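(* The following decision problem is NP-complete: given a finite table $\mathbf{r}$, a non-empty set $X$ of attributes and two attributes $A, B$, decide whether the unconditional implicit-to-implicit order compatibility (I/I OC) $X\colon A^*\sim B^*$ is valid over $\mathbf{r}$.
   Context: A table $\mathbf{r}$ is a finite collection of tuples. The partition groups of $\mathbf r$ by an attribute set $X$ are the maximal sets of tuples agreeing on all attributes of $X$. A strong total order is a transitive, irreflexive relation in which any two distinct elements are comparable; a strong partial order is a transitive, irreflexive (hence antisymmetric) relation. For a strong total order $T$ on a set of tuples and an attribute $C$, list the $C$-values of the tuples in the order $T$ and collapse adjacent equal values. If no value then occurs twice, $T$ is said to project to a strong total order on $C$'s values, called the order derived from $T$ on $C$. A witness for $A^*\sim B^*$ over a set $E$ of tuples is a strong total order on $E$ that projects to a strong total order both on the $A$-values and on the $B$-values of $E$. (No order on $A$ or $B$ is given.) The unconditional I/I OC $X\colon A^*\sim B^*$ is valid over $\mathbf r$ if there are a strong partial order $P_A$ on the $A$-values, a strong partial order $P_B$ on the $B$-values, and, for every partition group of $\mathbf r$ by $X$, a witness whose derived orders on $A$ and on $B$ are contained in $P_A$ and $P_B$, respectively. *)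

theory Defs
  imports "HOL-Computational_Algebra.Polynomial"
begin

section \<open>Unconditional I/I order compatibilities\<close>

text \<open>
  A table is a finite set \<open>R\<close> of tuples together with a function \<open>val\<close> giving the value of each
  tuple at each attribute. Tuples are thus identified independently of their values, so that
  a table may contain duplicates.
\<close>

definition strong_total_order_on :: "'t set \<Rightarrow> 't rel \<Rightarrow> bool" where
  "strong_total_order_on E T \<longleftrightarrow> T \<subseteq> E \<times> E \<and> strict_linear_order_on E T"

definition strong_partial_order_on :: "'v set \<Rightarrow> 'v rel \<Rightarrow> bool" where
  "strong_partial_order_on V P \<longleftrightarrow> P \<subseteq> V \<times> V \<and> trans P \<and> irrefl P"

definition agree_on :: "('t \<Rightarrow> 'a \<Rightarrow> 'v) \<Rightarrow> 'a set \<Rightarrow> 't set \<Rightarrow> bool" where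
  "agree_on val X G \<longleftrightarrow> (\<forall>s\<in>G. \<forall>t\<in>G. \<forall>a\<in>X. val s a = val t a)"

definition partition_groups :: "'t set \<Rightarrow> ('t \<Rightarrow> 'a \<Rightarrow> 'v) \<Rightarrow> 'a set \<Rightarrow> 't set set" where
  "partition_groups R val X =
     {G. G \<subseteq> R \<and> agree_on val X G \<and> (\<forall>H. G \<subseteq> H \<and> H \<subseteq> R \<and> agree_on val X H \<longrightarrow> H = G)}"

definition listing :: "'t set \<Rightarrow> 't rel \<Rightarrow> 't list" where
  "listing E T = (THE ts. distinct ts \<and> set ts = E \<and> sorted_wrt (\<lambda>s t. (s, t) \<in> T) ts)"

text \<open>
  The existence and uniqueness underlying \<open>listing\<close>, for the finite sets it is applied to.
\<close>

lemma listing_ex1: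
  assumes "finite E" and "strong_total_order_on E T"
  shows "\<exists>!ts. distinct ts \<and> set ts = E \<and> sorted_wrt (\<lambda>s t. (s, t) \<in> T) ts"
proof -
  have T: "trans T" "irrefl T" "total_on E T"
    using assms(2) by (auto simp: strong_total_order_on_def strict_linear_order_on_def)
  have "\<exists>ts. distinct ts \<and> set ts = F \<and> sorted_wrt (\<lambda>s t. (s, t) \<in> T) ts"
    if "finite F" "F \<subseteq> E" for F
    using that
  proof (induction F rule: finite_induct)
    case (insert x F)
    then obtain ts where ts: "distinct ts" "set ts = F" "sorted_wrt (\<lambda>s t. (s, t) \<in> T) ts"
      by auto
    let ?l = "filter (\<lambda>t. (t, x) \<in> T) ts @ x # filter (\<lambda>t. (x, t) \<in> T) ts"
    have cmp: "(t, x) \<in> T \<or> (x, t) \<in> T" if "t \<in> F" for t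
      using that insert.hyps insert.prems T(3) by (auto simp: total_on_def)
    have "\<not> ((t, x) \<in> T \<and> (x, t) \<in> T)" for t
      using transD[OF T(1), of t x t] irreflD[OF T(2), of t] by blast
    then have "distinct ?l"
      using ts insert.hyps by auto
    moreover have "set ?l = insert x F"
      using ts(2) cmp by auto
    moreover have "sorted_wrt (\<lambda>s t. (s, t) \<in> T) ?l"
      using ts(3) transD[OF T(1), of _ x] by (auto simp: sorted_wrt_append sorted_wrt_filter)
    ultimately show ?case by blast
  qed simp
  moreover have "ts = us"
    if "set ts = set us" and "distinct ts" "sorted_wrt (\<lambda>s t. (s, t) \<in> T) ts"
      and "distinct us" "sorted_wrt (\<lambda>s t. (s, t) \<in> T) us" for ts us
    using that
  proof (induction ts arbitrary: us)
    case (Cons t ts)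
    then obtain u us' where us: "us = u # us'"
      by (cases us) auto
    have ins: "insert t (set ts) = insert u (set us')"
      using Cons.prems(1) by (simp only: us list.set)
    have 1: "t \<notin> set ts" "distinct ts" "\<forall>v\<in>set ts. (t, v) \<in> T"
      "sorted_wrt (\<lambda>s t. (s, t) \<in> T) ts"
      using Cons.prems(2,3) by simp_all
    have 2: "u \<notin> set us'" "distinct us'" "\<forall>v\<in>set us'. (u, v) \<in> T"
      "sorted_wrt (\<lambda>s t. (s, t) \<in> T) us'"
      using Cons.prems(4,5) by (simp_all add: us)
    have "t = u"
    proof (rule ccontr)
      assume "t \<noteq> u"
      then have "t \<in> set us'" "u \<in> set ts"
        using ins by (metis insertE insertI1)+
      then have "(u, t) \<in> T" "(t, u) \<in> T"
        using 1(3) 2(3) by simp_all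
      then show False
        using transD[OF T(1), of t u t] irreflD[OF T(2), of t] by blast
    qed
    then have "set ts = set us'"
      using ins 1(1) 2(1) by (simp add: insert_ident)
    then have "ts = us'"
      using Cons.IH[of us'] 1(2,4) 2(2,4) by simp
    with \<open>t = u\<close> show ?case
      using us by simp
  qed simp
  ultimately show ?thesis
    using assms(1) by (intro ex_ex1I) blast+
qed

text \<open>The values of an attribute in the order of \<open>T\<close>, adjacent equal values being collapsed.\<close>

definition collapsed_values :: "'t set \<Rightarrow> 't rel \<Rightarrow> ('t \<Rightarrow> 'v) \<Rightarrow> 'v list" where
  "collapsed_values E T c = remdups_adj (map c (listing E T))"

definition projects :: "'t set \<Rightarrow> 't rel \<Rightarrow> ('t \<Rightarrow> 'v) \<Rightarrow> bool" where
  "projects E T c \<longleftrightarrow> distinct (collapsed_values E T c)"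

definition derived_order :: "'t set \<Rightarrow> 't rel \<Rightarrow> ('t \<Rightarrow> 'v) \<Rightarrow> 'v rel" where
  "derived_order E T c =
     {(collapsed_values E T c ! i, collapsed_values E T c ! j) | i j.
        i < j \<and> j < length (collapsed_values E T c)}"

definition witness :: "'t set \<Rightarrow> ('t \<Rightarrow> 'v) \<Rightarrow> ('t \<Rightarrow> 'v) \<Rightarrow> 't rel \<Rightarrow> bool" where
  "witness E a b T \<longleftrightarrow> strong_total_order_on E T \<and> projects E T a \<and> projects E T b"

definition unconditional_oc_valid ::
  "'t set \<Rightarrow> ('t \<Rightarrow> 'a \<Rightarrow> 'v) \<Rightarrow> 'a set \<Rightarrow> 'a \<Rightarrow> 'a \<Rightarrow> bool" where
  "unconditional_oc_valid R val X A B \<longleftrightarrow>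
     (\<exists>PA PB.
        strong_partial_order_on ((\<lambda>t. val t A) ` R) PA \<and>
        strong_partial_order_on ((\<lambda>t. val t B) ` R) PB \<and>
        (\<forall>G\<in>partition_groups R val X. \<exists>T.
           witness G (\<lambda>t. val t A) (\<lambda>t. val t B) T \<and>
           derived_order G T (\<lambda>t. val t A) \<subseteq> PA \<and>
           derived_order G T (\<lambda>t. val t B) \<subseteq> PB))"


section \<open>Instances of the decision problem and their encoding as bit strings\<close>

text \<open>
  Attribute names and attribute values are arbitrary bit strings. A row lists the values of
  one tuple in the order of the schema; the tuples of the table are the row indices.
\<close>

record oc_instance =
  schema :: "bool list list"
  rows :: "bool list list list"
  ctx_attrs :: "bool list list"
  attr_A :: "bool list"
  attr_B :: "bool list"

definition wf_instance :: "oc_instance \<Rightarrow> bool" where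
  "wf_instance I \<longleftrightarrow>
     distinct (schema I) \<and> (\<forall>row\<in>set (rows I). length row = length (schema I)) \<and>
     ctx_attrs I \<noteq> [] \<and> set (ctx_attrs I) \<subseteq> set (schema I) \<and>
     attr_A I \<in> set (schema I) \<and> attr_B I \<in> set (schema I)"

definition tuple_value :: "oc_instance \<Rightarrow> nat \<Rightarrow> bool list \<Rightarrow> bool list" where
  "tuple_value I t a = the (map_of (zip (schema I) (rows I ! t)) a)"

definition instance_valid :: "oc_instance \<Rightarrow> bool" where
  "instance_valid I \<longleftrightarrow>
     unconditional_oc_valid {..<length (rows I)} (tuple_value I)
       (set (ctx_attrs I)) (attr_A I) (attr_B I)"

text \<open>
  Self-delimiting encodings: every list element is preceded by a 1, and the list is closed by a 0.
\<close>

definition encode_list :: "('x \<Rightarrow> bool list) \<Rightarrow> 'x list \<Rightarrow> bool list" where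
  "encode_list e xs = concat (map (\<lambda>x. True # e x) xs) @ [False]"

definition encode_string :: "bool list \<Rightarrow> bool list" where
  "encode_string = encode_list (\<lambda>b. [b])"

definition encode_instance :: "oc_instance \<Rightarrow> bool list" where
  "encode_instance I =
     encode_list encode_string (schema I) @
     encode_list (encode_list encode_string) (rows I) @
     encode_list encode_string (ctx_attrs I) @
     encode_string (attr_A I) @ encode_string (attr_B I)"

lemma encode_list_prefix_free:
  assumes "\<And>x y u v. e x @ u = e y @ v \<Longrightarrow> x = y \<and> u = v"
    and "encode_list e xs @ u = encode_list e ys @ v"
  shows "xs = ys \<and> u = v"
  using assms(2)
proof (induction xs arbitrary: ys)
  case Nil
  then show ?case by (cases ys) (auto simp: encode_list_def)
next
  case (Cons x xs)
  then obtain y ys' where ys: "ys = y # ys'"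
    by (cases ys) (auto simp: encode_list_def)
  have "e x @ (encode_list e xs @ u) = e y @ (encode_list e ys' @ v)"
    using Cons.prems by (simp add: encode_list_def ys)
  from assms(1)[OF this] Cons.IH ys show ?case by blast
qed

lemma encode_string_prefix_free:
  "encode_string x @ u = encode_string y @ v \<Longrightarrow> x = y \<and> u = v"
  unfolding encode_string_def by (rule encode_list_prefix_free) auto

lemma inj_encode_instance: "inj encode_instance"
proof (rule injI)
  fix I J assume eq: "encode_instance I = encode_instance J"
  have l: "xs = ys \<and> u = v"
    if "encode_list encode_string xs @ u = encode_list encode_string ys @ v" for xs ys u v
    using encode_string_prefix_free that by (rule encode_list_prefix_free)
  have ll: "xs = ys \<and> u = v"
    if "encode_list (encode_list encode_string) xs @ u = encode_list (encode_list encode_string) ys @ v"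
    for xs ys u v
    using l that by (rule encode_list_prefix_free)
  have 1: "schema I = schema J" and
    e1: "encode_list (encode_list encode_string) (rows I) @
      encode_list encode_string (ctx_attrs I) @
      encode_string (attr_A I) @ encode_string (attr_B I) =
      encode_list (encode_list encode_string) (rows J) @
      encode_list encode_string (ctx_attrs J) @
      encode_string (attr_A J) @ encode_string (attr_B J)"
    using l[OF eq[unfolded encode_instance_def]] by auto
  have 2: "rows I = rows J" and
    e2: "encode_list encode_string (ctx_attrs I) @
      encode_string (attr_A I) @ encode_string (attr_B I) =
      encode_list encode_string (ctx_attrs J) @
      encode_string (attr_A J) @ encode_string (attr_B J)"
    using ll[OF e1] by auto
  have 3: "ctx_attrs I = ctx_attrs J" and
    e3: "encode_string (attr_A I) @ encode_string (attr_B I) =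
      encode_string (attr_A J) @ encode_string (attr_B J)"
    using l[OF e2] by auto
  have 4: "attr_A I = attr_A J" and e4: "encode_string (attr_B I) @ [] = encode_string (attr_B J) @ []"
    using encode_string_prefix_free[OF e3] by auto
  have 5: "attr_B I = attr_B J"
    using encode_string_prefix_free[OF e4] by auto
  show "I = J" using 1 2 3 4 5 by simp
qed


section \<open>Turing machines\<close>

text \<open>
  Deterministic multi-tape Turing machines. States and tape symbols are initial segments of
  the natural numbers; state 0 is the start state, symbol 0 is the blank, and the symbols 1 and 2
  represent the bits 0 and 1. The tapes are infinite in both directions. A machine halts
  when its transition function is undefined. Tape 0 holds the input, tape 1 the output.
\<close>

datatype move = Go_Left | Stay | Go_Right

record turing_machine =
  num_tapes :: nat
  num_symbols :: nat
  num_states :: nat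
  delta :: "nat \<Rightarrow> nat list \<Rightarrow> (nat \<times> (nat \<times> move) list) option"

definition wf_tm :: "turing_machine \<Rightarrow> bool" where
  "wf_tm M \<longleftrightarrow>
     num_tapes M \<ge> 2 \<and> num_symbols M \<ge> 3 \<and> num_states M \<ge> 1 \<and>
     (\<forall>q ss q' acts.
        q < num_states M \<and> length ss = num_tapes M \<and> (\<forall>s\<in>set ss. s < num_symbols M) \<and>
        delta M q ss = Some (q', acts) \<longrightarrow>
        q' < num_states M \<and> length acts = num_tapes M \<and>
        (\<forall>(s, d)\<in>set acts. s < num_symbols M))"

text \<open>A tape consists of its contents and the position of the head.\<close>

type_synonym tape = "(int \<Rightarrow> nat) \<times> int"
type_synonym config = "nat \<times> tape list"

fun act :: "nat \<times> move \<Rightarrow> tape \<Rightarrow> tape" where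
  "act (s, d) (f, h) =
     (f(h := s), (case d of Go_Left \<Rightarrow> h - 1 | Stay \<Rightarrow> h | Go_Right \<Rightarrow> h + 1))"

definition next_action :: "turing_machine \<Rightarrow> config \<Rightarrow> (nat \<times> (nat \<times> move) list) option" where
  "next_action M c = delta M (fst c) (map (\<lambda>(f, h). f h) (snd c))"

definition halted :: "turing_machine \<Rightarrow> config \<Rightarrow> bool" where
  "halted M c \<longleftrightarrow> next_action M c = None"

text \<open>A halted configuration is left unchanged.\<close>

definition step :: "turing_machine \<Rightarrow> config \<Rightarrow> config" where
  "step M c =
     (case next_action M c of
        None \<Rightarrow> c
      | Some (q', acts) \<Rightarrow> (q', map2 act acts (snd c)))"

definition word_contents :: "bool list \<Rightarrow> int \<Rightarrow> nat" where
  "word_contents w i =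
     (if 0 \<le> i \<and> i < int (length w) then (if w ! nat i then 2 else 1) else 0)"

definition initial_config :: "turing_machine \<Rightarrow> bool list \<Rightarrow> config" where
  "initial_config M x =
     (0, (word_contents x, 0) # replicate (num_tapes M - 1) (word_contents [], 0))"

definition computes_in_time ::
  "turing_machine \<Rightarrow> (bool list \<Rightarrow> bool list) \<Rightarrow> (nat \<Rightarrow> nat) \<Rightarrow> bool" where
  "computes_in_time M f T \<longleftrightarrow>
     (\<forall>x. let c = (step M ^^ T (length x)) (initial_config M x)
          in halted M c \<and> fst (snd c ! 1) = word_contents (f x))"


section \<open>NP-completeness\<close>

definition polytime_computable :: "(bool list \<Rightarrow> bool list) \<Rightarrow> bool" where
  "polytime_computable f \<longleftrightarrow>
     (\<exists>M (p :: nat poly). wf_tm M \<and> computes_in_time M f (poly p))"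

text \<open>The input of a verifier is the pair of the instance and a certificate.\<close>

definition encode_pair :: "bool list \<Rightarrow> bool list \<Rightarrow> bool list" where
  "encode_pair x u = encode_string x @ u"

definition in_NP :: "bool list set \<Rightarrow> bool" where
  "in_NP L \<longleftrightarrow>
     (\<exists>f (p :: nat poly). polytime_computable f \<and>
        (\<forall>x. x \<in> L \<longleftrightarrow>
           (\<exists>u. length u \<le> poly p (length x) \<and> f (encode_pair x u) = [True])))"

definition polytime_reducible :: "bool list set \<Rightarrow> bool list set \<Rightarrow> bool" where
  "polytime_reducible L L' \<longleftrightarrow>
     (\<exists>f. polytime_computable f \<and> (\<forall>x. x \<in> L \<longleftrightarrow> f x \<in> L'))"

definition NP_hard :: "bool list set \<Rightarrow> bool" where
  "NP_hard L \<longleftrightarrow> (\<forall>L'. in_NP L' \<longrightarrow> polytime_reducible L' L)"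

definition NP_complete :: "bool list set \<Rightarrow> bool" where
  "NP_complete L \<longleftrightarrow> in_NP L \<and> NP_hard L"

end

theory Submission
  imports Defs
begin

text \<open>
  Both parts of the statement rest on a rank characterisation: the dependency is valid iff there are functions
  \<open>\<alpha>\<close> and \<open>\<beta>\<close> from the values to the natural numbers such that, within each group, \<open>\<alpha>\<close> separates the
  \<open>A\<close>-values, \<open>\<beta>\<close> separates the \<open>B\<close>-values, and no two tuples are ordered in opposite ways by \<open>\<alpha>\<close> and
  \<open>\<beta>\<close>. (Count predecessors in the partial orders; conversely, sort each group lexicographically by the ranks.)
  The condition only concerns pairs of tuples, so that the ranks are a certificate.

  For hardness, the computation of a verifier is written as a CNF formula, and the literals of
  every clause are arranged on a cycle of \<open>A\<close>-values together with one further fixed literal. Three tuples per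
  literal tie the direction of its edge to the order of two \<open>B\<close>-values belonging to the variable. The
  order of the \<open>A\<close>-values being acyclic, this is satisfiability with the requirement that the literals
  of a cycle are not all equal; negating an assignment, one may take the fixed literal to be false.

  Polynomial-time computability is obtained for functions on data encoded as binary trees, from
  closure properties (composition, pairing, case distinction, folds with bounded growth) that are
  implemented by programs on stacks, in which each stack is a tape of a Turing machine.
\<close>

section \<open>A structured stack language and its translation to Turing machines\<close>

text \<open>Different groups interact only through the two shared partial orders. In the reduction
  every edge of a cycle is a group of its own, the edges of one clause share
  \<open>A\<close>-values, and all occurrences of a variable share its two \<open>B\<close>-values.

  Reversing all orders preserves validity, so orders represent truth values only up to a common
  complement. A clause is not invariant under complement, whereas the requirement that the literals
  of a cycle are not all equal is; the fixed literal, common to all clauses, serves as the reference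
  value that turns the latter into the former.

  The certificate is polynomial because counting predecessors yields ranks bounded by the number of
  tuples. All numbers can therefore be unary: ranks, clock times and tape columns are polynomial in
  the input.

  The encoding of an instance is never parsed. A certificate contains the instance in tree form, and
  the verifier encodes it and compares the result with its input.

  The tableau only derives positive facts. A satisfying assignment may contain contradictory
  additional facts; it is enough that it contains the facts of one actual computation, on which the
  final clauses then act.\<close>

type_synonym store = "nat \<Rightarrow> bool list"

datatype com =
    Skip
  | Push nat bool
  | Pop nat
  | Out bool
  | Seq com com
  | Cond nat "bool option \<Rightarrow> bool" com com
  | While nat "bool option \<Rightarrow> bool" com

definition top_of :: "'x list \<Rightarrow> 'x option" where
  "top_of xs = (case xs of [] \<Rightarrow> None | x # _ \<Rightarrow> Some x)"

lemma top_of_simps [simp]: "top_of [] = None" "top_of (x # xs) = Some x"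
  by (simp_all add: top_of_def)

text \<open>Register 1 is the output tape, which can only be appended to; the others are stacks.\<close>

inductive exec :: "com \<Rightarrow> store \<Rightarrow> nat \<Rightarrow> store \<Rightarrow> bool" where
  Skip: "exec Skip \<sigma> 0 \<sigma>"
| Push: "r \<noteq> 1 \<Longrightarrow> exec (Push r b) \<sigma> 2 (\<sigma>(r := b # \<sigma> r))"
| Pop: "r \<noteq> 1 \<Longrightarrow> exec (Pop r) \<sigma> 1 (\<sigma>(r := tl (\<sigma> r)))"
| Out: "exec (Out b) \<sigma> 1 (\<sigma>(1 := \<sigma> 1 @ [b]))"
| Seq: "exec c \<sigma> t \<sigma>' \<Longrightarrow> exec c' \<sigma>' t' \<sigma>'' \<Longrightarrow> exec (Seq c c') \<sigma> (t + t') \<sigma>''"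
| IfT: "r \<noteq> 1 \<Longrightarrow> P (top_of (\<sigma> r)) \<Longrightarrow> exec c \<sigma> t \<sigma>' \<Longrightarrow> exec (Cond r P c c') \<sigma> (1 + t + 1) \<sigma>'"
| IfF: "r \<noteq> 1 \<Longrightarrow> \<not> P (top_of (\<sigma> r)) \<Longrightarrow> exec c' \<sigma> t \<sigma>' \<Longrightarrow> exec (Cond r P c c') \<sigma> (1 + t) \<sigma>'"
| WhileT: "r \<noteq> 1 \<Longrightarrow> P (top_of (\<sigma> r)) \<Longrightarrow> exec c \<sigma> t \<sigma>' \<Longrightarrow> exec (While r P c) \<sigma>' t' \<sigma>'' \<Longrightarrow>
    exec (While r P c) \<sigma> (1 + t + 1 + t') \<sigma>''"
| WhileF: "r \<noteq> 1 \<Longrightarrow> \<not> P (top_of (\<sigma> r)) \<Longrightarrow> exec (While r P c) \<sigma> 1 \<sigma>"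

fun regs :: "com \<Rightarrow> nat set" where
  "regs Skip = {}"
| "regs (Push r b) = {r}"
| "regs (Pop r) = {r}"
| "regs (Out b) = {1}"
| "regs (Seq c c') = regs c \<union> regs c'"
| "regs (Cond r P c c') = {r} \<union> regs c \<union> regs c'"
| "regs (While r P c) = {r} \<union> regs c"

lemma finite_regs: "finite (regs c)"
  by (induction c) auto

text \<open>An instruction reads and rewrites a single tape; it is a tape number together with the
  symbol to be written, the move of the head and the next state as a function of the symbol read.\<close>

type_synonym instr = "nat \<times> (nat \<Rightarrow> nat \<times> move \<times> nat)"

section \<open>Compilation of programs into instructions on single tapes\<close>

definition bit_sym :: "bool \<Rightarrow> nat" where
  "bit_sym b = (if b then 2 else 1)"

definition sym_bit :: "nat \<Rightarrow> bool option" where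
  "sym_bit s = (if s = 0 then None else Some (s = 2))"

fun code_size :: "com \<Rightarrow> nat" where
  "code_size Skip = 0"
| "code_size (Push r b) = 2"
| "code_size (Pop r) = 1"
| "code_size (Out b) = 1"
| "code_size (Seq c c') = code_size c + code_size c'"
| "code_size (Cond r P c c') = 2 + code_size c + code_size c'"
| "code_size (While r P c) = 2 + code_size c"

fun compile :: "com \<Rightarrow> nat \<Rightarrow> instr list" where
  "compile Skip a = []"
| "compile (Push r b) a = [(r, \<lambda>s. (s, Go_Left, a + 1)), (r, \<lambda>s. (bit_sym b, Stay, a + 2))]"
| "compile (Pop r) a = [(r, \<lambda>s. (0, Go_Right, a + 1))]"
| "compile (Out b) a = [(1, \<lambda>s. (bit_sym b, Go_Right, a + 1))]"
| "compile (Seq c c') a = compile c a @ compile c' (a + code_size c)"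
| "compile (Cond r P c c') a =
     (r, \<lambda>s. (s, Stay, if P (sym_bit s) then a + 1 else a + 2 + code_size c)) # compile c (a + 1) @
     (r, \<lambda>s. (s, Stay, a + 2 + code_size c + code_size c')) # compile c' (a + 2 + code_size c)"
| "compile (While r P c) a =
     (r, \<lambda>s. (s, Stay, if P (sym_bit s) then a + 1 else a + 2 + code_size c)) # compile c (a + 1) @
     [(r, \<lambda>s. (s, Stay, a))]"

lemma length_compile: "length (compile c a) = code_size c"
  by (induction c arbitrary: a) auto

lemma compile_wf:
  assumes "(r, g) \<in> set (compile c a)" and "s < 3"
  shows "r \<in> regs c \<and> (case g s of (s', d, q) \<Rightarrow> s' < 3 \<and> q \<le> a + code_size c)"
  using assms by (induction c arbitrary: a) (force simp: bit_sym_def)+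

text \<open>All other tapes rewrite the scanned symbol and stay. No instruction exists at the first
  address past the code, so the machine halts there; this address is the additional state of
  \<open>com_tm\<close>.\<close>

definition instr_delta :: "instr list \<Rightarrow> nat \<Rightarrow> nat list \<Rightarrow> (nat \<times> (nat \<times> move) list) option" where
  "instr_delta ins q ss =
     (if q < length ins then
        (case ins ! q of (r, g) \<Rightarrow> (case g (ss ! r) of (s, d, q') \<Rightarrow>
           Some (q', (map (\<lambda>s. (s, Stay)) ss)[r := (s, d)])))
      else None)"

definition com_tm :: "nat \<Rightarrow> com \<Rightarrow> turing_machine" where
  "com_tm k c = \<lparr>num_tapes = k, num_symbols = 3, num_states = code_size c + 1,
     delta = instr_delta (compile c 0)\<rparr>"

lemma wf_com_tm:
  assumes "k \<ge> 2" and "regs c \<subseteq> {..<k}"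
  shows "wf_tm (com_tm k c)"
proof -
  have "q' < code_size c + 1 \<and> length acts = k \<and> (\<forall>(s, d)\<in>set acts. s < 3)"
    if "length ss = k" "\<forall>s\<in>set ss. s < 3" and d: "instr_delta (compile c 0) q ss = Some (q', acts)"
    for q ss q' acts
  proof -
    obtain r g where rg: "compile c 0 ! q = (r, g)" by fastforce
    obtain s m p where g: "g (ss ! r) = (s, m, p)" by (metis prod_cases3)
    have q: "q < length (compile c 0)"
      using d by (auto simp: instr_delta_def split: if_splits)
    then have "(r, g) \<in> set (compile c 0)"
      using rg by (metis nth_mem)
    from compile_wf[OF this] have "r \<in> regs c" by (metis zero_less_numeral)
    then have "r < k" using assms by auto
    then have "ss ! r < 3" using that by auto
    from compile_wf[OF \<open>(r, g) \<in> _\<close> this] have "s < 3 \<and> p \<le> code_size c"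
      using g by simp
    moreover have "q' = p" "acts = (map (\<lambda>s. (s, Stay)) ss)[r := (s, m)]"
      using d q rg g by (auto simp: instr_delta_def)
    ultimately show ?thesis
      using that set_update_subset_insert[of "map (\<lambda>s. (s, Stay)) ss" r "(s, m)"] by fastforce
  qed
  then show ?thesis
    using assms(1) unfolding wf_tm_def com_tm_def by simp blast
qed

text \<open>A stack is located relative to the head, its top being scanned and all cells outside it
  being blank. It grows to the left, and an initial input tape is already a stack. The output must
  start at the absolute position 0, so its tape can only be extended at the right end.\<close>

definition tape_repr :: "nat \<Rightarrow> bool list \<Rightarrow> tape \<Rightarrow> bool" where
  "tape_repr i w tp =
     (if i = 1 then tp = (word_contents w, int (length w))
      else fst tp = (\<lambda>x. word_contents w (x - snd tp)))"

definition store_repr :: "nat \<Rightarrow> store \<Rightarrow> tape list \<Rightarrow> bool" where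
  "store_repr k \<sigma> tps \<longleftrightarrow> length tps = k \<and> (\<forall>i<k. tape_repr i (\<sigma> i) (tps ! i))"

lemma word_contents_0: "word_contents w 0 = (case top_of w of None \<Rightarrow> 0 | Some b \<Rightarrow> bit_sym b)"
  by (cases w) (auto simp: word_contents_def bit_sym_def)

lemma word_contents_Cons: "word_contents (b # w) x = (if x = 0 then bit_sym b else word_contents w (x - 1))"
  by (auto simp: word_contents_def bit_sym_def nth_Cons nat_diff_distrib split: nat.splits)

lemma word_contents_tl: "word_contents (tl w) x = (if x = -1 then 0 else word_contents w (x + 1))"
proof (cases w)
  case Nil
  then show ?thesis by (auto simp: word_contents_def)
next
  case (Cons b v)
  then show ?thesis by (auto simp: word_contents_Cons) (auto simp: word_contents_def)
qed

lemma word_contents_append1: "word_contents (w @ [b]) = (word_contents w)(int (length w) := bit_sym b)"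
  by (auto simp: word_contents_def bit_sym_def nth_append fun_eq_iff nat_less_iff)

lemma sym_bit_top:
  assumes "tape_repr i w (f, h)" "i \<noteq> 1"
  shows "sym_bit (f h) = top_of w"
  using assms by (auto simp: tape_repr_def word_contents_0 sym_bit_def bit_sym_def split: option.splits)

lemma step_instr:
  assumes "q < length ins" "ins ! q = (r, g)" "r < length tps" "tps ! r = (f, h)" "g (f h) = (s, d, q')"
    and "delta M = instr_delta ins"
  shows "step M (q, tps) = (q', tps[r := act (s, d) (f, h)])"
proof -
  let ?ss = "map (\<lambda>(f, h). f h) tps"
  have "next_action M (q, tps) = Some (q', (map (\<lambda>s. (s, Stay)) ?ss)[r := (s, d)])"
    using assms by (simp add: next_action_def instr_delta_def)
  moreover have "map2 act ((map (\<lambda>s. (s, Stay)) ?ss)[r := (s, d)]) tps = tps[r := act (s, d) (f, h)]"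
    using assms by (intro nth_equalityI) (auto simp: nth_list_update split: prod.splits)
  ultimately show ?thesis by (simp add: step_def)
qed

lemma store_repr_update:
  assumes "store_repr k \<sigma> tps" "r < k" "tape_repr r w tp"
  shows "store_repr k (\<sigma>(r := w)) (tps[r := tp])"
  using assms by (auto simp: store_repr_def nth_list_update)

lemma step_instr_repr:
  assumes "q < length ins" "ins ! q = (r, g)" "delta M = instr_delta ins" "store_repr k \<sigma> tps" "r < k"
    and "\<And>f h. tape_repr r (\<sigma> r) (f, h) \<Longrightarrow>
           (case g (f h) of (s, d, q'') \<Rightarrow> q'' = q' \<and> tape_repr r w (act (s, d) (f, h)))"
  shows "\<exists>tps'. step M (q, tps) = (q', tps') \<and> store_repr k (\<sigma>(r := w)) tps'"
proof -
  obtain f h where fh: "tps ! r = (f, h)" by fastforce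
  obtain s d q'' where g: "g (f h) = (s, d, q'')" by (metis prod_cases3)
  have "tape_repr r (\<sigma> r) (f, h)" using assms(4,5) fh by (auto simp: store_repr_def)
  from assms(6)[OF this] g have "q'' = q'" "tape_repr r w (act (s, d) (f, h))" by auto
  then show ?thesis
    using step_instr[OF assms(1,2) _ fh g assms(3)] store_repr_update[OF assms(4,5)] assms(4,5)
    by (auto simp: store_repr_def)
qed

lemma funpow_trans:
  fixes f :: "'x \<Rightarrow> 'x"
  shows "(f ^^ m) x = y \<Longrightarrow> (f ^^ n) y = z \<Longrightarrow> (f ^^ (m + n)) x = z"
  by (metis add.commute comp_apply funpow_add)

lemma funpow_1:
  fixes f :: "'x \<Rightarrow> 'x"
  shows "f x = y \<Longrightarrow> (f ^^ 1) x = y"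
  by simp

lemma nth_append_Cons: "(pre @ x # post) ! length pre = x"
  by simp

text \<open>The times in \<open>exec\<close> are the exact numbers of machine steps; the additional
  step of a true \<open>Cond\<close> is the jump over the other branch. Jump targets are absolute,
  hence the code between arbitrary \<open>pre\<close> and \<open>post\<close>.\<close>

lemma exec_steps:
  assumes "exec c \<sigma> t \<sigma>'" "delta M = instr_delta ins" "ins = pre @ compile c (length pre) @ post"
    and "regs c \<subseteq> {..<k}" "store_repr k \<sigma> tps"
  shows "\<exists>tps'. (step M ^^ t) (length pre, tps) = (length pre + code_size c, tps') \<and> store_repr k \<sigma>' tps'"
  using assms(1,3-)
proof (induction c \<sigma> t \<sigma>' arbitrary: pre post tps rule: exec.induct)
  case (Skip \<sigma>)
  then show ?case by auto
next
  case (Push r b \<sigma>)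
  let ?p = "length pre"
  let ?m = "\<sigma>(r := \<sigma> r)"
  obtain f h where fh: "tps ! r = (f, h)" by fastforce
  have tr: "f = (\<lambda>x. word_contents (\<sigma> r) (x - h))" "r < length tps"
    using Push fh by (auto simp: store_repr_def tape_repr_def)
  \<comment> \<open>A transition writes before it moves, so a push takes two steps. After the first
    one the head is on the blank to the left of the stack, which in general represents no store;
    hence the explicit tapes.\<close>
  have eq: "act (f h, Go_Left) (f, h) = (f, h - 1)" by simp
  have s1: "step M (?p, tps) = (?p + 1, tps[r := (f, h - 1)])"
    unfolding eq[symmetric] using Push fh tr(2)
    by (intro step_instr[OF _ _ _ fh _ assms(2)]) (auto simp: nth_append)
  have s2: "step M (?p + 1, tps[r := (f, h - 1)]) =
     (?p + 2, tps[r := (f, h - 1), r := act (bit_sym b, Stay) (f, h - 1)])"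
    using Push.prems tr(2) by (intro step_instr[OF _ _ _ _ _ assms(2)]) (auto simp: nth_append)
  have "store_repr k (\<sigma>(r := b # \<sigma> r)) (tps[r := (f, h - 1), r := act (bit_sym b, Stay) (f, h - 1)])"
    using Push tr
    by (simp only: list_update_overwrite, intro store_repr_update)
      (auto simp: tape_repr_def word_contents_Cons fun_eq_iff algebra_simps)
  then show ?case
    using funpow_trans[OF funpow_1[of "step M", OF s1] funpow_1[of "step M", OF s2]]
    unfolding one_add_one code_size.simps by blast
next
  case (Pop r \<sigma>)
  have "\<exists>tps'. step M (length pre, tps) = (length pre + 1, tps') \<and> store_repr k (\<sigma>(r := tl (\<sigma> r))) tps'"
    using Pop assms(2)
    by (intro step_instr_repr[where ins = ins and r = r and g = "\<lambda>s. (0, Go_Right, length pre + 1)"])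
      (auto simp: tape_repr_def word_contents_tl fun_eq_iff algebra_simps)
  then show ?case using funpow_1[of "step M"] unfolding code_size.simps by blast
next
  case (Out b \<sigma>)
  have "\<exists>tps'. step M (length pre, tps) = (length pre + 1, tps') \<and> store_repr k (\<sigma>(1 := \<sigma> 1 @ [b])) tps'"
    using Out assms(2)
    by (intro step_instr_repr[where ins = ins and r = 1 and g = "\<lambda>s. (bit_sym b, Go_Right, length pre + 1)"])
      (auto simp: tape_repr_def word_contents_append1)
  then show ?case using funpow_1[of "step M"] unfolding code_size.simps by blast
next
  case (Seq c \<sigma> t \<sigma>' c' t' \<sigma>'')
  obtain tps' where 1: "(step M ^^ t) (length pre, tps) = (length pre + code_size c, tps')" "store_repr k \<sigma>' tps'"
    using Seq.IH(1)[of pre "compile c' (length pre + code_size c) @ post" tps] Seq.prems by auto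
  obtain tps'' where 2: "(step M ^^ t') (length pre + code_size c, tps') =
      (length pre + code_size c + code_size c', tps'')" "store_repr k \<sigma>'' tps''"
    using Seq.IH(2)[of "pre @ compile c (length pre)" post tps'] Seq.prems 1(2)
    by (auto simp: length_compile)
  show ?case using funpow_trans[OF 1(1) 2(1)] 2(2) by (auto simp: add.assoc)
next
  case (IfT r P \<sigma> c t \<sigma>' c')
  let ?g = "\<lambda>s. (s, Stay, if P (sym_bit s) then length pre + 1 else length pre + 2 + code_size c)"
  let ?e = "length pre + 2 + code_size c + code_size c'"
  let ?g' = "\<lambda>s::nat. (s, Stay, ?e)"
  obtain tps1 where 1: "step M (length pre, tps) = (length pre + 1, tps1)" "store_repr k \<sigma> tps1"
    using step_instr_repr[of "length pre" ins r ?g M k \<sigma> tps "length pre + 1" "\<sigma> r"] IfT sym_bit_top assms(2)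
    by auto
  obtain tps2 where 2: "(step M ^^ t) (length pre + 1, tps1) = (length pre + 1 + code_size c, tps2)"
      "store_repr k \<sigma>' tps2"
    using IfT.IH[of "pre @ [(r, ?g)]"
        "(r, ?g') # compile c' (length pre + 2 + code_size c) @ post" tps1] IfT.prems 1(2)
    by auto
  obtain tps3 where 3: "step M (length pre + 1 + code_size c, tps2) = (?e, tps3)" "store_repr k \<sigma>' tps3"
    using step_instr_repr[of "length pre + 1 + code_size c" ins r ?g' M k \<sigma>' tps2 ?e "\<sigma>' r"]
      IfT assms(2) 2(2) nth_append_Cons[of "pre @ (r, ?g) # compile c (length pre + 1)" "(r, ?g')"
        "compile c' (length pre + 2 + code_size c) @ post"]
    by (auto simp: length_compile)
  show ?case
    using funpow_trans[OF funpow_trans[OF funpow_1[of "step M", OF 1(1)] 2(1)] funpow_1[of "step M", OF 3(1)]] 3(2)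
    by (simp add: add.assoc)
next
  case (IfF r P \<sigma> c' t \<sigma>' c)
  let ?g = "\<lambda>s. (s, Stay, if P (sym_bit s) then length pre + 1 else length pre + 2 + code_size c)"
  let ?e = "length pre + 2 + code_size c + code_size c'"
  let ?g' = "\<lambda>s::nat. (s, Stay, ?e)"
  obtain tps1 where 1: "step M (length pre, tps) = (length pre + 2 + code_size c, tps1)" "store_repr k \<sigma> tps1"
    using step_instr_repr[of "length pre" ins r ?g M k \<sigma> tps "length pre + 2 + code_size c" "\<sigma> r"]
      IfF sym_bit_top assms(2) by auto
  obtain tps2 where 2: "(step M ^^ t) (length pre + 2 + code_size c, tps1) = (?e, tps2)"
      "store_repr k \<sigma>' tps2"
    using IfF.IH[of "pre @ (r, ?g) # compile c (length pre + 1) @ [(r, ?g')]" post tps1] IfF.prems 1(2)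
    by (auto simp: length_compile)
  show ?case
    using funpow_trans[OF funpow_1[of "step M", OF 1(1)] 2(1)] 2(2) by (auto simp: add.assoc)
next
  case (WhileT r P \<sigma> c t \<sigma>' t' \<sigma>'')
  let ?g = "\<lambda>s. (s, Stay, if P (sym_bit s) then length pre + 1 else length pre + 2 + code_size c)"
  let ?g' = "\<lambda>s::nat. (s, Stay, length pre)"
  obtain tps1 where 1: "step M (length pre, tps) = (length pre + 1, tps1)" "store_repr k \<sigma> tps1"
    using step_instr_repr[of "length pre" ins r ?g M k \<sigma> tps "length pre + 1" "\<sigma> r"] WhileT sym_bit_top assms(2)
    by auto
  obtain tps2 where 2: "(step M ^^ t) (length pre + 1, tps1) = (length pre + 1 + code_size c, tps2)"
      "store_repr k \<sigma>' tps2"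
    using WhileT.IH(1)[of "pre @ [(r, ?g)]" "(r, ?g') # post" tps1] WhileT.prems 1(2) by auto
  obtain tps3 where 3: "step M (length pre + 1 + code_size c, tps2) = (length pre, tps3)" "store_repr k \<sigma>' tps3"
    using step_instr_repr[of "length pre + 1 + code_size c" ins r ?g' M k \<sigma>' tps2 "length pre" "\<sigma>' r"]
      WhileT assms(2) 2(2) nth_append_Cons[of "pre @ (r, ?g) # compile c (length pre + 1)" "(r, ?g')" post]
    by (auto simp: length_compile)
  obtain tps4 where 4: "(step M ^^ t') (length pre, tps3) = (length pre + code_size (While r P c), tps4)"
      "store_repr k \<sigma>'' tps4"
    using WhileT.IH(2)[of pre post tps3] WhileT.prems 3(2) by blast
  show ?case
    using funpow_trans[OF funpow_trans[OF funpow_trans[OF funpow_1[of "step M", OF 1(1)] 2(1)]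
        funpow_1[of "step M", OF 3(1)]] 4(1)] 4(2) by (simp add: add.assoc)
next
  case (WhileF r P \<sigma> c)
  let ?g = "\<lambda>s. (s, Stay, if P (sym_bit s) then length pre + 1 else length pre + 2 + code_size c)"
  obtain tps1 where 1: "step M (length pre, tps) = (length pre + 2 + code_size c, tps1)" "store_repr k \<sigma> tps1"
    using step_instr_repr[of "length pre" ins r ?g M k \<sigma> tps "length pre + 2 + code_size c" "\<sigma> r"]
      WhileF sym_bit_top assms(2) by auto
  then show ?case by (auto simp: add.assoc)
qed

section \<open>From time-bounded programs to polynomial-time computability\<close>

lemma step_halted: "halted M c \<Longrightarrow> (step M ^^ n) c = c"
  by (induction n) (auto simp: halted_def step_def)

lemma step_funpow_halted:
  assumes "halted M ((step M ^^ m) c)" "m \<le> n"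
  shows "(step M ^^ n) c = (step M ^^ m) c"
  using funpow_trans[OF refl step_halted[OF assms(1)], of "n - m"] assms(2) by simp

definition run :: "com \<Rightarrow> store \<Rightarrow> store \<Rightarrow> nat \<Rightarrow> bool" where
  "run c \<sigma> \<sigma>' n \<longleftrightarrow> (\<exists>t\<le>n. exec c \<sigma> t \<sigma>')"

lemma polytime_computable_run:
  fixes p :: "nat poly"
  assumes "\<And>w. \<exists>\<sigma>. run c ((\<lambda>_. [])(0 := w)) \<sigma> (poly p (length w)) \<and> \<sigma> 1 = f w"
  shows "polytime_computable f"
proof -
  obtain k where k: "k \<ge> 2" "regs c \<subseteq> {..<k}"
  proof
    show "Max (insert 2 (Suc ` regs c)) \<ge> 2" by (simp add: finite_regs)
    show "regs c \<subseteq> {..<Max (insert 2 (Suc ` regs c))}"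
      using finite_regs[of c] by (auto simp: Suc_le_eq[symmetric] intro!: Max_ge)
  qed
  let ?M = "com_tm k c"
  have "let cf = (step ?M ^^ poly p (length x)) (initial_config ?M x)
        in halted ?M cf \<and> fst (snd cf ! 1) = word_contents (f x)" for x
  proof -
    obtain \<sigma> t where t: "t \<le> poly p (length x)" "exec c ((\<lambda>_. [])(0 := x)) t \<sigma>" "\<sigma> 1 = f x"
      using assms[of x] by (auto simp: run_def)
    let ?tps = "(word_contents x, 0) # replicate (k - 1) (word_contents [], 0)"
    have "store_repr k ((\<lambda>_. [])(0 := x)) ?tps"
      using k(1) by (auto simp: store_repr_def tape_repr_def nth_Cons word_contents_def split: nat.splits)
    moreover have "delta ?M = instr_delta (compile c 0)" "compile c 0 = [] @ compile c (length []) @ []"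
      by (simp_all add: com_tm_def)
    ultimately obtain tps' where tps': "(step ?M ^^ t) (0, ?tps) = (code_size c, tps')" "store_repr k \<sigma> tps'"
      using exec_steps[OF t(2) _ _ k(2)] by (metis add_0 list.size(3))
    have h: "halted ?M (code_size c, tps')"
      by (simp add: halted_def next_action_def com_tm_def instr_delta_def length_compile)
    have i: "initial_config ?M x = (0, ?tps)"
      by (simp add: initial_config_def com_tm_def)
    have "(step ?M ^^ poly p (length x)) (initial_config ?M x) = (code_size c, tps')"
      using step_funpow_halted[of ?M t "(0, ?tps)"] tps'(1) h t(1) i by metis
    moreover have "fst (tps' ! 1) = word_contents (f x)"
      using tps'(2) k(1) t(3) by (auto simp: store_repr_def tape_repr_def)
    ultimately show ?thesis using h by (simp add: Let_def)
  qed
  then show ?thesis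
    unfolding polytime_computable_def computes_in_time_def using wf_com_tm[OF k] by blast
qed

section \<open>Rules for time-bounded runs, and operations on whole registers\<close>

lemma run_mono: "run c \<sigma> \<sigma>' n \<Longrightarrow> n \<le> n' \<Longrightarrow> run c \<sigma> \<sigma>' n'"
  unfolding run_def using le_trans by blast

lemma run_Skip: "run Skip \<sigma> \<sigma> n"
  unfolding run_def using exec.Skip by blast

lemma run_Push: "r \<noteq> 1 \<Longrightarrow> \<sigma>' = \<sigma>(r := b # \<sigma> r) \<Longrightarrow> 2 \<le> n \<Longrightarrow> run (Push r b) \<sigma> \<sigma>' n"
  unfolding run_def using exec.Push by blast

lemma run_Pop: "r \<noteq> 1 \<Longrightarrow> \<sigma>' = \<sigma>(r := tl (\<sigma> r)) \<Longrightarrow> 1 \<le> n \<Longrightarrow> run (Pop r) \<sigma> \<sigma>' n"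
  unfolding run_def using exec.Pop by blast

lemma run_Out: "\<sigma>' = \<sigma>(1 := \<sigma> 1 @ [b]) \<Longrightarrow> 1 \<le> n \<Longrightarrow> run (Out b) \<sigma> \<sigma>' n"
  unfolding run_def using exec.Out by blast

lemma run_Seq:
  assumes "run c \<sigma> \<sigma>' n" "run c' \<sigma>' \<sigma>'' n'" "n + n' \<le> k"
  shows "run (Seq c c') \<sigma> \<sigma>'' k"
proof -
  obtain t t' where "t \<le> n" "exec c \<sigma> t \<sigma>'" "t' \<le> n'" "exec c' \<sigma>' t' \<sigma>''"
    using assms(1,2) unfolding run_def by blast
  then have "exec (Seq c c') \<sigma> (t + t') \<sigma>''" "t + t' \<le> k"
    using exec.Seq assms(3) by auto
  then show ?thesis unfolding run_def by blast
qed

lemma run_Cond: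
  assumes "r \<noteq> 1" "P (top_of (\<sigma> r)) \<Longrightarrow> run c \<sigma> \<sigma>' n" "\<not> P (top_of (\<sigma> r)) \<Longrightarrow> run c' \<sigma> \<sigma>' n" "n + 2 \<le> k"
  shows "run (Cond r P c c') \<sigma> \<sigma>' k"
proof (cases "P (top_of (\<sigma> r))")
  case True
  then obtain t where "t \<le> n" "exec c \<sigma> t \<sigma>'" using assms(2) unfolding run_def by blast
  then have "exec (Cond r P c c') \<sigma> (1 + t + 1) \<sigma>'" "1 + t + 1 \<le> k"
    using exec.IfT[of r P \<sigma> c t \<sigma>' c'] True assms by auto
  then show ?thesis unfolding run_def by blast
next
  case False
  then obtain t where "t \<le> n" "exec c' \<sigma> t \<sigma>'" using assms(3) unfolding run_def by blast
  then have "exec (Cond r P c c') \<sigma> (1 + t) \<sigma>'" "1 + t \<le> k"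
    using exec.IfF[of r P \<sigma> c' t \<sigma>' c] False assms by auto
  then show ?thesis unfolding run_def by blast
qed

lemma run_WhileT:
  assumes "r \<noteq> 1" "P (top_of (\<sigma> r))" "run c \<sigma> \<sigma>' n" "run (While r P c) \<sigma>' \<sigma>'' n'" "n + n' + 2 \<le> k"
  shows "run (While r P c) \<sigma> \<sigma>'' k"
proof -
  obtain t t' where "t \<le> n" "exec c \<sigma> t \<sigma>'" "t' \<le> n'" "exec (While r P c) \<sigma>' t' \<sigma>''"
    using assms(3,4) unfolding run_def by blast
  then have "exec (While r P c) \<sigma> (1 + t + 1 + t') \<sigma>''" "1 + t + 1 + t' \<le> k"
    using exec.WhileT[of r P \<sigma> c t \<sigma>' t' \<sigma>''] assms by auto
  then show ?thesis unfolding run_def by blast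
qed

lemma run_WhileF: "r \<noteq> 1 \<Longrightarrow> \<not> P (top_of (\<sigma> r)) \<Longrightarrow> 1 \<le> k \<Longrightarrow> run (While r P c) \<sigma> \<sigma> k"
  unfolding run_def using exec.WhileF by blast

abbreviation "nonempty x \<equiv> x \<noteq> None"
abbreviation "is_true x \<equiv> x = Some True"

definition rev_onto :: "nat \<Rightarrow> nat \<Rightarrow> com" where
  "rev_onto r s = While r (\<lambda>x. nonempty x) (Cond r (\<lambda>x. is_true x)
     (Seq (Pop r) (Push s True)) (Seq (Pop r) (Push s False)))"

definition rev_onto2 :: "nat \<Rightarrow> nat \<Rightarrow> nat \<Rightarrow> com" where
  "rev_onto2 r s s' = While r (\<lambda>x. nonempty x) (Cond r (\<lambda>x. is_true x)
     (Seq (Pop r) (Seq (Push s True) (Push s' True))) (Seq (Pop r) (Seq (Push s False) (Push s' False))))"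

definition clear :: "nat \<Rightarrow> com" where
  "clear r = While r (\<lambda>x. nonempty x) (Pop r)"

definition move_reg :: "nat \<Rightarrow> nat \<Rightarrow> nat \<Rightarrow> com" where
  "move_reg r s u = Seq (rev_onto r u) (rev_onto u s)"

definition copy_reg :: "nat \<Rightarrow> nat \<Rightarrow> nat \<Rightarrow> com" where
  "copy_reg r s u = Seq (rev_onto r u) (rev_onto2 u r s)"

fun push_word :: "nat \<Rightarrow> bool list \<Rightarrow> com" where
  "push_word r [] = Skip"
| "push_word r (b # w) = Seq (push_word r w) (Push r b)"

lemma run_rev_onto:
  assumes "distinct [1, r, s]" "\<sigma>' = \<sigma>(r := [], s := rev (\<sigma> r) @ \<sigma> s)" "7 * length (\<sigma> r) + 1 \<le> n"
  shows "run (rev_onto r s) \<sigma> \<sigma>' n"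
proof -
  have "\<forall>\<sigma>. \<sigma> r = w \<longrightarrow> run (rev_onto r s) \<sigma> (\<sigma>(r := [], s := rev w @ \<sigma> s)) (7 * length w + 1)" for w
  proof (induction w)
    case Nil
    show ?case
    proof (intro allI impI)
      fix \<sigma> :: store assume r: "\<sigma> r = []"
      then have "\<sigma>(r := [], s := rev [] @ \<sigma> s) = \<sigma>" by auto
      then show "run (rev_onto r s) \<sigma> (\<sigma>(r := [], s := rev [] @ \<sigma> s)) (7 * length [] + 1)"
        unfolding rev_onto_def using assms(1) r by (auto intro: run_WhileF)
    qed
  next
    case (Cons b w)
    show ?case
    proof (intro allI impI)
      fix \<sigma> assume r: "\<sigma> r = b # w"
      let ?\<sigma> = "\<sigma>(r := w, s := b # \<sigma> s)"
      have 1: "run (Cond r (\<lambda>x. is_true x) (Seq (Pop r) (Push s True)) (Seq (Pop r) (Push s False))) \<sigma> ?\<sigma> 5"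
        using assms(1) r
        by (intro run_Cond[where n = 3] run_Seq[where \<sigma>' = "\<sigma>(r := w)" and n = 1 and n' = 2] run_Pop run_Push) auto
      have 2: "run (rev_onto r s) ?\<sigma> (?\<sigma>(r := [], s := rev w @ ?\<sigma> s)) (7 * length w + 1)"
        by (rule Cons.IH[rule_format]) (use assms(1) in simp)
      have 3: "?\<sigma>(r := [], s := rev w @ ?\<sigma> s) = \<sigma>(r := [], s := rev (b # w) @ \<sigma> s)"
        using assms(1) by (auto simp: fun_eq_iff)
      show "run (rev_onto r s) \<sigma> (\<sigma>(r := [], s := rev (b # w) @ \<sigma> s)) (7 * length (b # w) + 1)"
        using 2 unfolding 3 rev_onto_def using assms(1) r by (intro run_WhileT[OF _ _ 1]) auto
    qed
  qed
  from this[of "\<sigma> r"] assms(2,3) show ?thesis by (auto intro: run_mono)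
qed

lemma run_rev_onto2:
  assumes "distinct [1, r, s, s']" "\<sigma>' = \<sigma>(r := [], s := rev (\<sigma> r) @ \<sigma> s, s' := rev (\<sigma> r) @ \<sigma> s')"
    and "9 * length (\<sigma> r) + 1 \<le> n"
  shows "run (rev_onto2 r s s') \<sigma> \<sigma>' n"
proof -
  have "\<forall>\<sigma>. \<sigma> r = w \<longrightarrow>
      run (rev_onto2 r s s') \<sigma> (\<sigma>(r := [], s := rev w @ \<sigma> s, s' := rev w @ \<sigma> s')) (9 * length w + 1)" for w
  proof (induction w)
    case Nil
    show ?case
    proof (intro allI impI)
      fix \<sigma> :: store assume r: "\<sigma> r = []"
      then have "\<sigma>(r := [], s := rev [] @ \<sigma> s, s' := rev [] @ \<sigma> s') = \<sigma>" by auto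
      then show "run (rev_onto2 r s s') \<sigma> (\<sigma>(r := [], s := rev [] @ \<sigma> s, s' := rev [] @ \<sigma> s')) (9 * length [] + 1)"
        unfolding rev_onto2_def using assms(1) r by (auto intro: run_WhileF)
    qed
  next
    case (Cons b w)
    show ?case
    proof (intro allI impI)
      fix \<sigma> assume r: "\<sigma> r = b # w"
      let ?\<sigma> = "\<sigma>(r := w, s := b # \<sigma> s, s' := b # \<sigma> s')"
      have 1: "run (Cond r (\<lambda>x. is_true x) (Seq (Pop r) (Seq (Push s True) (Push s' True)))
          (Seq (Pop r) (Seq (Push s False) (Push s' False)))) \<sigma> ?\<sigma> 7"
        using assms(1) r
        by (intro run_Cond[where n = 5] run_Seq[where \<sigma>' = "\<sigma>(r := w)" and n = 1 and n' = 4]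
            run_Seq[where \<sigma>' = "\<sigma>(r := w, s := b # \<sigma> s)" and n = 2 and n' = 2] run_Pop run_Push) auto
      have 2: "run (rev_onto2 r s s') ?\<sigma> (?\<sigma>(r := [], s := rev w @ ?\<sigma> s, s' := rev w @ ?\<sigma> s')) (9 * length w + 1)"
        by (rule Cons.IH[rule_format]) (use assms(1) in simp)
      have 3: "?\<sigma>(r := [], s := rev w @ ?\<sigma> s, s' := rev w @ ?\<sigma> s') =
          \<sigma>(r := [], s := rev (b # w) @ \<sigma> s, s' := rev (b # w) @ \<sigma> s')"
        using assms(1) by (auto simp: fun_eq_iff)
      show "run (rev_onto2 r s s') \<sigma> (\<sigma>(r := [], s := rev (b # w) @ \<sigma> s, s' := rev (b # w) @ \<sigma> s'))
          (9 * length (b # w) + 1)"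
        using 2 unfolding 3 rev_onto2_def using assms(1) r by (intro run_WhileT[OF _ _ 1]) auto
    qed
  qed
  from this[of "\<sigma> r"] assms(2,3) show ?thesis by (auto intro: run_mono)
qed

lemma run_clear:
  assumes "r \<noteq> 1" "\<sigma>' = \<sigma>(r := [])" "3 * length (\<sigma> r) + 1 \<le> n"
  shows "run (clear r) \<sigma> \<sigma>' n"
proof -
  have "\<forall>\<sigma>. \<sigma> r = w \<longrightarrow> run (clear r) \<sigma> (\<sigma>(r := [])) (3 * length w + 1)" for w
  proof (induction w)
    case Nil
    show ?case
    proof (intro allI impI)
      fix \<sigma> :: store assume r: "\<sigma> r = []"
      then have "\<sigma>(r := []) = \<sigma>" by auto
      then show "run (clear r) \<sigma> (\<sigma>(r := [])) (3 * length [] + 1)"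
        unfolding clear_def using assms(1) r by (auto intro: run_WhileF)
    qed
  next
    case (Cons b w)
    show ?case
    proof (intro allI impI)
      fix \<sigma> assume r: "\<sigma> r = b # w"
      have 1: "run (Pop r) \<sigma> (\<sigma>(r := w)) 1"
        using assms(1) r by (intro run_Pop) auto
      have 2: "run (clear r) (\<sigma>(r := w)) (\<sigma>(r := w, r := [])) (3 * length w + 1)"
        by (rule Cons.IH[rule_format]) simp
      show "run (clear r) \<sigma> (\<sigma>(r := [])) (3 * length (b # w) + 1)"
        using 2 unfolding clear_def fun_upd_upd using assms(1) r by (intro run_WhileT[OF _ _ 1]) auto
    qed
  qed
  from this[of "\<sigma> r"] assms(2,3) show ?thesis by (auto intro: run_mono)
qed

lemma run_move_reg:
  assumes "distinct [1, r, s, u]" "\<sigma> u = []" "\<sigma>' = \<sigma>(r := [], s := \<sigma> r @ \<sigma> s)" "14 * length (\<sigma> r) + 2 \<le> n"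
  shows "run (move_reg r s u) \<sigma> \<sigma>' n"
proof -
  have "run (rev_onto r u) \<sigma> (\<sigma>(r := [], u := rev (\<sigma> r))) (7 * length (\<sigma> r) + 1)"
    using assms by (intro run_rev_onto) auto
  moreover have "run (rev_onto u s) (\<sigma>(r := [], u := rev (\<sigma> r))) \<sigma>' (7 * length (\<sigma> r) + 1)"
    using assms by (intro run_rev_onto) (auto simp: fun_eq_iff)
  ultimately show ?thesis
    unfolding move_reg_def using assms(4) by (auto intro: run_Seq)
qed

lemma run_copy_reg:
  assumes "distinct [1, r, s, u]" "\<sigma> u = []" "\<sigma>' = \<sigma>(s := \<sigma> r @ \<sigma> s)" "16 * length (\<sigma> r) + 2 \<le> n"
  shows "run (copy_reg r s u) \<sigma> \<sigma>' n"
proof -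
  have "run (rev_onto r u) \<sigma> (\<sigma>(r := [], u := rev (\<sigma> r))) (7 * length (\<sigma> r) + 1)"
    using assms by (intro run_rev_onto) auto
  moreover have "run (rev_onto2 u r s) (\<sigma>(r := [], u := rev (\<sigma> r))) \<sigma>' (9 * length (\<sigma> r) + 1)"
    using assms by (intro run_rev_onto2) (auto simp: fun_eq_iff)
  ultimately show ?thesis
    unfolding copy_reg_def using assms(4) by (auto intro: run_Seq)
qed

lemma run_push_word:
  assumes "r \<noteq> 1" "\<sigma>' = \<sigma>(r := w @ \<sigma> r)" "2 * length w \<le> n"
  shows "run (push_word r w) \<sigma> \<sigma>' n"
proof -
  have "run (push_word r w) \<sigma> (\<sigma>(r := w @ \<sigma> r)) (2 * length w)"
  proof (induction w)
    case Nil
    show "run (push_word r []) \<sigma> (\<sigma>(r := [] @ \<sigma> r)) (2 * length [])"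
      by (simp add: run_Skip)
  next
    case (Cons b w)
    have "run (Push r b) (\<sigma>(r := w @ \<sigma> r)) (\<sigma>(r := (b # w) @ \<sigma> r)) 2"
      using assms(1) by (intro run_Push) auto
    with Cons.IH show "run (push_word r (b # w)) \<sigma> (\<sigma>(r := (b # w) @ \<sigma> r)) (2 * length (b # w))"
      unfolding push_word.simps by (rule run_Seq) simp
  qed
  then show ?thesis using assms(2,3) by (auto intro: run_mono)
qed

section \<open>Binary trees as universal data\<close>

datatype tree = Leaf | Node tree tree

primrec ser :: "tree \<Rightarrow> bool list" where
  "ser Leaf = [False]"
| "ser (Node s t) = True # ser s @ ser t"

text \<open>The counter register \<open>c\<close> holds one symbol for every subtree that is still to be read.\<close>

definition read_tree_loop :: "nat \<Rightarrow> nat \<Rightarrow> nat \<Rightarrow> com" where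
  "read_tree_loop r s c = While c (\<lambda>x. nonempty x) (Cond r (\<lambda>x. is_true x)
     (Seq (Pop r) (Seq (Push s True) (Push c True))) (Seq (Pop r) (Seq (Push s False) (Pop c))))"

definition read_tree :: "nat \<Rightarrow> nat \<Rightarrow> nat \<Rightarrow> nat \<Rightarrow> com" where
  "read_tree r s u c = Seq (Seq (Push c True) (read_tree_loop r u c)) (rev_onto u s)"

text \<open>The remaining run of the loop appears as a continuation: the loop does not stop between
  the two subtrees of a node, so that the readings of the subtrees are not complete runs that could
  be sequenced.\<close>

lemma run_read_tree_loop:
  assumes "distinct [1, r, s, c]" "\<sigma> r = ser t @ w" "\<sigma> c = x # cs"
    and "run (read_tree_loop r s c) (\<sigma>(r := w, s := rev (ser t) @ \<sigma> s, c := cs)) \<sigma>' n"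
    and "9 * length (ser t) + n \<le> k"
  shows "run (read_tree_loop r s c) \<sigma> \<sigma>' k"
proof -
  define P where "P t \<longleftrightarrow> (\<forall>\<sigma> w x cs n. \<sigma> r = ser t @ w \<longrightarrow> \<sigma> c = x # cs \<longrightarrow>
      run (read_tree_loop r s c) (\<sigma>(r := w, s := rev (ser t) @ \<sigma> s, c := cs)) \<sigma>' n \<longrightarrow>
      run (read_tree_loop r s c) \<sigma> \<sigma>' (9 * length (ser t) + n))" for t
  have "P t"
  proof (induction t)
    case Leaf
    show ?case unfolding P_def
    proof (intro allI impI)
      fix \<sigma> w x cs n
      let ?\<sigma> = "\<sigma>(r := w, s := rev (ser Leaf) @ \<sigma> s, c := cs)"
      assume *: "\<sigma> r = ser Leaf @ w" "\<sigma> c = x # cs" "run (read_tree_loop r s c) ?\<sigma> \<sigma>' n"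
      have "run (Cond r (\<lambda>x. is_true x) (Seq (Pop r) (Seq (Push s True) (Push c True)))
          (Seq (Pop r) (Seq (Push s False) (Pop c)))) \<sigma> ?\<sigma> 7"
        using * assms(1)
        by (intro run_Cond[where n = 5] run_Seq[where \<sigma>' = "\<sigma>(r := w)" and n = 1 and n' = 4]
            run_Seq[where \<sigma>' = "\<sigma>(r := w, s := False # \<sigma> s)" and n = 2 and n' = 2] run_Pop run_Push) auto
      then show "run (read_tree_loop r s c) \<sigma> \<sigma>' (9 * length (ser Leaf) + n)"
        using *(3) unfolding read_tree_loop_def by (rule run_WhileT[rotated 2]) (use * assms(1) in auto)
    qed
  next
    case (Node t1 t2)
    show ?case unfolding P_def
    proof (intro allI impI)
      fix \<sigma> w x cs n
      let ?\<sigma> = "\<sigma>(r := ser t1 @ ser t2 @ w, s := True # \<sigma> s, c := True # x # cs)"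
      let ?\<sigma>1 = "\<sigma>(r := ser t2 @ w, s := rev (ser t1) @ True # \<sigma> s, c := x # cs)"
      let ?\<sigma>2 = "\<sigma>(r := w, s := rev (ser (Node t1 t2)) @ \<sigma> s, c := cs)"
      assume *: "\<sigma> r = ser (Node t1 t2) @ w" "\<sigma> c = x # cs" "run (read_tree_loop r s c) ?\<sigma>2 \<sigma>' n"
      have 1: "run (Cond r (\<lambda>x. is_true x) (Seq (Pop r) (Seq (Push s True) (Push c True)))
          (Seq (Pop r) (Seq (Push s False) (Pop c)))) \<sigma> ?\<sigma> 7"
        using * assms(1)
        by (intro run_Cond[where n = 5] run_Seq[where \<sigma>' = "\<sigma>(r := ser t1 @ ser t2 @ w)" and n = 1 and n' = 4]
            run_Seq[where \<sigma>' = "\<sigma>(r := ser t1 @ ser t2 @ w, s := True # \<sigma> s)" and n = 2 and n' = 2]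
            run_Pop run_Push) auto
      have e2: "?\<sigma>1(r := w, s := rev (ser t2) @ ?\<sigma>1 s, c := cs) = ?\<sigma>2"
        using assms(1) by (auto simp: fun_eq_iff)
      have r2: "run (read_tree_loop r s c) ?\<sigma>1 \<sigma>' (9 * length (ser t2) + n)"
        using Node.IH(2)[unfolded P_def, rule_format, of ?\<sigma>1 w x cs n] e2 *(3) assms(1) by simp
      have e1: "?\<sigma>(r := ser t2 @ w, s := rev (ser t1) @ ?\<sigma> s, c := x # cs) = ?\<sigma>1"
        using assms(1) by (auto simp: fun_eq_iff)
      have r1: "run (read_tree_loop r s c) ?\<sigma> \<sigma>' (9 * length (ser t1) + (9 * length (ser t2) + n))"
        using Node.IH(1)[unfolded P_def, rule_format, of ?\<sigma> "ser t2 @ w" True "x # cs" "9 * length (ser t2) + n"] e1 r2 assms(1)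
        by simp
      show "run (read_tree_loop r s c) \<sigma> \<sigma>' (9 * length (ser (Node t1 t2)) + n)"
        using 1 r1 unfolding read_tree_loop_def by (rule run_WhileT[rotated 2]) (use * assms(1) in auto)
    qed
  qed
  then have "run (read_tree_loop r s c) \<sigma> \<sigma>' (9 * length (ser t) + n)"
    using assms(2-4) unfolding P_def by blast
  then show ?thesis using assms(5) by (rule run_mono)
qed

lemma run_read_tree:
  assumes "distinct [1, r, s, u, c]" "\<sigma> u = []" "\<sigma> c = []" "\<sigma> r = ser t @ w"
    and "\<sigma>' = \<sigma>(r := w, s := ser t @ \<sigma> s)" "16 * length (ser t) + 4 \<le> n"
  shows "run (read_tree r s u c) \<sigma> \<sigma>' n"
proof -
  have 1: "run (Push c True) \<sigma> (\<sigma>(c := [True])) 2"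
    using assms by (intro run_Push) auto
  have e: "\<sigma>(c := [True], r := w, u := rev (ser t) @ (\<sigma>(c := [True])) u, c := []) = \<sigma>(r := w, u := rev (ser t))"
    using assms by (auto simp: fun_eq_iff)
  have "run (read_tree_loop r u c) (\<sigma>(r := w, u := rev (ser t))) (\<sigma>(r := w, u := rev (ser t))) 1"
    unfolding read_tree_loop_def using assms by (intro run_WhileF) auto
  then have 2: "run (read_tree_loop r u c) (\<sigma>(c := [True])) (\<sigma>(r := w, u := rev (ser t))) (9 * length (ser t) + 1)"
    using assms(1-4) e
    by - (rule run_read_tree_loop[where t = t and w = w and n = 1 and x = True and cs = "[]"]; auto)
  have 3: "run (rev_onto u s) (\<sigma>(r := w, u := rev (ser t))) \<sigma>' (7 * length (ser t) + 1)"
    using assms by (intro run_rev_onto) (auto simp: fun_eq_iff)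
  show ?thesis
    unfolding read_tree_def by (rule run_Seq[OF run_Seq[OF 1 2 order.refl] 3]) (use assms(6) in simp)
qed

section \<open>Types encoded as trees, and their sizes\<close>

class tree_enc =
  fixes enc :: "'a \<Rightarrow> tree" and dec :: "tree \<Rightarrow> 'a"
  assumes dec_enc [simp]: "dec (enc a) = a"

instantiation tree :: tree_enc
begin
definition "enc (t :: tree) = t"
definition "dec (t :: tree) = t"
instance by standard (simp add: enc_tree_def dec_tree_def)
end

instantiation unit :: tree_enc
begin
definition "enc (u :: unit) = Leaf"
definition "dec (t :: tree) = ()"
instance by standard simp
end

instantiation bool :: tree_enc
begin
definition "enc b = (if b then Node Leaf Leaf else Leaf)"
definition "dec t \<longleftrightarrow> t \<noteq> Leaf"
instance by standard (simp add: enc_bool_def dec_bool_def)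
end

text \<open>The unary encoding makes the size linear in the value. It is also the encoding of a list
  of units, so that iterating a function \<open>n\<close> times is a fold over \<open>n\<close>
  itself.\<close>

instantiation nat :: tree_enc
begin
primrec enc_nat :: "nat \<Rightarrow> tree" where
  "enc_nat 0 = Leaf"
| "enc_nat (Suc n) = Node Leaf (enc_nat n)"
primrec dec_nat :: "tree \<Rightarrow> nat" where
  "dec_nat Leaf = 0"
| "dec_nat (Node s t) = Suc (dec_nat t)"
instance
proof
  show "dec (enc n) = n" for n :: nat by (induction n) auto
qed
end

instantiation prod :: (tree_enc, tree_enc) tree_enc
begin
definition "enc p = Node (enc (fst p)) (enc (snd p))"
definition "dec t = (case t of Leaf \<Rightarrow> (dec Leaf, dec Leaf) | Node s u \<Rightarrow> (dec s, dec u))"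
instance by standard (simp add: enc_prod_def dec_prod_def)
end

instantiation list :: (tree_enc) tree_enc
begin
primrec enc_list :: "'a list \<Rightarrow> tree" where
  "enc_list [] = Leaf"
| "enc_list (x # xs) = Node (enc x) (enc_list xs)"
primrec dec_list :: "tree \<Rightarrow> 'a list" where
  "dec_list Leaf = []"
| "dec_list (Node s t) = dec s # dec_list t"
instance
proof
  show "dec (enc xs) = xs" for xs :: "'a list" by (induction xs) auto
qed
end

definition tsize :: "'a::tree_enc \<Rightarrow> nat" where
  "tsize a = length (ser (enc a))"

lemma tsize_simps [simp]:
  "tsize (a, b) = Suc (tsize a + tsize b)" "tsize ([] :: 'a::tree_enc list) = 1"
  "tsize (x # xs) = Suc (tsize x + tsize xs)"
  "tsize (Node s t) = Suc (tsize s + tsize t)" "tsize Leaf = 1"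
  "tsize (0::nat) = 1" "tsize (Suc n) = Suc (Suc (tsize n))" "tsize () = 1"
  "tsize True = 3" "tsize False = 1"
  by (simp_all add: tsize_def enc_prod_def enc_tree_def enc_unit_def enc_bool_def)

lemma tsize_enc [simp]: "tsize (enc a) = tsize a"
  by (simp add: tsize_def enc_tree_def)

lemma tsize_pos [simp]: "0 < tsize a"
  unfolding tsize_def by (cases "enc a") auto

lemma poly_nat_mono: "m \<le> n \<Longrightarrow> poly (p :: nat poly) m \<le> poly p n"
  by (induction p) (auto intro: add_mono mult_mono)

section \<open>Polynomial-time functions on encoded data\<close>

text \<open>The calling convention: the argument is in register \<open>m\<close>, all higher registers are empty,
  and the result replaces the argument.\<close>

definition computes_at :: "nat \<Rightarrow> com \<Rightarrow> ('a::tree_enc \<Rightarrow> 'b::tree_enc) \<Rightarrow> nat poly \<Rightarrow> bool" where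
  "computes_at m c f q \<longleftrightarrow> (\<forall>\<sigma> a. \<sigma> m = ser (enc a) \<longrightarrow> (\<forall>j>m. \<sigma> j = []) \<longrightarrow>
     run c \<sigma> (\<sigma>(m := ser (enc (f a)))) (poly q (tsize a)))"

text \<open>The program depends on the base register \<open>m\<close>, the polynomial does not: a
  caller keeps its data in low registers and runs its parts at higher ones. The bound on the size of
  the result is what the time bound of a composition needs.\<close>

definition pt :: "('a::tree_enc \<Rightarrow> 'b::tree_enc) \<Rightarrow> bool" where
  "pt f \<longleftrightarrow> (\<exists>q. (\<forall>a. tsize (f a) \<le> poly q (tsize a)) \<and> (\<forall>m\<ge>2. \<exists>c. computes_at m c f q))"

lemma computes_at_run:
  assumes "computes_at m c f q" "\<sigma> m = ser (enc a)" "\<forall>j>m. \<sigma> j = []" "\<sigma>' = \<sigma>(m := ser (enc (f a)))"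
    and "poly q (tsize a) \<le> n"
  shows "run c \<sigma> \<sigma>' n"
  using assms run_mono unfolding computes_at_def by blast

lemma ptI:
  assumes "\<And>a. tsize (f a) \<le> poly p (tsize a)" "\<And>m. m \<ge> 2 \<Longrightarrow> \<exists>c. computes_at m c f q"
  shows "pt f"
  unfolding pt_def
proof (intro exI[of _ "p + q"] conjI allI impI)
  show "tsize (f a) \<le> poly (p + q) (tsize a)" for a
    using assms(1)[of a] by simp
  show "\<exists>c. computes_at m c f (p + q)" if "2 \<le> m" for m
    using assms(2)[OF that] unfolding computes_at_def by (metis le_add2 poly_add run_mono)
qed

text \<open>Programs only see trees, so a function may be replaced by one between other types whose
  encodings correspond. Constructors and selectors of pairs, lists and numbers thus reduce to those
  of trees.\<close>

lemma pt_cong_enc: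
  fixes f :: "'a::tree_enc \<Rightarrow> 'b::tree_enc" and g :: "'c::tree_enc \<Rightarrow> 'd::tree_enc"
  assumes "pt g" "\<And>a. enc a = enc (h a)" "\<And>a. enc (f a) = enc (g (h a))"
  shows "pt f"
proof -
  obtain q where q: "\<And>a. tsize (g a) \<le> poly q (tsize a)" "\<And>m. m \<ge> 2 \<Longrightarrow> \<exists>c. computes_at m c g q"
    using assms(1) unfolding pt_def by blast
  have [simp]: "tsize a = tsize (h a)" "tsize (f a) = tsize (g (h a))" for a
    by (simp_all add: tsize_def assms(2,3))
  show ?thesis
  proof (rule ptI)
    show "tsize (f a) \<le> poly q (tsize a)" for a
      using q(1) by simp
    show "\<exists>c. computes_at m c f q" if "2 \<le> m" for m
      using q(2)[OF that] unfolding computes_at_def by (simp add: assms(2,3)) blast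
  qed
qed

lemma pt_id: "pt (\<lambda>a. a)"
proof (rule ptI)
  show "tsize a \<le> poly [:0, 1:] (tsize a)" for a :: 'a by simp
  show "\<exists>c. computes_at m c (\<lambda>a. a :: 'a) 0" for m
    unfolding computes_at_def by (rule exI[of _ Skip]) (auto simp: fun_upd_idem intro: run_Skip)
qed

lemma pt_const: "pt (\<lambda>_ :: 'a::tree_enc. b :: 'b::tree_enc)"
proof (rule ptI)
  show "tsize b \<le> poly [:tsize b:] (tsize a)" for a :: 'a by simp
  fix m :: nat assume m: "2 \<le> m"
  have "run (Seq (clear m) (push_word m (ser (enc b)))) \<sigma> (\<sigma>(m := ser (enc b)))
      (poly [:2 * tsize b + 1, 3:] (tsize a))" if "\<sigma> m = ser (enc a)" for \<sigma> and a :: 'a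
  proof (rule run_Seq)
    show "run (clear m) \<sigma> (\<sigma>(m := [])) (3 * tsize a + 1)"
      using m that by (intro run_clear) (auto simp: tsize_def)
    show "run (push_word m (ser (enc b))) (\<sigma>(m := [])) (\<sigma>(m := ser (enc b))) (2 * tsize b)"
      using m by (intro run_push_word) (auto simp: tsize_def)
  qed simp
  then show "\<exists>c. computes_at m c (\<lambda>_ :: 'a. b) [:2 * tsize b + 1, 3:]"
    unfolding computes_at_def by blast
qed

lemma pt_comp:
  assumes "pt g" "pt f"
  shows "pt (\<lambda>a. g (f a))"
proof -
  obtain p where p: "\<And>a. tsize (f a) \<le> poly p (tsize a)" "\<And>m. m \<ge> 2 \<Longrightarrow> \<exists>c. computes_at m c f p"
    using assms(2) unfolding pt_def by blast
  obtain q where q: "\<And>a. tsize (g a) \<le> poly q (tsize a)" "\<And>m. m \<ge> 2 \<Longrightarrow> \<exists>c. computes_at m c g q"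
    using assms(1) unfolding pt_def by blast
  have mono: "poly q (tsize (f a)) \<le> poly (pcompose q p) (tsize a)" for a
    using poly_nat_mono[OF p(1)] by (simp add: poly_pcompose)
  show ?thesis
  proof (rule ptI)
    show "tsize (g (f a)) \<le> poly (pcompose q p) (tsize a)" for a
      using q(1) mono le_trans by blast
    fix m :: nat assume m: "2 \<le> m"
    obtain c d where c: "computes_at m c f p" and d: "computes_at m d g q"
      using p(2) q(2) m by blast
    have "run (Seq c d) \<sigma> (\<sigma>(m := ser (enc (g (f a))))) (poly (p + pcompose q p) (tsize a))"
      if "\<sigma> m = ser (enc a)" "\<forall>j>m. \<sigma> j = []" for \<sigma> a
    proof (rule run_Seq)
      show "run c \<sigma> (\<sigma>(m := ser (enc (f a)))) (poly p (tsize a))"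
        using that by (intro computes_at_run[OF c]) auto
      show "run d (\<sigma>(m := ser (enc (f a)))) (\<sigma>(m := ser (enc (g (f a))))) (poly (pcompose q p) (tsize a))"
        using that mono by (intro computes_at_run[OF d]) auto
    qed simp
    then show "\<exists>c. computes_at m c (\<lambda>a. g (f a)) (p + pcompose q p)"
      unfolding computes_at_def by blast
  qed
qed

lemma pt_Node:
  assumes "pt f" "pt g"
  shows "pt (\<lambda>a. Node (f a) (g a))"
proof -
  obtain p where p: "\<And>a. tsize (f a) \<le> poly p (tsize a)" "\<And>m. m \<ge> 2 \<Longrightarrow> \<exists>c. computes_at m c f p"
    using assms(1) unfolding pt_def by blast
  obtain q where q: "\<And>a. tsize (g a) \<le> poly q (tsize a)" "\<And>m. m \<ge> 2 \<Longrightarrow> \<exists>c. computes_at m c g q"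
    using assms(2) unfolding pt_def by blast
  show ?thesis
  proof (rule ptI)
    show "tsize (Node (f a) (g a)) \<le> poly (1 + p + q) (tsize a)" for a
      using p(1)[of a] q(1)[of a] by simp
    fix m :: nat assume m: "2 \<le> m"
    obtain c where c: "computes_at (m + 1) c f p"
      using p(2)[of "m + 1"] m by auto
    obtain d where d: "computes_at (m + 2) d g q"
      using q(2)[of "m + 2"] m by auto
    \<comment> \<open>Both results are computed above \<open>m\<close>. As words on a stack are
      built from their end, the second result is moved to \<open>m\<close> before the first, and the
      node marker comes last.\<close>
    let ?c = "Seq (copy_reg m (m + 1) (m + 2)) (Seq c (Seq (copy_reg m (m + 2) (m + 3)) (Seq d (Seq (clear m)
      (Seq (move_reg (m + 2) m (m + 3)) (Seq (move_reg (m + 1) m (m + 2)) (Push m True)))))))"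
    let ?r = "smult 15 p + smult 15 q + [:20, 35:]"
    have "run ?c \<sigma> (\<sigma>(m := ser (Node (f a) (g a)))) (poly ?r (tsize a))"
      if \<sigma>: "\<sigma> m = ser (enc a)" "\<forall>j>m. \<sigma> j = []" for \<sigma> a
    proof -
      note l = tsize_def[symmetric]
      let ?z = "ser (enc a)" and ?n = "tsize a"
      have F: "length (ser (f a)) \<le> poly p ?n" "length (ser (g a)) \<le> poly q ?n"
        using p(1)[of a] q(1)[of a] by (simp_all add: tsize_def enc_tree_def)
      have 1: "run (copy_reg m (m + 1) (m + 2)) \<sigma> (\<sigma>(m + 1 := ?z)) (16 * ?n + 2)"
        using m \<sigma> by (intro run_copy_reg) (auto simp: l)
      have 2: "run c (\<sigma>(m + 1 := ?z)) (\<sigma>(m + 1 := ser (f a))) (poly p ?n)"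
        using \<sigma> by (intro computes_at_run[OF c, where a = a]) (auto simp: enc_tree_def)
      have 3: "run (copy_reg m (m + 2) (m + 3)) (\<sigma>(m + 1 := ser (f a)))
          (\<sigma>(m + 1 := ser (f a), m + 2 := ?z)) (16 * ?n + 2)"
        using m \<sigma> by (intro run_copy_reg) (auto simp: l)
      have 4: "run d (\<sigma>(m + 1 := ser (f a), m + 2 := ?z)) (\<sigma>(m + 1 := ser (f a), m + 2 := ser (g a))) (poly q ?n)"
        using \<sigma> by (intro computes_at_run[OF d, where a = a]) (auto simp: enc_tree_def)
      have 5: "run (clear m) (\<sigma>(m + 1 := ser (f a), m + 2 := ser (g a)))
          (\<sigma>(m + 1 := ser (f a), m + 2 := ser (g a), m := [])) (3 * ?n + 1)"
        using m \<sigma> by (intro run_clear) (auto simp: l)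
      have 6: "run (move_reg (m + 2) m (m + 3)) (\<sigma>(m + 1 := ser (f a), m + 2 := ser (g a), m := []))
          (\<sigma>(m + 1 := ser (f a), m := ser (g a))) (14 * poly q ?n + 2)"
        using m \<sigma> F by (intro run_move_reg) (auto simp: fun_eq_iff)
      have 7: "run (move_reg (m + 1) m (m + 2)) (\<sigma>(m + 1 := ser (f a), m := ser (g a)))
          (\<sigma>(m := ser (f a) @ ser (g a))) (14 * poly p ?n + 2)"
        using m \<sigma> F by (intro run_move_reg) (auto simp: fun_eq_iff)
      have 8: "run (Push m True) (\<sigma>(m := ser (f a) @ ser (g a))) (\<sigma>(m := ser (Node (f a) (g a)))) 2"
        using m by (intro run_Push) auto
      show ?thesis
        by (rule run_mono, (rule run_Seq, rule 1 2 3 4 5 6 7)+, rule 8) (rule order.refl | simp)+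
    qed
    then show "\<exists>c. computes_at m c (\<lambda>a. Node (f a) (g a)) ?r"
      unfolding computes_at_def enc_tree_def by blast
  qed
qed

definition left :: "tree \<Rightarrow> tree" where
  "left t = (case t of Leaf \<Rightarrow> Leaf | Node s u \<Rightarrow> s)"

definition right :: "tree \<Rightarrow> tree" where
  "right t = (case t of Leaf \<Rightarrow> Leaf | Node s u \<Rightarrow> u)"

lemma left_right_simps [simp]: "left Leaf = Leaf" "left (Node s u) = s" "right Leaf = Leaf" "right (Node s u) = u"
  by (simp_all add: left_def right_def)

lemma pt_left: "pt left"
proof (rule ptI)
  show "tsize (left t) \<le> poly [:0, 1:] (tsize t)" for t by (cases t) auto
  fix m :: nat assume m: "2 \<le> m"
  let ?c = "Cond m (\<lambda>x. is_true x) (Seq (Pop m) (Seq (read_tree m (m + 1) (m + 2) (m + 3))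
    (Seq (clear m) (move_reg (m + 1) m (m + 2))))) Skip"
  have "run ?c \<sigma> (\<sigma>(m := ser (left t))) (poly [:20, 33:] (tsize t))"
    if \<sigma>: "\<sigma> m = ser t" "\<forall>j>m. \<sigma> j = []" for \<sigma> t
  proof (cases t)
    case Leaf
    then have "\<sigma>(m := ser (left t)) = \<sigma>" using \<sigma> by auto
    then show ?thesis using Leaf \<sigma> m by (auto intro!: run_Cond[where n = 0] run_Skip)
  next
    case (Node s u)
    let ?n = "tsize t"
    have n: "length (ser s) \<le> ?n" "length (ser u) \<le> ?n"
      by (simp_all add: Node tsize_def enc_tree_def)
    have 1: "run (Pop m) \<sigma> (\<sigma>(m := ser s @ ser u)) 1"
      using m \<sigma> Node by (intro run_Pop) auto
    have 2: "run (read_tree m (m + 1) (m + 2) (m + 3)) (\<sigma>(m := ser s @ ser u))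
        (\<sigma>(m := ser u, m + 1 := ser s)) (16 * ?n + 4)"
      using m \<sigma> Node n by (intro run_read_tree[where t = s and w = "ser u"]) (auto simp: fun_eq_iff)
    have 3: "run (clear m) (\<sigma>(m := ser u, m + 1 := ser s)) (\<sigma>(m := [], m + 1 := ser s)) (3 * ?n + 1)"
      using m n by (intro run_clear) auto
    have 4: "run (move_reg (m + 1) m (m + 2)) (\<sigma>(m := [], m + 1 := ser s)) (\<sigma>(m := ser s)) (14 * ?n + 2)"
      using m n \<sigma> by (intro run_move_reg) (auto simp: fun_eq_iff)
    have "run (Seq (Pop m) (Seq (read_tree m (m + 1) (m + 2) (m + 3))
        (Seq (clear m) (move_reg (m + 1) m (m + 2))))) \<sigma> (\<sigma>(m := ser s)) (33 * ?n + 8)"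
      by (rule run_mono, (rule run_Seq, rule 1 2 3)+, rule 4) (rule order.refl | simp)+
    then show ?thesis
      using Node \<sigma> m by (auto intro!: run_Cond)
  qed
  then show "\<exists>c. computes_at m c left [:20, 33:]"
    unfolding computes_at_def enc_tree_def by blast
qed

lemma pt_right: "pt right"
proof (rule ptI)
  show "tsize (right t) \<le> poly [:0, 1:] (tsize t)" for t by (cases t) auto
  fix m :: nat assume m: "2 \<le> m"
  let ?c = "Cond m (\<lambda>x. is_true x) (Seq (Pop m) (Seq (read_tree m (m + 1) (m + 2) (m + 3)) (clear (m + 1)))) Skip"
  have "run ?c \<sigma> (\<sigma>(m := ser (right t))) (poly [:20, 33:] (tsize t))"
    if \<sigma>: "\<sigma> m = ser t" "\<forall>j>m. \<sigma> j = []" for \<sigma> t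
  proof (cases t)
    case Leaf
    then have "\<sigma>(m := ser (right t)) = \<sigma>" using \<sigma> by auto
    then show ?thesis using Leaf \<sigma> m by (auto intro!: run_Cond[where n = 0] run_Skip)
  next
    case (Node s u)
    let ?n = "tsize t"
    have n: "length (ser s) \<le> ?n"
      by (simp add: Node tsize_def enc_tree_def)
    have 1: "run (Pop m) \<sigma> (\<sigma>(m := ser s @ ser u)) 1"
      using m \<sigma> Node by (intro run_Pop) auto
    have 2: "run (read_tree m (m + 1) (m + 2) (m + 3)) (\<sigma>(m := ser s @ ser u))
        (\<sigma>(m := ser u, m + 1 := ser s)) (16 * ?n + 4)"
      using m \<sigma> Node n by (intro run_read_tree[where t = s and w = "ser u"]) (auto simp: fun_eq_iff)
    have 3: "run (clear (m + 1)) (\<sigma>(m := ser u, m + 1 := ser s)) (\<sigma>(m := ser u)) (3 * ?n + 1)"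
      using m n \<sigma> by (intro run_clear) (auto simp: fun_eq_iff)
    have "run (Seq (Pop m) (Seq (read_tree m (m + 1) (m + 2) (m + 3)) (clear (m + 1))))
        \<sigma> (\<sigma>(m := ser u)) (33 * ?n + 8)"
      by (rule run_mono, (rule run_Seq, rule 1 2)+, rule 3) (rule order.refl | simp)+
    then show ?thesis
      using Node \<sigma> m by (auto intro!: run_Cond)
  qed
  then show "\<exists>c. computes_at m c right [:20, 33:]"
    unfolding computes_at_def enc_tree_def by blast
qed

text \<open>The first symbol of a serialized tree already tells a node from a leaf, so one test of
  the top of a stack decides the case.\<close>

lemma pt_if_Leaf:
  assumes "pt h" "pt f" "pt g"
  shows "pt (\<lambda>a. if h a = Leaf then g a else f a)"
proof -
  obtain r where r: "\<And>a. tsize (h a) \<le> poly r (tsize a)" "\<And>m. m \<ge> 2 \<Longrightarrow> \<exists>c. computes_at m c h r"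
    using assms(1) unfolding pt_def by blast
  obtain p where p: "\<And>a. tsize (f a) \<le> poly p (tsize a)" "\<And>m. m \<ge> 2 \<Longrightarrow> \<exists>c. computes_at m c f p"
    using assms(2) unfolding pt_def by blast
  obtain q where q: "\<And>a. tsize (g a) \<le> poly q (tsize a)" "\<And>m. m \<ge> 2 \<Longrightarrow> \<exists>c. computes_at m c g q"
    using assms(3) unfolding pt_def by blast
  show ?thesis
  proof (rule ptI)
    show "tsize (if h a = Leaf then g a else f a) \<le> poly (p + q) (tsize a)" for a
      using p(1)[of a] q(1)[of a] by simp
    fix m :: nat assume m: "2 \<le> m"
    obtain b where b: "computes_at (m + 1) b h r"
      using r(2)[of "m + 1"] m by auto
    obtain c d where c: "computes_at m c f p" and d: "computes_at m d g q"
      using p(2) q(2) m by blast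
    let ?c = "Seq (copy_reg m (m + 1) (m + 2)) (Seq b (Cond (m + 1) (\<lambda>x. is_true x)
      (Seq (clear (m + 1)) c) (Seq (clear (m + 1)) d)))"
    let ?r = "smult 4 r + p + q + [:20, 16:]"
    have "run ?c \<sigma> (\<sigma>(m := ser (enc (if h a = Leaf then g a else f a)))) (poly ?r (tsize a))"
      if \<sigma>: "\<sigma> m = ser (enc a)" "\<forall>j>m. \<sigma> j = []" for \<sigma> a
    proof -
      let ?z = "ser (enc a)" and ?n = "tsize a"
      have 1: "run (copy_reg m (m + 1) (m + 2)) \<sigma> (\<sigma>(m + 1 := ?z)) (16 * ?n + 2)"
        using m \<sigma> by (intro run_copy_reg) (auto simp: tsize_def)
      have 2: "run b (\<sigma>(m + 1 := ?z)) (\<sigma>(m + 1 := ser (h a))) (poly r ?n)"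
        using \<sigma> by (intro computes_at_run[OF b, where a = a]) (auto simp: enc_tree_def)
      have 3: "run (clear (m + 1)) (\<sigma>(m + 1 := ser (h a))) \<sigma> (3 * poly r ?n + 1)"
        using m \<sigma> r(1)[of a] by (intro run_clear) (auto simp: fun_eq_iff tsize_def enc_tree_def)
      have 4: "run c \<sigma> (\<sigma>(m := ser (enc (f a)))) (poly p ?n)"
        using \<sigma> by (intro computes_at_run[OF c, where a = a]) auto
      have 5: "run d \<sigma> (\<sigma>(m := ser (enc (g a)))) (poly q ?n)"
        using \<sigma> by (intro computes_at_run[OF d, where a = a]) auto
      let ?k = "3 * poly r ?n + poly p ?n + poly q ?n + 1"
      have c': "run (Seq (clear (m + 1)) c) (\<sigma>(m + 1 := ser (h a))) (\<sigma>(m := ser (enc (f a)))) ?k"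
        by (rule run_Seq[OF 3 4]) simp
      have d': "run (Seq (clear (m + 1)) d) (\<sigma>(m + 1 := ser (h a))) (\<sigma>(m := ser (enc (g a)))) ?k"
        by (rule run_Seq[OF 3 5]) simp
      have 6: "run (Cond (m + 1) (\<lambda>x. is_true x) (Seq (clear (m + 1)) c) (Seq (clear (m + 1)) d))
          (\<sigma>(m + 1 := ser (h a))) (\<sigma>(m := ser (enc (if h a = Leaf then g a else f a)))) (?k + 2)"
        by (rule run_Cond[where n = ?k]) (use m c' d' in \<open>cases "h a"; auto\<close>)+
      show ?thesis
        by (rule run_Seq[OF 1 run_Seq[OF 2 6 order.refl]]) simp
    qed
    then show "\<exists>c. computes_at m c (\<lambda>a. if h a = Leaf then g a else f a) ?r"
      unfolding computes_at_def by blast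
  qed
qed

section \<open>Iteration over lists\<close>

lemma tsize_take: "tsize (take k xs) \<le> tsize xs"
  by (induction xs arbitrary: k) (auto simp: take_Cons split: nat.splits)

lemma tsize_mem: "x \<in> set xs \<Longrightarrow> tsize x \<le> tsize xs"
  by (induction xs) auto

lemma length_le_tsize: "length xs \<le> tsize xs"
  by (induction xs) auto

text \<open>Registers \<open>m\<close>, \<open>m + 1\<close> and \<open>m + 2\<close> hold the
  state, the environment and the remaining list. The argument triple of \<open>c\<close> is
  assembled in \<open>m + 4\<close> from its end; the environment is copied, as every round needs
  it, whereas element and state are consumed.\<close>

definition fold_body :: "nat \<Rightarrow> com \<Rightarrow> com" where
  "fold_body m c = Seq (Pop (m + 2)) (Seq (read_tree (m + 2) (m + 3) (m + 4) (m + 5))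
     (Seq (move_reg m (m + 4) (m + 5)) (Seq (move_reg (m + 3) (m + 4) (m + 5)) (Seq (Push (m + 4) True)
     (Seq (copy_reg (m + 1) (m + 4) (m + 5)) (Seq (Push (m + 4) True)
     (Seq c (move_reg (m + 4) m (m + 5)))))))))"

definition fold_loop :: "nat \<Rightarrow> com \<Rightarrow> com" where
  "fold_loop m c = While (m + 2) (\<lambda>x. is_true x) (fold_body m c)"

definition fold_com :: "nat \<Rightarrow> com \<Rightarrow> com" where
  "fold_com m c = Seq (Pop m) (Seq (read_tree m (m + 1) (m + 3) (m + 4)) (Seq (Pop m)
     (Seq (read_tree m (m + 2) (m + 3) (m + 4)) (Seq (fold_loop m c)
     (Seq (Pop (m + 2)) (clear (m + 1)))))))"

lemma run_fold_body:
  fixes h :: "'e::tree_enc \<Rightarrow> 'x::tree_enc \<Rightarrow> 's::tree_enc \<Rightarrow> 's"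
  assumes m: "m \<ge> 2" and c: "computes_at (m + 4) c (\<lambda>(e, x, s). h e x s) q"
    and \<sigma>: "\<forall>j>m. \<sigma> j = []"
    and B: "tsize e \<le> B" "tsize x \<le> B" "tsize s \<le> B" "tsize (h e x s) \<le> B"
    and n: "74 * B + 20 + poly q (3 * B + 2) \<le> n"
  shows "run (fold_body m c) (\<sigma>(m := ser (enc s), m + 1 := ser (enc e), m + 2 := ser (enc (x # xs))))
    (\<sigma>(m := ser (enc (h e x s)), m + 1 := ser (enc e), m + 2 := ser (enc xs))) n"
    (is "run _ ?\<sigma>0 ?\<sigma>9 _")
proof -
  let ?s = "ser (enc s)" and ?e = "ser (enc e)" and ?x = "ser (enc x)" and ?xs = "ser (enc xs)"
  note l = tsize_def[symmetric]
  let ?\<sigma>1 = "\<sigma>(m := ?s, m + 1 := ?e, m + 2 := ?x @ ?xs)"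
  let ?\<sigma>2 = "\<sigma>(m := ?s, m + 1 := ?e, m + 2 := ?xs, m + 3 := ?x)"
  let ?\<sigma>3 = "\<sigma>(m := [], m + 1 := ?e, m + 2 := ?xs, m + 3 := ?x, m + 4 := ?s)"
  let ?\<sigma>4 = "\<sigma>(m := [], m + 1 := ?e, m + 2 := ?xs, m + 4 := ?x @ ?s)"
  let ?\<sigma>5 = "\<sigma>(m := [], m + 1 := ?e, m + 2 := ?xs, m + 4 := True # ?x @ ?s)"
  let ?\<sigma>6 = "\<sigma>(m := [], m + 1 := ?e, m + 2 := ?xs, m + 4 := ?e @ True # ?x @ ?s)"
  let ?\<sigma>7 = "\<sigma>(m := [], m + 1 := ?e, m + 2 := ?xs, m + 4 := ser (enc (e, x, s)))"
  let ?\<sigma>8 = "\<sigma>(m := [], m + 1 := ?e, m + 2 := ?xs, m + 4 := ser (enc (h e x s)))"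
  have 1: "run (Pop (m + 2)) ?\<sigma>0 ?\<sigma>1 1"
    using m by (intro run_Pop) (auto simp: fun_eq_iff)
  have 2: "run (read_tree (m + 2) (m + 3) (m + 4) (m + 5)) ?\<sigma>1 ?\<sigma>2 (16 * B + 4)"
    using m \<sigma> B by (intro run_read_tree[where t = "enc x" and w = ?xs]) (auto simp: fun_eq_iff l)
  have 3: "run (move_reg m (m + 4) (m + 5)) ?\<sigma>2 ?\<sigma>3 (14 * B + 2)"
    using m \<sigma> B by (intro run_move_reg) (auto simp: fun_eq_iff l)
  have 4: "run (move_reg (m + 3) (m + 4) (m + 5)) ?\<sigma>3 ?\<sigma>4 (14 * B + 2)"
    using m \<sigma> B by (intro run_move_reg) (auto simp: fun_eq_iff l)
  have 5: "run (Push (m + 4) True) ?\<sigma>4 ?\<sigma>5 2"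
    using m by (intro run_Push) (auto simp: fun_eq_iff)
  have 6: "run (copy_reg (m + 1) (m + 4) (m + 5)) ?\<sigma>5 ?\<sigma>6 (16 * B + 2)"
    using m \<sigma> B by (intro run_copy_reg) (auto simp: fun_eq_iff l)
  have 7: "run (Push (m + 4) True) ?\<sigma>6 ?\<sigma>7 2"
    using m by (intro run_Push) (auto simp: fun_eq_iff enc_prod_def)
  have "tsize (e, x, s) \<le> 3 * B + 2"
    using B by simp
  then have 8: "run c ?\<sigma>7 ?\<sigma>8 (poly q (3 * B + 2))"
    using \<sigma> by (intro computes_at_run[OF c, where a = "(e, x, s)"]) (auto intro: poly_nat_mono)
  have 9: "run (move_reg (m + 4) m (m + 5)) ?\<sigma>8 ?\<sigma>9 (14 * B + 2)"
    using m \<sigma> B by (intro run_move_reg) (auto simp: fun_eq_iff l)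
  show ?thesis
    unfolding fold_body_def
    by (rule run_mono, (rule run_Seq, rule 1 2 3 4 5 6 7 8)+, rule 9) (rule order.refl | use n in simp)+
qed

lemma run_fold_loop:
  fixes h :: "'e::tree_enc \<Rightarrow> 'x::tree_enc \<Rightarrow> 's::tree_enc \<Rightarrow> 's"
  assumes m: "m \<ge> 2" and c: "computes_at (m + 4) c (\<lambda>(e, x, s). h e x s) q"
    and \<sigma>: "\<forall>j>m. \<sigma> j = []"
    and B: "tsize e \<le> B" "\<And>x. x \<in> set xs \<Longrightarrow> tsize x \<le> B" "\<And>k. tsize (fold (h e) (take k xs) s) \<le> B"
  shows "run (fold_loop m c) (\<sigma>(m := ser (enc s), m + 1 := ser (enc e), m + 2 := ser (enc xs)))
    (\<sigma>(m := ser (enc (fold (h e) xs s)), m + 1 := ser (enc e), m + 2 := [False]))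
    (length xs * (74 * B + 22 + poly q (3 * B + 2)) + 1)"
proof -
  let ?n = "74 * B + 20 + poly q (3 * B + 2)"
  define P where "P xs \<longleftrightarrow> (\<forall>s. (\<forall>x\<in>set xs. tsize x \<le> B) \<longrightarrow> (\<forall>k. tsize (fold (h e) (take k xs) s) \<le> B) \<longrightarrow>
    run (fold_loop m c) (\<sigma>(m := ser (enc s), m + 1 := ser (enc e), m + 2 := ser (enc xs)))
      (\<sigma>(m := ser (enc (fold (h e) xs s)), m + 1 := ser (enc e), m + 2 := [False]))
      (length xs * (?n + 2) + 1))" for xs
  have "P xs"
  proof (induction xs)
    case Nil
    show ?case
      unfolding P_def fold_loop_def using m by (auto intro!: run_WhileF)
  next
    case (Cons x xs)
    show ?case
      unfolding P_def
    proof (intro allI impI)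
      fix s assume x: "\<forall>x\<in>set (x # xs). tsize x \<le> B" and k: "\<forall>k. tsize (fold (h e) (take k (x # xs)) s) \<le> B"
      have s: "tsize s \<le> B" "tsize (h e x s) \<le> B"
        using k[rule_format, of 0] k[rule_format, of 1] by auto
      have "tsize (fold (h e) (take k xs) (h e x s)) \<le> B" for k
        using k[rule_format, of "Suc k"] by simp
      then have IH: "run (fold_loop m c) (\<sigma>(m := ser (enc (h e x s)), m + 1 := ser (enc e), m + 2 := ser (enc xs)))
          (\<sigma>(m := ser (enc (fold (h e) (x # xs) s)), m + 1 := ser (enc e), m + 2 := [False]))
          (length xs * (?n + 2) + 1)"
        using Cons.IH x unfolding P_def by simp
      have 1: "run (fold_body m c) (\<sigma>(m := ser (enc s), m + 1 := ser (enc e), m + 2 := ser (enc (x # xs))))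
          (\<sigma>(m := ser (enc (h e x s)), m + 1 := ser (enc e), m + 2 := ser (enc xs))) ?n"
        using x s by (intro run_fold_body[OF m c \<sigma> B(1)]) auto
      show "run (fold_loop m c) (\<sigma>(m := ser (enc s), m + 1 := ser (enc e), m + 2 := ser (enc (x # xs))))
          (\<sigma>(m := ser (enc (fold (h e) (x # xs) s)), m + 1 := ser (enc e), m + 2 := [False]))
          (length (x # xs) * (?n + 2) + 1)"
        using 1 IH unfolding fold_loop_def by (rule run_WhileT[rotated 2]) (use m in auto)
    qed
  qed
  moreover have "?n + 2 = 74 * B + 22 + poly q (3 * B + 2)" by simp
  ultimately show ?thesis using B(2,3) unfolding P_def by metis
qed

text \<open>Polynomial time of a single round is not enough, since iteration could make the state
  exponentially large. The bound covers all lists, hence the prefixes, which yield the intermediate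
  states.\<close>

lemma pt_fold_bounded:
  fixes h :: "'e::tree_enc \<Rightarrow> 'x::tree_enc \<Rightarrow> 's::tree_enc \<Rightarrow> 's"
  assumes "pt (\<lambda>(e, x, s). h e x s)"
    and b: "\<And>e xs s. tsize (fold (h e) xs s) \<le> poly b (tsize e + tsize xs + tsize s)"
  shows "pt (\<lambda>(e, xs, s). fold (h e) xs s)"
proof -
  obtain q where q: "\<And>m. m \<ge> 2 \<Longrightarrow> \<exists>c. computes_at m c (\<lambda>(e, x, s). h e x s) q"
    using assms(1) unfolding pt_def by blast
  let ?b = "b + [:0, 1:]"
  let ?r = "[:0, 1:] * (smult 74 ?b + [:22:] + pcompose q (smult 3 ?b + [:2:])) + [:20, 35:]"
  show ?thesis
  proof (rule ptI)
    show "tsize (case a of (e, xs, s) \<Rightarrow> fold (h e) xs s) \<le> poly b (tsize a)" for a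
      using order.trans[OF b poly_nat_mono] by (auto split: prod.splits)
    fix m :: nat assume m: "2 \<le> m"
    obtain c where c: "computes_at (m + 4) c (\<lambda>(e, x, s). h e x s) q"
      using q[of "m + 4"] m by auto
    have "run (fold_com m c) \<sigma> (\<sigma>(m := ser (enc (fold (h e) xs s)))) (poly ?r (tsize (e, xs, s)))"
      if \<sigma>: "\<sigma> m = ser (enc (e, xs, s))" "\<forall>j>m. \<sigma> j = []" for \<sigma> e xs s
    proof -
      let ?n = "tsize (e, xs, s)"
      let ?B = "poly ?b ?n"
      let ?s = "ser (enc s)" and ?e = "ser (enc e)" and ?xs = "ser (enc xs)" and ?f = "ser (enc (fold (h e) xs s))"
      note l = tsize_def[symmetric]
      have b': "tsize (fold (h e) (take k xs) s) \<le> ?B" for k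
      proof -
        have "tsize (fold (h e) (take k xs) s) \<le> poly b (tsize e + tsize (take k xs) + tsize s)" by (rule b)
        also have "\<dots> \<le> poly b ?n" using tsize_take[of k xs] by (intro poly_nat_mono) simp
        finally show ?thesis by simp
      qed
      have xb: "tsize x \<le> ?B" if "x \<in> set xs" for x
        using tsize_mem[OF that] by simp
      have 1: "run (Pop m) \<sigma> (\<sigma>(m := ?e @ True # ?xs @ ?s)) 1"
        using m \<sigma> by (intro run_Pop) (auto simp: enc_prod_def)
      have 2: "run (read_tree m (m + 1) (m + 3) (m + 4)) (\<sigma>(m := ?e @ True # ?xs @ ?s))
          (\<sigma>(m := True # ?xs @ ?s, m + 1 := ?e)) (16 * ?n + 4)"
        using m \<sigma> by (intro run_read_tree[where t = "enc e"]) (auto simp: fun_eq_iff l)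
      have 3: "run (Pop m) (\<sigma>(m := True # ?xs @ ?s, m + 1 := ?e)) (\<sigma>(m := ?xs @ ?s, m + 1 := ?e)) 1"
        using m \<sigma> by (intro run_Pop) (auto simp: fun_eq_iff)
      have 4: "run (read_tree m (m + 2) (m + 3) (m + 4)) (\<sigma>(m := ?xs @ ?s, m + 1 := ?e))
          (\<sigma>(m := ?s, m + 1 := ?e, m + 2 := ?xs)) (16 * ?n + 4)"
        using m \<sigma> by (intro run_read_tree[where t = "enc xs"]) (auto simp: fun_eq_iff l)
      have "run (fold_loop m c) (\<sigma>(m := ?s, m + 1 := ?e, m + 2 := ?xs))
          (\<sigma>(m := ?f, m + 1 := ?e, m + 2 := [False])) (length xs * (74 * ?B + 22 + poly q (3 * ?B + 2)) + 1)"
        using xb b' by (intro run_fold_loop[OF m c \<sigma>(2)]) auto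
      then have 5: "run (fold_loop m c) (\<sigma>(m := ?s, m + 1 := ?e, m + 2 := ?xs))
          (\<sigma>(m := ?f, m + 1 := ?e, m + 2 := [False])) (?n * (74 * ?B + 22 + poly q (3 * ?B + 2)) + 1)"
        by (rule run_mono) (use length_le_tsize[of xs] in \<open>intro add_mono mult_mono, auto\<close>)
      have 6: "run (Pop (m + 2)) (\<sigma>(m := ?f, m + 1 := ?e, m + 2 := [False])) (\<sigma>(m := ?f, m + 1 := ?e)) 1"
        using m \<sigma> by (intro run_Pop) (auto simp: fun_eq_iff)
      have 7: "run (clear (m + 1)) (\<sigma>(m := ?f, m + 1 := ?e)) (\<sigma>(m := ?f)) (3 * ?n + 1)"
        using m \<sigma> by (intro run_clear) (auto simp: fun_eq_iff l)
      show ?thesis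
        unfolding fold_com_def
        by (rule run_mono, (rule run_Seq, rule 1 2 3 4 5 6)+, rule 7)
          (rule order.refl | simp only: poly_add poly_mult poly_smult poly_pCons poly_0 poly_pcompose, simp)+
    qed
    then show "\<exists>c. computes_at m c (\<lambda>(e, xs, s). fold (h e) xs s) ?r"
      unfolding computes_at_def by (auto split: prod.splits)
  qed
qed

section \<open>Conversion between bit strings and serialized lists of bits\<close>

definition load_loop :: com where
  "load_loop = While 2 (\<lambda>x. nonempty x) (Cond 2 (\<lambda>x. is_true x)
     (Seq (Pop 2) (push_word 3 [True, True, False, False])) (Seq (Pop 2) (push_word 3 [True, False])))"

definition unload_loop :: com where
  "unload_loop = While 3 (\<lambda>x. is_true x) (Seq (Pop 3) (Cond 3 (\<lambda>x. is_true x)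
     (Seq (Pop 3) (Seq (Pop 3) (Seq (Pop 3) (Out True)))) (Seq (Pop 3) (Out False))))"

lemma run_load_loop:
  "run load_loop (\<sigma>(2 := v, 3 := ser (enc u))) (\<sigma>(2 := [], 3 := ser (enc (rev v @ u)))) (13 * length v + 1)"
proof -
  define P where "P v \<longleftrightarrow> (\<forall>u. run load_loop (\<sigma>(2 := v, 3 := ser (enc u)))
    (\<sigma>(2 := [], 3 := ser (enc (rev v @ u)))) (13 * length v + 1))" for v
  have "P v"
  proof (induction v)
    case Nil
    show ?case unfolding P_def load_loop_def by (auto intro: run_WhileF)
  next
    case (Cons b v)
    show ?case
      unfolding P_def
    proof (intro allI)
      fix u :: "bool list"
      let ?\<sigma> = "\<sigma>(2 := v, 3 := ser (enc u))"
      let ?\<sigma>' = "\<sigma>(2 := v, 3 := ser (enc (b # u)))"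
      have 1: "run (Pop 2) (\<sigma>(2 := b # v, 3 := ser (enc u))) ?\<sigma> 1"
        by (intro run_Pop) (auto simp: fun_eq_iff)
      \<comment> \<open>The pushed word is the node marker followed by \<open>ser (enc b)\<close>;
        pushing it conses \<open>b\<close> onto the serialized list.\<close>
      have 2: "run (push_word 3 (if b then [True, True, False, False] else [True, False])) ?\<sigma> ?\<sigma>' 8"
        by (intro run_push_word) (auto simp: fun_eq_iff enc_bool_def)
      have 3: "run (Seq (Pop 2) (push_word 3 (if b then [True, True, False, False] else [True, False])))
          (\<sigma>(2 := b # v, 3 := ser (enc u))) ?\<sigma>' 9"
        by (rule run_Seq[OF 1 2]) simp
      have 4: "run (Cond 2 (\<lambda>x. is_true x) (Seq (Pop 2) (push_word 3 [True, True, False, False]))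
          (Seq (Pop 2) (push_word 3 [True, False]))) (\<sigma>(2 := b # v, 3 := ser (enc u))) ?\<sigma>' 11"
        by (rule run_Cond[where n = 9]) (use 3 in \<open>cases b; simp\<close>)+
      have 5: "run load_loop ?\<sigma>' (\<sigma>(2 := [], 3 := ser (enc (rev (b # v) @ u)))) (13 * length v + 1)"
        using Cons.IH[unfolded P_def, rule_format, of "b # u"] by simp
      show "run load_loop (\<sigma>(2 := b # v, 3 := ser (enc u)))
          (\<sigma>(2 := [], 3 := ser (enc (rev (b # v) @ u)))) (13 * length (b # v) + 1)"
        using 4 5 unfolding load_loop_def by (rule run_WhileT[rotated 2]) auto
    qed
  qed
  then show ?thesis unfolding P_def by blast
qed

lemma run_unload_loop:
  "run unload_loop (\<sigma>(1 := v, 3 := ser (enc (w :: bool list)))) (\<sigma>(1 := v @ w, 3 := [False])) (9 * length w + 1)"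
proof -
  define P where "P w \<longleftrightarrow> (\<forall>v. run unload_loop (\<sigma>(1 := v, 3 := ser (enc w)))
    (\<sigma>(1 := v @ w, 3 := [False])) (9 * length w + 1))" for w :: "bool list"
  have "P w"
  proof (induction w)
    case Nil
    show ?case unfolding P_def unload_loop_def by (auto intro: run_WhileF)
  next
    case (Cons b w)
    show ?case
      unfolding P_def
    proof (intro allI)
      fix v
      let ?\<sigma>0 = "\<sigma>(1 := v, 3 := ser (enc (b # w)))"
      let ?\<sigma>1 = "\<sigma>(1 := v, 3 := ser (enc b) @ ser (enc w))"
      let ?\<sigma>2 = "\<sigma>(1 := v @ [b], 3 := ser (enc w))"
      have 1: "run (Pop 3) ?\<sigma>0 ?\<sigma>1 1"
        by (intro run_Pop) (auto simp: fun_eq_iff)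
      have 2: "run (if b then Seq (Pop 3) (Seq (Pop 3) (Seq (Pop 3) (Out True))) else Seq (Pop 3) (Out False))
          ?\<sigma>1 ?\<sigma>2 4"
      proof (cases b)
        case True
        have "run (Pop 3) ?\<sigma>1 (\<sigma>(1 := v, 3 := False # False # ser (enc w))) 1"
          "run (Pop 3) (\<sigma>(1 := v, 3 := False # False # ser (enc w))) (\<sigma>(1 := v, 3 := False # ser (enc w))) 1"
          "run (Pop 3) (\<sigma>(1 := v, 3 := False # ser (enc w))) (\<sigma>(1 := v, 3 := ser (enc w))) 1"
          "run (Out True) (\<sigma>(1 := v, 3 := ser (enc w))) ?\<sigma>2 1"
          by (auto intro!: run_Pop run_Out simp: True enc_bool_def fun_eq_iff)
        from run_Seq[OF this(1) run_Seq[OF this(2) run_Seq[OF this(3,4) order.refl] order.refl], of 4]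
        show ?thesis by (simp add: True)
      next
        case False
        have "run (Pop 3) ?\<sigma>1 (\<sigma>(1 := v, 3 := ser (enc w))) 1"
          "run (Out False) (\<sigma>(1 := v, 3 := ser (enc w))) ?\<sigma>2 1"
          by (auto intro!: run_Pop run_Out simp: False enc_bool_def fun_eq_iff)
        from run_Seq[OF this, of 4] show ?thesis by (simp add: False)
      qed
      have 3: "run (Cond 3 (\<lambda>x. is_true x) (Seq (Pop 3) (Seq (Pop 3) (Seq (Pop 3) (Out True))))
          (Seq (Pop 3) (Out False))) ?\<sigma>1 ?\<sigma>2 6"
        by (rule run_Cond[where n = 4]) (use 2 in \<open>cases b; simp add: enc_bool_def\<close>)+
      have 4: "run unload_loop ?\<sigma>2 (\<sigma>(1 := v @ b # w, 3 := [False])) (9 * length w + 1)"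
        using Cons.IH unfolding P_def by (metis append.assoc append_Cons append_Nil)
      show "run unload_loop ?\<sigma>0 (\<sigma>(1 := v @ b # w, 3 := [False])) (9 * length (b # w) + 1)"
        using run_Seq[OF 1 3 order.refl] 4 unfolding unload_loop_def by (rule run_WhileT[rotated 2]) auto
    qed
  qed
  then show ?thesis unfolding P_def by blast
qed

lemma tsize_bool_list: "tsize (w :: bool list) \<le> 4 * length w + 1"
proof (induction w)
  case (Cons b w)
  then show ?case by (cases b) auto
qed simp

theorem polytime_computable_pt:
  assumes "pt (f :: bool list \<Rightarrow> bool list)"
  shows "polytime_computable f"
proof -
  obtain q where q: "\<And>w. tsize (f w) \<le> poly q (tsize w)" "\<And>m. m \<ge> 2 \<Longrightarrow> \<exists>c. computes_at m c f q"
    using assms unfolding pt_def by blast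
  obtain c where c: "computes_at 3 c f q"
    using q(2)[of 3] by auto
  \<comment> \<open>Register 2 receives the reversed input, so that consing from its top restores
    the order; \<open>Push 3 False\<close> creates the empty list. The polynomial
    \<open>[:1, 4:]\<close> bounds the size of the encoded word by its length.\<close>
  let ?c = "Seq (rev_onto 0 2) (Seq (Push 3 False) (Seq load_loop (Seq c unload_loop)))"
  let ?q = "pcompose q [:1, 4:]"
  let ?p = "smult 10 ?q + [:5, 20:]"
  have "\<exists>\<sigma>. run ?c ((\<lambda>_. [])(0 := w)) \<sigma> (poly ?p (length w)) \<and> \<sigma> 1 = f w" for w
  proof -
    let ?\<sigma> = "(\<lambda>_. []) :: store" and ?n = "length w"
    have le: "poly q (tsize w) \<le> poly ?q ?n"
      using poly_nat_mono[OF tsize_bool_list[of w]] by (simp add: poly_pcompose add.commute mult.commute)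
    have f: "length (f w) \<le> poly ?q ?n"
      using length_le_tsize[of "f w"] q(1)[of w] le by linarith
    have 1: "run (rev_onto 0 2) (?\<sigma>(0 := w)) (?\<sigma>(2 := rev w)) (7 * ?n + 1)"
      by (intro run_rev_onto) (auto simp: fun_eq_iff)
    have 2: "run (Push 3 False) (?\<sigma>(2 := rev w)) (?\<sigma>(2 := rev w, 3 := ser (enc ([] :: bool list)))) 2"
      by (intro run_Push) (auto simp: fun_eq_iff)
    have "?\<sigma>(2 := [], 3 := ser (enc (rev (rev w) @ []))) = ?\<sigma>(3 := ser (enc w))"
      by (auto simp: fun_eq_iff)
    then have 3: "run load_loop (?\<sigma>(2 := rev w, 3 := ser (enc ([] :: bool list)))) (?\<sigma>(3 := ser (enc w))) (13 * ?n + 1)"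
      using run_load_loop[of ?\<sigma> "rev w" "[]"] by simp
    have 4: "run c (?\<sigma>(3 := ser (enc w))) (?\<sigma>(3 := ser (enc (f w)))) (poly ?q ?n)"
      using le by (intro computes_at_run[OF c, where a = w]) auto
    have "?\<sigma>(1 := [], 3 := ser (enc (f w))) = ?\<sigma>(3 := ser (enc (f w)))"
      by (auto simp: fun_eq_iff)
    then have "run unload_loop (?\<sigma>(3 := ser (enc (f w)))) (?\<sigma>(1 := [] @ f w, 3 := [False])) (9 * length (f w) + 1)"
      using run_unload_loop[of ?\<sigma> "[]" "f w"] by simp
    then have 5: "run unload_loop (?\<sigma>(3 := ser (enc (f w)))) (?\<sigma>(1 := [] @ f w, 3 := [False])) (9 * poly ?q ?n + 1)"
      by (rule run_mono) (use f in simp)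
    have "run ?c (?\<sigma>(0 := w)) (?\<sigma>(1 := [] @ f w, 3 := [False])) (poly ?p (length w))"
      by (rule run_mono, (rule run_Seq, rule 1 2 3 4)+, rule 5) (rule order.refl | simp)+
    then show ?thesis by fastforce
  qed
  then show ?thesis by (rule polytime_computable_run)
qed

subsection \<open>Closure properties\<close>

text \<open>Applied backwards, these rules derive \<open>pt\<close> along the syntax of a function.
  Functions on instances and formulas are therefore written with the operations covered here, such
  as \<open>hd (drop i xs)\<close> for indexing.\<close>

named_theorems pt_rules

lemma pt_enc [pt_rules]: "pt f \<Longrightarrow> pt (\<lambda>a. enc (f a))"
  by (erule pt_cong_enc[where h = "\<lambda>a. a"]) (simp_all add: enc_tree_def)

lemma pt_via_tree:
  assumes "pt g" "\<And>a. enc (f a) = (g a :: tree)"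
  shows "pt f"
  by (rule pt_cong_enc[where h = "\<lambda>a. a", OF assms(1)]) (simp_all add: assms(2) enc_tree_def)

lemma pt_cong: "pt g \<Longrightarrow> (\<And>a. f a = g a) \<Longrightarrow> pt f"
  by (erule back_subst[where P = pt]) auto

lemma pt_Pair [pt_rules]: "pt f \<Longrightarrow> pt g \<Longrightarrow> pt (\<lambda>a. (f a, g a))"
  by (rule pt_via_tree[OF pt_Node[OF pt_enc pt_enc]]) (auto simp: enc_prod_def)

lemma pt_fst [pt_rules]: "pt f \<Longrightarrow> pt (\<lambda>a. fst (f a))"
  by (rule pt_via_tree[OF pt_comp[OF pt_left pt_enc]]) (auto simp: enc_prod_def)

lemma pt_snd [pt_rules]: "pt f \<Longrightarrow> pt (\<lambda>a. snd (f a))"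
  by (rule pt_via_tree[OF pt_comp[OF pt_right pt_enc]]) (auto simp: enc_prod_def)

lemma pt_Cons [pt_rules]: "pt f \<Longrightarrow> pt g \<Longrightarrow> pt (\<lambda>a. f a # g a)"
  by (rule pt_via_tree[OF pt_Node[OF pt_enc pt_enc]]) auto

lemma pt_tl [pt_rules]: "pt f \<Longrightarrow> pt (\<lambda>a. tl (f a))"
proof (rule pt_via_tree[OF pt_comp[OF pt_right pt_enc]])
  show "enc (tl (f a)) = right (enc (f a))" for a by (cases "f a") auto
qed

lemma pt_Suc [pt_rules]: "pt f \<Longrightarrow> pt (\<lambda>a. Suc (f a))"
  by (rule pt_via_tree[OF pt_Node[OF pt_const pt_enc]]) auto

lemma pt_pred: "pt f \<Longrightarrow> pt (\<lambda>a. f a - Suc 0)"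
proof (rule pt_via_tree[OF pt_comp[OF pt_right pt_enc]])
  show "enc (f a - Suc 0) = right (enc (f a))" for a by (cases "f a") auto
qed

lemma pt_if [pt_rules]:
  assumes "pt b" "pt f" "pt g"
  shows "pt (\<lambda>a. if b a then f a else g a)"
  using pt_if_Leaf[OF pt_enc[OF assms(1)] assms(2,3)] unfolding enc_bool_def
  by (rule back_subst[where P = pt]) auto

lemma pt_not [pt_rules]: "pt f \<Longrightarrow> pt (\<lambda>a. \<not> f a)"
  by (rule pt_cong[OF pt_if[OF _ pt_const[of False] pt_const[of True], of f]]) auto

lemma pt_conj [pt_rules]: "pt f \<Longrightarrow> pt g \<Longrightarrow> pt (\<lambda>a. f a \<and> g a)"
  by (rule pt_cong[OF pt_if[OF _ _ pt_const[of False], of f g]]) auto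

lemma pt_imp [pt_rules]: "pt f \<Longrightarrow> pt g \<Longrightarrow> pt (\<lambda>a. f a \<longrightarrow> g a)"
  by (rule pt_cong[OF pt_if[OF _ _ pt_const[of True], of f g]]) auto

lemma pt_Leaf: "pt f \<Longrightarrow> pt (\<lambda>a. f a = Leaf)"
  by (rule pt_cong[OF pt_if_Leaf[OF _ pt_const[of False] pt_const[of True], of f]]) auto

lemma pt_null [pt_rules]:
  assumes "pt f"
  shows "pt (\<lambda>a. f a = [])"
proof (rule pt_cong[OF pt_Leaf[OF pt_enc[OF assms]]])
  show "(f a = []) = (enc (f a) = Leaf)" for a by (cases "f a") auto
qed

lemma pt_zero [pt_rules]:
  assumes "pt f"
  shows "pt (\<lambda>a. f a = (0 :: nat))"
proof (rule pt_cong[OF pt_Leaf[OF pt_enc[OF assms]]])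
  show "(f a = 0) = (enc (f a) = Leaf)" for a by (cases "f a") auto
qed

lemma pt_hd [pt_rules]:
  fixes f :: "'a::tree_enc \<Rightarrow> 'b::tree_enc list"
  assumes "pt f"
  shows "pt (\<lambda>a. hd (f a))"
\<comment> \<open>The value of \<open>hd []\<close> is unknown but fixed, so its encoding can be
  supplied as a constant.\<close>
proof (rule pt_via_tree[OF pt_if[OF pt_null[OF assms] pt_const[of "enc (hd [] :: 'b)"] pt_comp[OF pt_left pt_enc[OF assms]]]])
  show "enc (hd (f a)) = (if f a = [] then enc (hd [] :: 'b) else left (enc (f a)))" for a
    by (cases "f a") auto
qed

lemma pt_bound:
  assumes "pt f"
  obtains p where "\<And>a. tsize (f a) \<le> poly p (tsize a)"
  using assms unfolding pt_def by blast

lemma pt_bound_pair: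
  assumes "pt (\<lambda>p. h (fst p) (snd p))"
  obtains p where "\<And>e x. tsize (h e x) \<le> poly p (tsize e + tsize x)"
proof -
  obtain p where p: "\<And>a. tsize (h (fst a) (snd a)) \<le> poly p (tsize a)"
    using pt_bound[OF assms] by blast
  have "tsize (h e x) \<le> poly (pcompose p [:1, 1:]) (tsize e + tsize x)" for e x
    using p[of "(e, x)"] by (simp add: poly_pcompose)
  then show ?thesis using that by blast
qed

text \<open>Since a fold only has polynomially many steps, it suffices that a single step enlarges the
  state by an amount that does not depend on the state.\<close>

lemma pt_fold:
  fixes h :: "'e::tree_enc \<Rightarrow> 'x::tree_enc \<Rightarrow> 's::tree_enc \<Rightarrow> 's"
  assumes "pt (\<lambda>p. h (fst p) (fst (snd p)) (snd (snd p)))"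
    and step: "\<And>e x s. tsize (h e x s) \<le> tsize s + poly p (tsize e + tsize x)"
    and "pt xs" "pt s"
  shows "pt (\<lambda>a. fold (h a) (xs a) (s a))"
proof -
  have b: "tsize (fold (h e) xs s) \<le> tsize s + length xs * poly p (tsize e + n)"
    if "\<forall>x\<in>set xs. tsize x \<le> n" for e xs s n
    using that
  proof (induction xs arbitrary: s)
    case (Cons x xs)
    have "tsize (fold (h e) xs (h e x s)) \<le> tsize (h e x s) + length xs * poly p (tsize e + n)"
      using Cons by simp
    also have "tsize (h e x s) \<le> tsize s + poly p (tsize e + n)"
      using step[of e x s] poly_nat_mono[of "tsize e + tsize x" "tsize e + n" p] Cons.prems by simp
    finally show ?case by simp
  qed simp
  have "pt (\<lambda>(e, xs, s). fold (h e) xs s)"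
  proof (rule pt_fold_bounded)
    show "pt (\<lambda>(e, x, s). h e x s)"
      by (rule pt_cong[OF assms(1)]) (auto split: prod.splits)
    fix e :: 'e and xs :: "'x list" and s :: 's
    let ?n = "tsize e + tsize xs + tsize s"
    have "tsize (fold (h e) xs s) \<le> tsize s + length xs * poly p (tsize e + tsize xs)"
      using b[of xs "tsize xs"] tsize_mem[of _ xs] by blast
    also have "length xs * poly p (tsize e + tsize xs) \<le> ?n * poly p ?n"
      using length_le_tsize[of xs] by (intro mult_le_mono poly_nat_mono) auto
    finally show "tsize (fold (h e) xs s) \<le> poly ([:0, 1:] + [:0, 1:] * p) ?n"
      by simp
  qed
  from pt_comp[OF this pt_Pair[OF pt_id pt_Pair[OF assms(3,4)]]] show ?thesis by simp
qed

lemma pt_rev [pt_rules]: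
  assumes "pt f"
  shows "pt (\<lambda>a. rev (f a))"
proof -
  have "pt (\<lambda>a. fold (\<lambda>x s. x # s) (f a) [])"
    by (rule pt_fold[where p = "[:1, 1:]" and h = "\<lambda>_ x s. x # s"])
      (rule assms pt_const pt_id pt_rules | simp)+
  then show ?thesis by (simp add: rev_conv_fold)
qed

lemma pt_append [pt_rules]:
  assumes "pt f" "pt g"
  shows "pt (\<lambda>a. f a @ g a)"
proof -
  have "pt (\<lambda>a. fold (\<lambda>x s. x # s) (rev (f a)) (g a))"
    by (rule pt_fold[where p = "[:1, 1:]" and h = "\<lambda>_ x s. x # s"])
      (rule assms pt_const pt_id pt_rules | simp)+
  then show ?thesis by (simp add: fold_Cons_rev)
qed

lemma fold_Cons_map: "fold (\<lambda>x s. h x # s) xs s = rev (map h xs) @ s"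
  by (induction xs arbitrary: s) auto

text \<open>The mapped function receives the whole input as its environment: outer and bound
  variables become projections of the pair of \<open>a\<close> and \<open>x\<close>. The rules for
  filters and bounded quantifiers have the same form, so nested binders are handled by nested
  pairs.\<close>

lemma pt_map [pt_rules]:
  assumes "pt (\<lambda>p. h (fst p) (snd p))" "pt xs"
  shows "pt (\<lambda>a. map (h a) (xs a))"
proof -
  obtain p where p: "\<And>e x. tsize (h e x) \<le> poly p (tsize e + tsize x)"
    using pt_bound_pair[OF assms(1)] by blast
  have "pt (\<lambda>q. (\<lambda>q. h (fst q) (snd q)) (fst q, fst (snd q)))"
    by (rule pt_comp[OF assms(1)]) (rule pt_const pt_id pt_rules)+
  then have h: "pt (\<lambda>q. h (fst q) (fst (snd q)))" by simp
  have "pt (\<lambda>a. rev (fold (\<lambda>x s. h a x # s) (xs a) []))"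
    by (rule pt_rev, rule pt_fold[where p = "1 + p" and h = "\<lambda>a x s. h a x # s"])
      (rule assms pt_const pt_id h pt_rules | simp add: p)+
  then show ?thesis by (simp add: fold_Cons_map)
qed

lemma tsize_append: "tsize (xs @ ys) + 1 = tsize xs + tsize ys"
  by (induction xs) auto

lemma pt_concat [pt_rules]:
  assumes "pt f"
  shows "pt (\<lambda>a. concat (f a))"
proof -
  have le: "tsize (xs @ ys) \<le> tsize ys + poly [:0, 1:] (tsize e + tsize xs)" for e xs ys
    using tsize_append[of xs ys] by simp
  have "pt (\<lambda>a. fold (\<lambda>x s. x @ s) (rev (f a)) [])"
    by (rule pt_fold[where p = "[:0, 1:]" and h = "\<lambda>_ x s. x @ s"], rule_tac [2] le)
      (rule assms pt_const pt_id pt_rules)+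
  then show ?thesis by (simp add: foldr_conv_fold[symmetric] concat_conv_foldr)
qed

lemma pt_filter [pt_rules]:
  assumes "pt (\<lambda>p. h (fst p) (snd p))" "pt xs"
  shows "pt (\<lambda>a. filter (h a) (xs a))"
proof -
  have "pt (\<lambda>a. concat (map (\<lambda>x. if h a x then [x] else []) (xs a)))"
    by (rule assms pt_const pt_id pt_rules)+
  moreover have "concat (map (\<lambda>x. if P x then [x] else []) ys) = filter P ys" for P and ys :: "'b list"
    by (induction ys) auto
  ultimately show ?thesis by simp
qed

lemma pt_Ball [pt_rules]:
  assumes "pt (\<lambda>p. h (fst p) (snd p))" "pt xs"
  shows "pt (\<lambda>a. \<forall>x\<in>set (xs a). h a x)"
proof -
  have "pt (\<lambda>a. filter (\<lambda>x. \<not> h a x) (xs a) = [])"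
    by (rule assms pt_const pt_id pt_rules)+
  then show ?thesis by (simp add: filter_empty_conv)
qed

lemma pt_Bex [pt_rules]:
  assumes "pt (\<lambda>p. h (fst p) (snd p))" "pt xs"
  shows "pt (\<lambda>a. \<exists>x\<in>set (xs a). h a x)"
proof -
  have "pt (\<lambda>a. \<not> (\<forall>x\<in>set (xs a). \<not> h a x))"
    by (rule assms pt_const pt_id pt_rules)+
  then show ?thesis by simp
qed

lemma pt_units: "pt f \<Longrightarrow> pt (\<lambda>a. replicate (f a) ())"
proof (rule pt_via_tree[OF pt_enc])
  have "enc (replicate n ()) = enc n" for n by (induction n) (auto simp: enc_unit_def)
  then show "enc (replicate (f a) ()) = enc (f a)" for a .
qed

lemma fold_replicate: "fold (\<lambda>_. g) (replicate n u) s = (g ^^ n) s"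
  by (induction n arbitrary: s) (auto simp: funpow_swap1)

lemma pt_funpow:
  fixes h :: "'e::tree_enc \<Rightarrow> 's::tree_enc \<Rightarrow> 's"
  assumes "pt (\<lambda>p. h (fst p) (snd p))" "pt n" "pt s"
    and "\<And>e s. tsize (h e s) \<le> tsize s + poly p (tsize e)"
  shows "pt (\<lambda>a. (h a ^^ n a) (s a))"
proof -
  have "pt (\<lambda>q. (\<lambda>q. h (fst q) (snd q)) (fst q, snd (snd q)))"
    by (rule pt_comp[OF assms(1)]) (rule pt_const pt_id pt_rules)+
  then have h: "pt (\<lambda>q. h (fst q) (snd (snd q)))" by simp
  have le: "tsize (h e s) \<le> tsize s + poly p (tsize e + tsize (u :: unit))" for e s u
    by (rule order.trans[OF assms(4)]) (auto intro: poly_nat_mono)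
  have "pt (\<lambda>a. fold (\<lambda>_. h a) (replicate (n a) ()) (s a))"
    by (rule pt_fold[where p = p and h = "\<lambda>a _. h a"], rule_tac [2] le)
      (rule assms pt_units h)+
  then show ?thesis by (simp add: fold_replicate)
qed

section \<open>Arithmetic on unary numbers, and further list functions\<close>

lemma tsize_nat [simp]: "tsize (n :: nat) = 2 * n + 1"
  by (induction n) auto

lemma pt_diff [pt_rules]:
  assumes "pt f" "pt g"
  shows "pt (\<lambda>a. f a - (g a :: nat))"
proof -
  have "pt (\<lambda>a. ((\<lambda>n. n - Suc 0) ^^ g a) (f a))"
    by (rule pt_funpow[where p = 0 and h = "\<lambda>_ n. n - Suc 0"])
      (rule assms pt_const pt_id pt_pred pt_rules | simp)+
  moreover have "((\<lambda>n. n - Suc 0) ^^ n) m = m - n" for n m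
    by (induction n) auto
  ultimately show ?thesis by simp
qed

lemma pt_less [pt_rules]: "pt f \<Longrightarrow> pt g \<Longrightarrow> pt (\<lambda>a. f a < (g a :: nat))"
  by (rule pt_cong[OF pt_not[OF pt_zero[OF pt_diff[of g f]]]]) auto

lemma pt_add [pt_rules]:
  assumes "pt f" "pt g"
  shows "pt (\<lambda>a. f a + (g a :: nat))"
proof -
  have "pt (\<lambda>a. (Suc ^^ g a) (f a))"
    by (rule pt_funpow[where p = "[:2:]" and h = "\<lambda>_. Suc"])
      (rule assms pt_const pt_id pt_rules | simp)+
  then show ?thesis by (rule pt_cong) simp
qed

lemma pt_mult [pt_rules]:
  assumes "pt f" "pt g"
  shows "pt (\<lambda>a. f a * (g a :: nat))"
proof -
  obtain p where p: "\<And>a. tsize (f a) \<le> poly p (tsize a)"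
    using pt_bound[OF assms(1)] by blast
  have f: "pt (\<lambda>q. f (fst q))"
    by (rule pt_comp[OF assms(1)]) (rule pt_const pt_id pt_rules)+
  have step: "tsize (n + f a) \<le> tsize n + poly p (tsize a)" for n a
    using p[of a] by simp
  have "pt (\<lambda>a. ((\<lambda>n. n + f a) ^^ g a) 0)"
    by (rule pt_funpow[OF _ assms(2) pt_const step]) (rule f pt_id pt_rules)+
  moreover have "((\<lambda>n. n + m) ^^ n) 0 = m * n" for n m :: nat
    by (induction n) auto
  ultimately show ?thesis by simp
qed

lemma pt_poly [pt_rules]:
  assumes "pt f"
  shows "pt (\<lambda>a. poly p (f a :: nat))"
proof (induction p)
  case 0
  show ?case by (simp add: pt_const)
next
  case (pCons c p)
  have "pt (\<lambda>a. c + f a * poly p (f a))"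
    by (rule assms pCons.IH pt_const pt_add pt_mult)+
  then show ?case by simp
qed

lemma pt_length [pt_rules]:
  assumes "pt f"
  shows "pt (\<lambda>a. length (f a))"
proof -
  have "pt (\<lambda>a. fold (\<lambda>_. Suc) (f a) 0)"
    by (rule pt_fold[where p = "[:2:]" and h = "\<lambda>_ _. Suc"])
      (rule assms pt_const pt_id pt_rules | simp)+
  moreover have "fold (\<lambda>_. Suc) xs n = length xs + n" for xs :: "'b list" and n
    by (induction xs arbitrary: n) auto
  ultimately show ?thesis by simp
qed

lemma pt_replicate [pt_rules]:
  assumes "pt f" "pt g"
  shows "pt (\<lambda>a. replicate (f a) (g a))"
proof -
  have "pt (\<lambda>q. g (fst q))"
    by (rule pt_comp[OF assms(2)]) (rule pt_const pt_id pt_rules)+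
  then have "pt (\<lambda>a. map (\<lambda>_. g a) (replicate (f a) ()))"
    by (rule pt_map[OF _ pt_units[OF assms(1)], where h = "\<lambda>a _. g a"])
  then show ?thesis by simp
qed

lemma pt_drop [pt_rules]:
  assumes "pt f" "pt g"
  shows "pt (\<lambda>a. drop (f a) (g a))"
proof -
  have "tsize (tl xs) \<le> tsize xs" for xs :: "'b list" by (cases xs) auto
  then have "pt (\<lambda>a. (tl ^^ f a) (g a))"
    by (intro pt_funpow[where p = "0" and h = "\<lambda>_. tl"])
      (rule assms pt_const pt_id pt_rules | simp)+
  moreover have "(tl ^^ n) xs = drop n xs" for n and xs :: "'b list"
    by (induction n) (auto simp: drop_Suc tl_drop)
  ultimately show ?thesis by simp
qed

text \<open>The guard keeps the growth in each step bounded in terms of \<open>f a\<close>.\<close>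

lemma pt_upt [pt_rules]:
  assumes "pt f"
  shows "pt (\<lambda>a. [0..<f a])"
proof -
  obtain p where p: "\<And>a. tsize (f a) \<le> poly p (tsize a)"
    using pt_bound[OF assms(1)] by blast
  let ?h = "\<lambda>a s. if length s < f a then length s # s else s"
  have f: "pt (\<lambda>q. f (fst q))"
    by (rule pt_comp[OF assms(1)]) (rule pt_const pt_id pt_rules)+
  have "tsize (?h a s) \<le> tsize s + poly p (tsize a)" for a s
    using p[of a] by auto
  then have "pt (\<lambda>a. rev ((?h a ^^ f a) []))"
    by (intro pt_rev pt_funpow[where p = p and h = ?h]) (rule assms f pt_const pt_id pt_rules)+
  moreover have "((\<lambda>s. if length s < m then length s # s else s) ^^ n) [] = rev [0..<n]" if "n \<le> m" for n m
    using that by (induction n) auto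
  ultimately show ?thesis by simp
qed

lemma pt_zip [pt_rules]:
  assumes "pt f" "pt g"
  shows "pt (\<lambda>a. zip (f a) (g a))"
proof -
  let ?h = "\<lambda>x s. if fst s = [] then s else (tl (fst s), (x, hd (fst s)) # snd s)"
  have "tsize (?h x s) \<le> tsize s + poly [:2, 1:] (tsize e + tsize x)" for e x s
    by (cases s; cases "fst s") auto
  then have "pt (\<lambda>a. rev (snd (fold ?h (f a) (g a, []))))"
    by (intro pt_rev pt_snd pt_fold[where p = "[:2, 1:]" and h = "\<lambda>_. ?h"])
      (rule assms pt_const pt_id pt_rules | assumption)+
  moreover have "snd (fold ?h xs (ys, zs)) = rev (zip xs ys) @ zs" for xs :: "'b list" and ys :: "'c list" and zs
  proof (induction xs arbitrary: ys zs)
    case (Cons x xs)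
    have "snd (fold ?h xs ([], zs)) = zs" for xs :: "'b list"
      by (induction xs) auto
    then show ?case using Cons.IH by (cases ys) auto
  qed simp
  ultimately show ?thesis by simp
qed

lemma pt_encode_list [pt_rules]:
  assumes "pt (\<lambda>p. e (fst p) (snd p))" "pt f"
  shows "pt (\<lambda>a. encode_list (e a) (f a))"
  unfolding encode_list_def by (rule assms pt_const pt_id pt_rules)+

lemma pt_encode_string [pt_rules]: "pt f \<Longrightarrow> pt (\<lambda>a. encode_string (f a))"
  unfolding encode_string_def by (rule pt_const pt_id pt_rules | assumption)+

text \<open>Indexing by a type lets resolution find an equality test by recursion on the structure
  of the type, as a type class would.\<close>

definition pt_eq :: "'a::tree_enc itself \<Rightarrow> bool" where
  "pt_eq T \<longleftrightarrow> pt (\<lambda>p :: 'a \<times> 'a. fst p = snd p)"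

lemma pt_eqI [pt_rules]:
  fixes f :: "'a::tree_enc \<Rightarrow> 'b::tree_enc"
  assumes "pt_eq TYPE('b)" "pt f" "pt g"
  shows "pt (\<lambda>a. f a = g a)"
  using pt_comp[OF assms(1)[unfolded pt_eq_def] pt_Pair[OF assms(2,3)]] by simp

lemma pt_eq_bool [pt_rules]: "pt_eq TYPE(bool)"
proof -
  have "pt (\<lambda>p. if fst p then snd p else \<not> snd p)"
    by (rule pt_const pt_id pt_rules)+
  then show ?thesis unfolding pt_eq_def by (rule back_subst[where P = pt]) auto
qed

lemma pt_eq_nat [pt_rules]: "pt_eq TYPE(nat)"
proof -
  have "pt (\<lambda>p :: nat \<times> nat. \<not> fst p < snd p \<and> \<not> snd p < fst p)"
    by (rule pt_const pt_id pt_rules)+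
  then show ?thesis unfolding pt_eq_def by (rule back_subst[where P = pt]) auto
qed

lemma pt_eq_list [pt_rules]:
  assumes "pt_eq TYPE('a::tree_enc)"
  shows "pt_eq TYPE('a list)"
proof -
  let ?h = "\<lambda>(x :: 'a) s. (tl (fst s), snd s \<and> fst s \<noteq> [] \<and> hd (fst s) = x)"
  have "tsize (?h x s) \<le> tsize s + poly [:2:] (tsize e + tsize x)" for e x s
  proof -
    have "tsize b \<le> 3" for b :: bool by (cases b) auto
    from this[of "snd s \<and> fst s \<noteq> [] \<and> hd (fst s) = x"] tsize_pos[of "snd s"] show ?thesis
      by (cases s; cases "fst s") (auto simp del: tsize_pos)
  qed
  then have "pt (\<lambda>p. fst (fold ?h (fst p) (snd p, True)) = [] \<and> snd (fold ?h (fst p) (snd p, True)))"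
    by (intro pt_conj pt_null pt_fst pt_snd pt_fold[where p = "[:2:]" and h = "\<lambda>_. ?h"])
      (rule assms pt_const pt_id pt_rules | assumption)+
  moreover have "fst (fold ?h xs (ys, b)) = [] \<and> snd (fold ?h xs (ys, b)) \<longleftrightarrow> b \<and> xs = ys" for xs ys b
  proof (induction xs arbitrary: ys b)
    case (Cons x xs)
    then show ?case by (cases ys) auto
  qed auto
  ultimately show ?thesis unfolding pt_eq_def by simp
qed

lemma pt_mem [pt_rules]:
  fixes f :: "'a::tree_enc \<Rightarrow> 'b::tree_enc"
  assumes "pt_eq TYPE('b)" "pt f" "pt g"
  shows "pt (\<lambda>a. f a \<in> set (g a))"
proof -
  have f: "pt (\<lambda>q. f (fst q))"
    by (rule pt_comp[OF assms(2)]) (rule pt_const pt_id pt_rules)+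
  have "pt (\<lambda>a. \<exists>x\<in>set (g a). x = f a)"
    by (rule assms f pt_const pt_id pt_rules)+
  then show ?thesis by (rule pt_cong) auto
qed

lemma distinct_conv_drop: "distinct xs \<longleftrightarrow> (\<forall>i\<in>set [0..<length xs]. hd (drop i xs) \<notin> set (drop (Suc i) xs))"
proof (induction xs)
  case (Cons x xs)
  have "set [0..<length (x # xs)] = insert 0 (Suc ` set [0..<length xs])"
    by (simp add: atLeast0_lessThan_Suc_eq_insert_0 del: upt_Suc)
  then show ?case unfolding Cons distinct.simps by (simp only: ball_simps) (simp del: set_upt)
qed simp

lemma pt_distinct [pt_rules]:
  assumes "pt_eq TYPE('b::tree_enc)" "pt (f :: 'a::tree_enc \<Rightarrow> 'b list)"
  shows "pt (\<lambda>a. distinct (f a))"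
proof -
  have f: "pt (\<lambda>q. f (fst q))"
    by (rule pt_comp[OF assms(2)]) (rule pt_const pt_id pt_rules)+
  show ?thesis
    unfolding distinct_conv_drop by (rule assms f pt_const pt_id pt_rules)+
qed

section \<open>Rank functions for order compatibilities\<close>

lemma listing_props:
  assumes "finite E" "strong_total_order_on E T"
  shows "distinct (listing E T)" "set (listing E T) = E" "sorted_wrt (\<lambda>s t. (s, t) \<in> T) (listing E T)"
  using theI'[OF listing_ex1[OF assms]] unfolding listing_def by auto

lemma remdups_adj_nth_nth:
  assumes "i < j" "j < length xs" "xs ! i \<noteq> xs ! j"
  shows "\<exists>i' j'. i' < j' \<and> j' < length (remdups_adj xs) \<and>
    remdups_adj xs ! i' = xs ! i \<and> remdups_adj xs ! j' = xs ! j"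
  using assms
proof (induction xs arbitrary: i j rule: remdups_adj.induct)
  case (3 x y xs)
  show ?case
  proof (cases "x = y")
    case True
    \<comment> \<open>Dropping one of the two equal heads lowers all later indices by one. Truncated
      subtraction sends both 0 and 1 to 0, which is right because \<open>x = y\<close>.\<close>
    have nth: "(x # y # xs) ! k = (x # xs) ! (k - 1)" for k
      using True by (cases k) (auto simp: nth_Cons')
    then have "(x # xs) ! (i - 1) \<noteq> (x # xs) ! (j - 1)"
      using 3(5) by simp
    moreover from this have "i - 1 < j - 1" "j - 1 < length (x # xs)"
      using 3(3,4) by (cases "i = 0"; cases "j = 1"; auto)+
    ultimately show ?thesis
      using 3(1)[OF True, of "i - 1" "j - 1"] unfolding nth by (simp add: True)
  next
    case False
    obtain j' where j: "j = Suc j'" using 3(3) by (cases j) auto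
    show ?thesis
    proof (cases i)
      case 0
      have "(y # xs) ! j' \<in> set (remdups_adj (y # xs))"
        using 3(4) unfolding j by (metis Suc_less_eq length_Cons nth_mem remdups_adj_set)
      then obtain k where "k < length (remdups_adj (y # xs))" "remdups_adj (y # xs) ! k = (y # xs) ! j'"
        by (metis in_set_conv_nth)
      then show ?thesis
        using False 0 j by (intro exI[of _ 0] exI[of _ "Suc k"]) simp
    next
      case (Suc k)
      then obtain i' j'' where "i' < j''" "j'' < length (remdups_adj (y # xs))"
        "remdups_adj (y # xs) ! i' = (y # xs) ! k" "remdups_adj (y # xs) ! j'' = (y # xs) ! j'"
        using 3(2)[OF False, of k j'] 3(3-) j by auto
      then show ?thesis
        using False Suc j by (intro exI[of _ "Suc i'"] exI[of _ "Suc j''"]) simp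
    qed
  qed
qed auto

text \<open>Replaces positions in the collapsed list by pairs of tuples, the form to which the rank
  condition refers.\<close>

lemma derived_orderI:
  assumes "finite E" "strong_total_order_on E T" "(s, t) \<in> T" "c s \<noteq> c t"
  shows "(c s, c t) \<in> derived_order E T c"
proof -
  let ?ts = "listing E T"
  note l = listing_props[OF assms(1,2)]
  have T: "T \<subseteq> E \<times> E" "trans T" "irrefl T"
    using assms(2) by (auto simp: strong_total_order_on_def strict_linear_order_on_def)
  obtain i j where ij: "i < length ?ts" "?ts ! i = s" "j < length ?ts" "?ts ! j = t"
    using assms(3) T(1) l(2) by (metis (no_types, lifting) in_set_conv_nth mem_Sigma_iff subsetD)
  have "\<not> j < i" "i \<noteq> j"
    using sorted_wrt_nth_less[OF l(3), of j i] ij assms(3,4) T(2,3) by (auto dest: transD irreflD)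
  then have "i < j" by simp
  then obtain i' j' where "i' < j'" "j' < length (remdups_adj (map c ?ts))"
    "remdups_adj (map c ?ts) ! i' = c s" "remdups_adj (map c ?ts) ! j' = c t"
    using remdups_adj_nth_nth[of i j "map c ?ts"] ij assms(4) by auto
  then show ?thesis
    unfolding derived_order_def collapsed_values_def by (intro CollectI exI[of _ i'] exI[of _ j']) simp
qed

lemma sorted_wrt_remdups_adj:
  fixes k :: "'v \<Rightarrow> nat"
  assumes "sorted (map k xs)" "inj_on k (set xs)"
  shows "sorted_wrt (\<lambda>u v. k u < k v) (remdups_adj xs)"
  using assms
proof (induction xs rule: remdups_adj.induct)
  case (3 x y xs)
  show ?case
  proof (cases "x = y")
    case True
    then show ?thesis using 3(1)[OF True] 3(3,4) by simp
  next
    case False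
    then have "k x \<noteq> k y" using 3(4) by (auto dest: inj_onD)
    then have "k x < k v" if "v \<in> set (y # xs)" for v
      using 3(3) that by fastforce
    moreover have "inj_on k (set (y # xs))"
      using 3(4) by (rule inj_on_subset) auto
    ultimately show ?thesis using 3(2)[OF False] 3(3) False by simp
  qed
qed auto

text \<open>Sorting by ranks that are injective on the values makes equal values adjacent. The
  collapsed list is then strictly increasing, hence distinct.\<close>

lemma derived_order_ranks:
  assumes "finite E" "strong_total_order_on E T" "sorted (map (\<lambda>t. k (c t)) (listing E T))" "inj_on k (c ` E)"
  shows "projects E T c" "derived_order E T c \<subseteq> {(u, v). u \<in> c ` E \<and> v \<in> c ` E \<and> k u < (k v :: nat)}"
proof -
  note l = listing_props[OF assms(1,2)]
  have set: "set (collapsed_values E T c) = c ` E"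
    unfolding collapsed_values_def by (simp add: l)
  have s: "sorted_wrt (\<lambda>u v. k u < k v) (collapsed_values E T c)"
    unfolding collapsed_values_def
    using assms(3,4) l(2) by (intro sorted_wrt_remdups_adj) (auto simp: comp_def)
  have "distinct vs" if "sorted_wrt (\<lambda>u v. k u < k v) vs" for vs
    using that by (induction vs) auto
  then show "projects E T c" using s unfolding projects_def by blast
  show "derived_order E T c \<subseteq> {(u, v). u \<in> c ` E \<and> v \<in> c ` E \<and> k u < k v}"
  proof
    fix p assume "p \<in> derived_order E T c"
    then obtain i j where "p = (collapsed_values E T c ! i, collapsed_values E T c ! j)"
      "i < j" "j < length (collapsed_values E T c)"
      unfolding derived_order_def by blast
    then show "p \<in> {(u, v). u \<in> c ` E \<and> v \<in> c ` E \<and> k u < k v}"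
      using sorted_wrt_nth_less[OF s, of i j] unfolding set[symmetric] by simp
  qed
qed

section \<open>Equivalence of validity and the existence of compatible ranks\<close>

definition ranks_ok ::
  "'t set \<Rightarrow> ('t \<Rightarrow> 'a \<Rightarrow> 'v) \<Rightarrow> 'a set \<Rightarrow> 'a \<Rightarrow> 'a \<Rightarrow> ('v \<Rightarrow> nat) \<Rightarrow> ('v \<Rightarrow> nat) \<Rightarrow> bool" where
  "ranks_ok R val X A B \<alpha> \<beta> \<longleftrightarrow> (\<forall>s\<in>R. \<forall>t\<in>R. (\<forall>a\<in>X. val s a = val t a) \<longrightarrow>
     (\<alpha> (val s A) = \<alpha> (val t A) \<longrightarrow> val s A = val t A) \<and>
     (\<beta> (val s B) = \<beta> (val t B) \<longrightarrow> val s B = val t B) \<and>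
     \<not> (\<alpha> (val s A) < \<alpha> (val t A) \<and> \<beta> (val t B) < \<beta> (val s B)))"

lemma partition_group_of:
  assumes "s \<in> R"
  shows "{t\<in>R. \<forall>a\<in>X. val t a = val s a} \<in> partition_groups R val X"
proof -
  let ?G = "{t\<in>R. \<forall>a\<in>X. val t a = val s a}"
  have "agree_on val X ?G"
    unfolding agree_on_def by simp
  moreover have "H = ?G" if H: "?G \<subseteq> H" "H \<subseteq> R" "agree_on val X H" for H
  proof
    have "s \<in> H" using H(1) assms by blast
    then show "H \<subseteq> ?G" using H(2,3) unfolding agree_on_def by blast
  qed (fact H(1))
  ultimately show ?thesis unfolding partition_groups_def by blast
qed

definition predecessors :: "'v rel \<Rightarrow> 'v \<Rightarrow> nat" where
  "predecessors P v = card {u. (u, v) \<in> P}"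

text \<open>The predecessors of \<open>u\<close> precede \<open>v\<close> by transitivity, and
  \<open>u\<close> itself makes the inclusion proper by irreflexivity.\<close>

lemma predecessors_less:
  assumes "finite V" "strong_partial_order_on V P" "(u, v) \<in> P"
  shows "predecessors P u < predecessors P v"
  unfolding predecessors_def
proof (rule psubset_card_mono)
  have P: "P \<subseteq> V \<times> V" "trans P" "irrefl P"
    using assms(2) by (auto simp: strong_partial_order_on_def)
  show "finite {w. (w, v) \<in> P}"
    using assms(1) P(1) by (auto intro: rev_finite_subset)
  show "{w. (w, u) \<in> P} \<subset> {w. (w, v) \<in> P}"
    using P(2,3) assms(3) by (auto dest: transD irreflD)
qed

lemma predecessors_le:
  assumes "finite V" "strong_partial_order_on V P"
  shows "predecessors P v \<le> card V"
  unfolding predecessors_def using assms by (intro card_mono) (auto simp: strong_partial_order_on_def)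

lemma oc_valid_imp_ranks:
  assumes "finite R" "unconditional_oc_valid R val X A B"
  shows "\<exists>\<alpha> \<beta>. ranks_ok R val X A B \<alpha> \<beta> \<and> (\<forall>v. \<alpha> v \<le> card R) \<and> (\<forall>v. \<beta> v \<le> card R)"
proof -
  obtain PA PB where PA: "strong_partial_order_on ((\<lambda>t. val t A) ` R) PA"
    and PB: "strong_partial_order_on ((\<lambda>t. val t B) ` R) PB"
    and w: "\<And>G. G \<in> partition_groups R val X \<Longrightarrow> \<exists>T. witness G (\<lambda>t. val t A) (\<lambda>t. val t B) T \<and>
           derived_order G T (\<lambda>t. val t A) \<subseteq> PA \<and> derived_order G T (\<lambda>t. val t B) \<subseteq> PB"
    using assms(2) unfolding unconditional_oc_valid_def by metis
  let ?\<alpha> = "predecessors PA" and ?\<beta> = "predecessors PB"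
  have less: "(u, v) \<in> PA \<Longrightarrow> ?\<alpha> u < ?\<alpha> v" "(u, v) \<in> PB \<Longrightarrow> ?\<beta> u < ?\<beta> v" for u v
    using predecessors_less[OF _ PA] predecessors_less[OF _ PB] assms(1) by auto
  have "(?\<alpha> (val s A) = ?\<alpha> (val t A) \<longrightarrow> val s A = val t A) \<and>
     (?\<beta> (val s B) = ?\<beta> (val t B) \<longrightarrow> val s B = val t B) \<and>
     \<not> (?\<alpha> (val s A) < ?\<alpha> (val t A) \<and> ?\<beta> (val t B) < ?\<beta> (val s B))"
    if st: "s \<in> R" "t \<in> R" "\<forall>a\<in>X. val s a = val t a" for s t
  proof -
    let ?G = "{u\<in>R. \<forall>a\<in>X. val u a = val s a}"
    obtain T where T: "strong_total_order_on ?G T"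
        "derived_order ?G T (\<lambda>t. val t A) \<subseteq> PA" "derived_order ?G T (\<lambda>t. val t B) \<subseteq> PB"
      using w[OF partition_group_of[OF st(1)]] unfolding witness_def by blast
    have fin: "finite ?G" using assms(1) by simp
    \<comment> \<open>Along \<open>T\<close>, each of the two ranks increases strictly wherever its
      value changes. As \<open>T\<close> compares any two distinct tuples of the group, two tuples
      cannot be ordered in opposite ways.\<close>
    have ord: "(u, v) \<in> T \<Longrightarrow> (val u A \<noteq> val v A \<longrightarrow> ?\<alpha> (val u A) < ?\<alpha> (val v A)) \<and>
        (val u B \<noteq> val v B \<longrightarrow> ?\<beta> (val u B) < ?\<beta> (val v B))" for u v
      using derived_orderI[OF fin T(1), of u v "\<lambda>t. val t A"] derived_orderI[OF fin T(1), of u v "\<lambda>t. val t B"]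
        less T(2,3) by blast
    have "s \<in> ?G" "t \<in> ?G" using st by auto
    then have "s = t \<or> (s, t) \<in> T \<or> (t, s) \<in> T"
      using T(1) unfolding strong_total_order_on_def strict_linear_order_on_def total_on_def by blast
    then show ?thesis using ord[of s t] ord[of t s] by (metis less_asym' nat_neq_iff)
  qed
  then have "ranks_ok R val X A B ?\<alpha> ?\<beta>"
    unfolding ranks_ok_def by blast
  moreover have "?\<alpha> v \<le> card R" "?\<beta> v \<le> card R" for v
    using predecessors_le[OF _ PA, of v] predecessors_le[OF _ PB, of v] assms(1)
    by (auto intro: le_trans card_image_le)
  ultimately show ?thesis by blast
qed

lemma ranks_imp_oc_valid:
  fixes R :: "'t::linorder set"
  assumes "finite R" "ranks_ok R val X A B \<alpha> \<beta>"
  shows "unconditional_oc_valid R val X A B"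
proof -
  let ?a = "\<lambda>t. val t A" and ?b = "\<lambda>t. val t B"
  let ?PA = "{(u, v). u \<in> ?a ` R \<and> v \<in> ?a ` R \<and> \<alpha> u < \<alpha> v}"
  let ?PB = "{(u, v). u \<in> ?b ` R \<and> v \<in> ?b ` R \<and> \<beta> u < \<beta> v}"
  have "strong_partial_order_on (?a ` R) ?PA" "strong_partial_order_on (?b ` R) ?PB"
    unfolding strong_partial_order_on_def by (auto simp: trans_def irrefl_def)
  moreover have "\<exists>T. witness G ?a ?b T \<and> derived_order G T ?a \<subseteq> ?PA \<and> derived_order G T ?b \<subseteq> ?PB"
    if "G \<in> partition_groups R val X" for G
  proof -
    have G: "G \<subseteq> R" "\<forall>s\<in>G. \<forall>t\<in>G. \<forall>a\<in>X. val s a = val t a"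
      using that unfolding partition_groups_def agree_on_def by blast+
    then have fin: "finite G" using assms(1) by (auto intro: finite_subset)
    have ok: "(\<alpha> (?a s) = \<alpha> (?a t) \<longrightarrow> ?a s = ?a t) \<and> (\<beta> (?b s) = \<beta> (?b t) \<longrightarrow> ?b s = ?b t) \<and>
        \<not> (\<alpha> (?a s) < \<alpha> (?a t) \<and> \<beta> (?b t) < \<beta> (?b s))" if "s \<in> G" "t \<in> G" for s t
      using assms(2) G that unfolding ranks_ok_def by blast
    \<comment> \<open>The order on the tuples, here row indices, only breaks ties between tuples
      that agree in both ranks, and hence in both values.\<close>
    define T where "T = {(s, t). s \<in> G \<and> t \<in> G \<and> (\<alpha> (?a s) < \<alpha> (?a t) \<or> \<alpha> (?a s) = \<alpha> (?a t) \<and>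
       (\<beta> (?b s) < \<beta> (?b t) \<or> \<beta> (?b s) = \<beta> (?b t) \<and> s < t))}"
    have T: "strong_total_order_on G T"
      unfolding strong_total_order_on_def strict_linear_order_on_def
      by (auto simp: T_def trans_def irrefl_def total_on_def)
    note l = listing_props[OF fin T]
    have "sorted (map (\<lambda>t. \<alpha> (?a t)) (listing G T))"
      unfolding sorted_map by (rule sorted_wrt_mono_rel[OF _ l(3)]) (auto simp: T_def)
    moreover have "inj_on \<alpha> (?a ` G)" using ok by (auto simp: inj_on_def)
    ultimately have A: "projects G T ?a"
      "derived_order G T ?a \<subseteq> {(u, v). u \<in> ?a ` G \<and> v \<in> ?a ` G \<and> \<alpha> u < \<alpha> v}"
      using derived_order_ranks[OF fin T, of \<alpha> ?a] by auto
    \<comment> \<open>This is where the compatibility of the ranks enters: if \<alpha> increases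
      strictly from \<open>s\<close> to \<open>t\<close>, then \<beta> cannot decrease.\<close>
    have "\<beta> (?b s) \<le> \<beta> (?b t)" if "(s, t) \<in> T" for s t
      using ok[of s t] that by (auto simp: T_def not_less)
    then have "sorted (map (\<lambda>t. \<beta> (?b t)) (listing G T))"
      unfolding sorted_map by (intro sorted_wrt_mono_rel[OF _ l(3)]) auto
    moreover have "inj_on \<beta> (?b ` G)" using ok by (auto simp: inj_on_def)
    ultimately have B: "projects G T ?b"
      "derived_order G T ?b \<subseteq> {(u, v). u \<in> ?b ` G \<and> v \<in> ?b ` G \<and> \<beta> u < \<beta> v}"
      using derived_order_ranks[OF fin T, of \<beta> ?b] by auto
    have "derived_order G T ?a \<subseteq> ?PA" "derived_order G T ?b \<subseteq> ?PB"
      by (rule order.trans[OF A(2)], use G(1) in blast) (rule order.trans[OF B(2)], use G(1) in blast)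
    then show ?thesis
      using T A(1) B(1) unfolding witness_def by blast
  qed
  ultimately show ?thesis unfolding unconditional_oc_valid_def by blast
qed

section \<open>Membership in NP\<close>

type_synonym cert =
  "bool list list \<times> (bool list list \<times> nat \<times> nat) list \<times> bool list list \<times> bool list \<times> bool list"

text \<open>A certificate is the instance itself, each row being extended by the ranks of its values
  at the two attributes.\<close>

abbreviation cert_schema :: "cert \<Rightarrow> bool list list" where "cert_schema d \<equiv> fst d"
abbreviation cert_rows :: "cert \<Rightarrow> (bool list list \<times> nat \<times> nat) list" where "cert_rows d \<equiv> fst (snd d)"
abbreviation cert_ctx :: "cert \<Rightarrow> bool list list" where "cert_ctx d \<equiv> fst (snd (snd d))"
abbreviation cert_A :: "cert \<Rightarrow> bool list" where "cert_A d \<equiv> fst (snd (snd (snd d)))"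
abbreviation cert_B :: "cert \<Rightarrow> bool list" where "cert_B d \<equiv> snd (snd (snd (snd d)))"

definition cert_instance :: "cert \<Rightarrow> oc_instance" where
  "cert_instance d = \<lparr>schema = cert_schema d, rows = map fst (cert_rows d), ctx_attrs = cert_ctx d,
     attr_A = cert_A d, attr_B = cert_B d\<rparr>"

text \<open>A lookup by \<open>filter\<close> and \<open>hd\<close> instead of
  \<open>map_of\<close>, to fit the closure rules.\<close>

definition cell :: "bool list list \<Rightarrow> bool list list \<Rightarrow> bool list \<Rightarrow> bool list" where
  "cell sch row a = snd (hd (filter (\<lambda>p. fst p = a) (zip sch row)))"

abbreviation cell_of :: "cert \<Rightarrow> bool list list \<times> nat \<times> nat \<Rightarrow> bool list \<Rightarrow> bool list" where
  "cell_of d p a \<equiv> cell (cert_schema d) (fst p) a"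

definition cert_wf :: "cert \<Rightarrow> bool" where
  "cert_wf d \<longleftrightarrow> distinct (cert_schema d) \<and> (\<forall>p\<in>set (cert_rows d). length (fst p) = length (cert_schema d)) \<and>
     cert_ctx d \<noteq> [] \<and> (\<forall>a\<in>set (cert_ctx d). a \<in> set (cert_schema d)) \<and>
     cert_A d \<in> set (cert_schema d) \<and> cert_B d \<in> set (cert_schema d)"

text \<open>Ranks are stored with rows and not with values. The first two conditions, on arbitrary
  pairs of rows, make them functions of the values across all groups; separation and compatibility
  are only required within a group.\<close>

definition cert_ranks :: "cert \<Rightarrow> bool" where
  "cert_ranks d \<longleftrightarrow> (\<forall>p\<in>set (cert_rows d). \<forall>q\<in>set (cert_rows d).
     (cell_of d p (cert_A d) = cell_of d q (cert_A d) \<longrightarrow> fst (snd p) = fst (snd q)) \<and>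
     (cell_of d p (cert_B d) = cell_of d q (cert_B d) \<longrightarrow> snd (snd p) = snd (snd q)) \<and>
     ((\<forall>a\<in>set (cert_ctx d). cell_of d p a = cell_of d q a) \<longrightarrow>
        (fst (snd p) = fst (snd q) \<longrightarrow> cell_of d p (cert_A d) = cell_of d q (cert_A d)) \<and>
        (snd (snd p) = snd (snd q) \<longrightarrow> cell_of d p (cert_B d) = cell_of d q (cert_B d)) \<and>
        \<not> (fst (snd p) < fst (snd q) \<and> snd (snd q) < snd (snd p))))"

lemma cell_map_of:
  assumes "a \<in> set sch" "length row = length sch"
  shows "cell sch row a = the (map_of (zip sch row) a)"
  using assms(2,1) unfolding cell_def by (induction row sch rule: list_induct2) auto

lemma tuple_value_cell:
  assumes "wf_instance I" "t < length (rows I)" "a \<in> set (schema I)"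
  shows "tuple_value I t a = cell (schema I) (rows I ! t) a"
  using assms unfolding tuple_value_def wf_instance_def by (subst cell_map_of) auto

lemma cert_wf_iff: "cert_wf d \<longleftrightarrow> wf_instance (cert_instance d)"
  unfolding cert_wf_def wf_instance_def cert_instance_def by (auto simp: subset_iff)

lemma cert_sound:
  assumes "cert_wf d" "cert_ranks d"
  shows "instance_valid (cert_instance d)"
proof -
  let ?I = "cert_instance d" and ?n = "length (cert_rows d)"
  have wf: "wf_instance ?I" using assms(1) by (simp add: cert_wf_iff)
  \<comment> \<open>The rank is read off at any row that contains the value; by the consistency
    conditions the choice does not matter.\<close>
  define \<alpha> where "\<alpha> v = fst (snd (SOME p. p \<in> set (cert_rows d) \<and> cell_of d p (cert_A d) = v))" for v
  define \<beta> where "\<beta> v = snd (snd (SOME p. p \<in> set (cert_rows d) \<and> cell_of d p (cert_B d) = v))" for v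
  have \<alpha>: "\<alpha> (cell_of d p (cert_A d)) = fst (snd p)" and \<beta>: "\<beta> (cell_of d p (cert_B d)) = snd (snd p)"
    if p: "p \<in> set (cert_rows d)" for p
  proof -
    let ?P = "\<lambda>a q. q \<in> set (cert_rows d) \<and> cell_of d q a = cell_of d p a"
    have q: "?P a (SOME q. ?P a q)" for a
      by (rule someI[of "?P a" p]) (use p in simp)
    have eq: "(cell_of d p' (cert_A d) = cell_of d p (cert_A d) \<longrightarrow> fst (snd p') = fst (snd p)) \<and>
        (cell_of d p' (cert_B d) = cell_of d p (cert_B d) \<longrightarrow> snd (snd p') = snd (snd p))"
      if "p' \<in> set (cert_rows d)" for p'
      using assms(2) that p unfolding cert_ranks_def by blast
    show "\<alpha> (cell_of d p (cert_A d)) = fst (snd p)"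
      unfolding \<alpha>_def by (rule mp[OF conjunct1[OF eq[OF conjunct1[OF q]]] conjunct2[OF q]])
    show "\<beta> (cell_of d p (cert_B d)) = snd (snd p)"
      unfolding \<beta>_def by (rule mp[OF conjunct2[OF eq[OF conjunct1[OF q]]] conjunct2[OF q]])
  qed
  have val: "tuple_value ?I t a = cell_of d (cert_rows d ! t) a" if "t < ?n" "a \<in> set (cert_schema d)" for t a
    using tuple_value_cell[OF wf, of t a] that by (simp add: cert_instance_def)
  have sch: "cert_A d \<in> set (cert_schema d)" "cert_B d \<in> set (cert_schema d)" "set (cert_ctx d) \<subseteq> set (cert_schema d)"
    using assms(1) by (auto simp: cert_wf_def)
  have "ranks_ok {..<?n} (tuple_value ?I) (set (cert_ctx d)) (cert_A d) (cert_B d) \<alpha> \<beta>"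
    unfolding ranks_ok_def
  proof (intro ballI impI)
    fix s t assume st: "s \<in> {..<?n}" "t \<in> {..<?n}"
      and X: "\<forall>a\<in>set (cert_ctx d). tuple_value ?I s a = tuple_value ?I t a"
    let ?p = "cert_rows d ! s" and ?q = "cert_rows d ! t"
    have pq: "?p \<in> set (cert_rows d)" "?q \<in> set (cert_rows d)" using st by auto
    have "\<forall>a\<in>set (cert_ctx d). cell_of d ?p a = cell_of d ?q a"
    proof
      fix a assume a: "a \<in> set (cert_ctx d)"
      then have "a \<in> set (cert_schema d)" using sch(3) by blast
      then show "cell_of d ?p a = cell_of d ?q a"
        using X a val[of s a] val[of t a] st by simp
    qed
    then have "(fst (snd ?p) = fst (snd ?q) \<longrightarrow> cell_of d ?p (cert_A d) = cell_of d ?q (cert_A d)) \<and>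
        (snd (snd ?p) = snd (snd ?q) \<longrightarrow> cell_of d ?p (cert_B d) = cell_of d ?q (cert_B d)) \<and>
        \<not> (fst (snd ?p) < fst (snd ?q) \<and> snd (snd ?q) < snd (snd ?p))"
      using bspec[OF bspec[OF assms(2)[unfolded cert_ranks_def] pq(1)] pq(2)] by blast
    then show "(\<alpha> (tuple_value ?I s (cert_A d)) = \<alpha> (tuple_value ?I t (cert_A d)) \<longrightarrow>
          tuple_value ?I s (cert_A d) = tuple_value ?I t (cert_A d)) \<and>
        (\<beta> (tuple_value ?I s (cert_B d)) = \<beta> (tuple_value ?I t (cert_B d)) \<longrightarrow>
          tuple_value ?I s (cert_B d) = tuple_value ?I t (cert_B d)) \<and>
        \<not> (\<alpha> (tuple_value ?I s (cert_A d)) < \<alpha> (tuple_value ?I t (cert_A d)) \<and>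
           \<beta> (tuple_value ?I t (cert_B d)) < \<beta> (tuple_value ?I s (cert_B d)))"
      using st pq sch by (simp add: val \<alpha> \<beta>)
  qed
  from ranks_imp_oc_valid[OF _ this] show ?thesis
    unfolding instance_valid_def by (simp add: cert_instance_def)
qed

lemma cert_complete:
  assumes "wf_instance I" "instance_valid I"
  obtains d where "cert_instance d = I" "cert_wf d" "cert_ranks d"
    "\<forall>p\<in>set (cert_rows d). fst (snd p) \<le> length (rows I) \<and> snd (snd p) \<le> length (rows I)"
proof -
  let ?n = "length (rows I)"
  obtain \<alpha> \<beta> where ok: "ranks_ok {..<?n} (tuple_value I) (set (ctx_attrs I)) (attr_A I) (attr_B I) \<alpha> \<beta>"
    and le: "\<forall>v. \<alpha> v \<le> ?n" "\<forall>v. \<beta> v \<le> ?n"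
    using oc_valid_imp_ranks[OF _ assms(2)[unfolded instance_valid_def]] by auto
  let ?c = "cell (schema I)"
  let ?d = "(schema I, map (\<lambda>r. (r, \<alpha> (?c r (attr_A I)), \<beta> (?c r (attr_B I)))) (rows I), ctx_attrs I, attr_A I, attr_B I)"
  have I: "cert_instance ?d = I"
    by (cases I) (simp add: cert_instance_def comp_def)
  have sch: "attr_A I \<in> set (schema I)" "attr_B I \<in> set (schema I)" "set (ctx_attrs I) \<subseteq> set (schema I)"
    using assms(1) by (auto simp: wf_instance_def)
  note val = tuple_value_cell[OF assms(1)]
  have "(\<alpha> (?c r (attr_A I)) = \<alpha> (?c r' (attr_A I)) \<longrightarrow> ?c r (attr_A I) = ?c r' (attr_A I)) \<and>
      (\<beta> (?c r (attr_B I)) = \<beta> (?c r' (attr_B I)) \<longrightarrow> ?c r (attr_B I) = ?c r' (attr_B I)) \<and>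
      \<not> (\<alpha> (?c r (attr_A I)) < \<alpha> (?c r' (attr_A I)) \<and> \<beta> (?c r' (attr_B I)) < \<beta> (?c r (attr_B I)))"
    if r: "r \<in> set (rows I)" "r' \<in> set (rows I)" "\<forall>a\<in>set (ctx_attrs I). ?c r a = ?c r' a" for r r'
  proof -
    obtain s t where st: "s < ?n" "rows I ! s = r" "t < ?n" "rows I ! t = r'"
      using r by (metis in_set_conv_nth)
    then have "\<forall>a\<in>set (ctx_attrs I). tuple_value I s a = tuple_value I t a"
      using r(3) val sch(3) by (metis subsetD)
    then show ?thesis
      using ok st sch(1,2) unfolding ranks_ok_def by (auto simp: val)
  qed
  then have "cert_ranks ?d" unfolding cert_ranks_def by auto
  moreover have "cert_wf ?d" unfolding cert_wf_iff I by (rule assms(1))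
  ultimately show ?thesis using that[OF I] le by simp
qed

subsection \<open>Decoding of certificates\<close>

primrec elems :: "tree \<Rightarrow> tree list" where
  "elems Leaf = []"
| "elems (Node s t) = s # elems t"

lemma pt_elems [pt_rules]: "pt f \<Longrightarrow> pt (\<lambda>a. elems (f a))"
proof (rule pt_via_tree)
  show "enc (elems t) = t" for t by (induction t) (auto simp: enc_tree_def)
qed

lemma pt_dec_bool: "pt (dec :: tree \<Rightarrow> bool)"
  unfolding dec_bool_def[abs_def] by (intro pt_not pt_Leaf pt_id)

lemma pt_dec_nat: "pt (dec :: tree \<Rightarrow> nat)"
proof (rule pt_cong[OF pt_length[OF pt_elems[OF pt_id]]])
  show "dec t = length (elems t)" for t by (induction t) auto
qed

lemma pt_dec_prod:
  assumes "pt (dec :: tree \<Rightarrow> 'a::tree_enc)" "pt (dec :: tree \<Rightarrow> 'b::tree_enc)"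
  shows "pt (dec :: tree \<Rightarrow> 'a \<times> 'b)"
proof (rule pt_cong[OF pt_Pair[OF pt_comp[OF assms(1) pt_left] pt_comp[OF assms(2) pt_right]]])
  show "dec t = (dec (left t) :: 'a, dec (right t) :: 'b)" for t
    by (cases t) (auto simp: dec_prod_def)
qed

lemma pt_dec_list:
  assumes "pt (dec :: tree \<Rightarrow> 'a::tree_enc)"
  shows "pt (dec :: tree \<Rightarrow> 'a list)"
proof (rule pt_cong)
  show "pt (\<lambda>t. map (dec :: tree \<Rightarrow> 'a) (elems t))"
    by (rule pt_map[OF pt_comp[OF assms pt_snd[OF pt_id]] pt_elems[OF pt_id]])
  show "dec t = map (dec :: tree \<Rightarrow> 'a) (elems t)" for t
    by (induction t) auto
qed

lemma pt_dec_cert: "pt (dec :: tree \<Rightarrow> cert)"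
  by (rule pt_dec_prod pt_dec_list pt_dec_nat pt_dec_bool)+

text \<open>A word is read as a postfix program that builds a tree on a stack.\<close>

definition postfix_step :: "bool \<Rightarrow> tree list \<Rightarrow> tree list" where
  "postfix_step b ts = (if b then if tl ts = [] then ts else Node (hd (tl ts)) (hd ts) # tl (tl ts) else Leaf # ts)"

definition postfix_tree :: "bool list \<Rightarrow> tree" where
  "postfix_tree u = hd (fold postfix_step u [])"

primrec postfix :: "tree \<Rightarrow> bool list" where
  "postfix Leaf = [False]"
| "postfix (Node s t) = postfix s @ postfix t @ [True]"

lemma fold_postfix: "fold postfix_step (postfix t @ u) ts = fold postfix_step u (t # ts)"
proof (induction t arbitrary: u ts)
  case (Node s t)
  show ?case
    unfolding postfix.simps append_assoc Node.IH by (simp add: postfix_step_def[of True])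
qed (simp add: postfix_step_def)

lemma postfix_tree_postfix: "postfix_tree (postfix t) = t"
  using fold_postfix[of t "[]" "[]"] by (simp add: postfix_tree_def)

lemma length_postfix: "length (postfix t) = tsize t"
  by (induction t) auto

lemma pt_postfix_tree: "pt postfix_tree"
proof -
  \<comment> \<open>Joining the two topmost trees leaves the size of the stack unchanged, and
    pushing a leaf adds 2.\<close>
  have "tsize (postfix_step b ts) \<le> tsize ts + poly [:2:] (tsize (e :: bool list) + tsize b)" for b ts e
    by (cases ts; cases "tl ts") (auto simp: postfix_step_def)
  moreover have "pt (\<lambda>p :: bool list \<times> bool \<times> tree list. postfix_step (fst (snd p)) (snd (snd p)))"
    unfolding postfix_step_def by (rule pt_const pt_id pt_Node pt_rules)+
  ultimately have "pt (\<lambda>u. hd (fold postfix_step u []))"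
    by (intro pt_hd pt_fold[where p = "[:2:]" and h = "\<lambda>_. postfix_step"]) (auto intro: pt_const pt_id)
  then show ?thesis by (rule pt_cong) (simp add: postfix_tree_def)
qed

text \<open>The first component of the state tells whether a marker (0) or a bit (1) of the self-delimiting
  string is expected, or its end has been passed (2).\<close>

definition split_step :: "bool \<Rightarrow> nat \<times> bool list \<times> bool list \<Rightarrow> nat \<times> bool list \<times> bool list" where
  "split_step b s = (if fst s = 0 then (if b then 1 else 2, snd s)
     else if fst s = 1 then (0, b # fst (snd s), snd (snd s)) else (fst s, fst (snd s), b # snd (snd s)))"

definition split_pair :: "bool list \<Rightarrow> bool list \<times> bool list" where
  "split_pair w = (let s = fold split_step w (0, [], []) in (rev (fst (snd s)), rev (snd (snd s))))"

lemma fold_split_rest: "fold split_step w (2, xs, us) = (2, xs, rev w @ us)"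
  by (induction w arbitrary: us) (auto simp: split_step_def)

lemma fold_split: "fold split_step (encode_string x @ u) (0, xs, []) = (2, rev x @ xs, rev u)"
  by (induction x arbitrary: xs)
    (auto simp: encode_string_def encode_list_def fold_split_rest split_step_def)

lemma split_pair_encode: "split_pair (encode_pair x u) = (x, u)"
  unfolding split_pair_def encode_pair_def fold_split by simp

lemma tsize_bool_le: "tsize (b :: bool) \<le> 3"
  by (cases b) auto

lemma pt_split_pair: "pt split_pair"
proof -
  have "tsize (split_step b s) \<le> tsize s + poly [:8:] (tsize (e :: bool list) + tsize b)" for b s e
    using tsize_bool_le[of b] by (cases s) (auto simp: split_step_def)
  moreover have "pt (\<lambda>p :: bool list \<times> bool \<times> nat \<times> bool list \<times> bool list. split_step (fst (snd p)) (snd (snd p)))"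
    unfolding split_step_def by (rule pt_const pt_id pt_rules)+
  ultimately have f: "pt (\<lambda>w. fold split_step w (0, [], []))"
    by (intro pt_fold[where p = "[:8:]" and h = "\<lambda>_. split_step"]) (auto intro: pt_const pt_id)
  show ?thesis
    unfolding split_pair_def Let_def by (rule f pt_rules)+
qed

section \<open>The verifier and the length of its certificates\<close>

lemma pt_cell [pt_rules]:
  assumes "pt f" "pt g" "pt h"
  shows "pt (\<lambda>a. cell (f a) (g a) (h a))"
proof -
  have "pt (\<lambda>p. cell (fst p) (fst (snd p)) (snd (snd p)))"
    unfolding cell_def by (rule pt_const pt_id pt_rules)+
  from pt_comp[OF this pt_Pair[OF assms(1) pt_Pair[OF assms(2,3)]]] show ?thesis by simp
qed

lemma pt_cert_wf: "pt cert_wf"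
  unfolding cert_wf_def[abs_def] by (rule pt_const pt_id pt_rules)+

lemma pt_cert_ranks: "pt cert_ranks"
  unfolding cert_ranks_def[abs_def] by (rule pt_const pt_id pt_rules)+

lemma pt_encode_cert: "pt (\<lambda>d. encode_instance (cert_instance d))"
  unfolding encode_instance_def cert_instance_def oc_instance.simps encode_string_def
  by (rule pt_const pt_id pt_rules)+

text \<open>Every word decodes to some certificate, since \<open>postfix_tree\<close> and
  \<open>dec\<close> are total. Comparing the encoding of its instance with \<open>x\<close> takes
  the place of parsing \<open>x\<close>.\<close>

definition verifier :: "bool list \<Rightarrow> bool list" where
  "verifier w = (let x = fst (split_pair w); d = dec (postfix_tree (snd (split_pair w)))
     in if encode_instance (cert_instance d) = x \<and> cert_wf d \<and> cert_ranks d then [True] else [])"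

lemma pt_verifier: "pt verifier"
proof -
  have d: "pt (\<lambda>w. dec (postfix_tree (snd (split_pair w))) :: cert)"
    by (rule pt_comp[OF pt_dec_cert] pt_comp[OF pt_postfix_tree] pt_snd pt_split_pair)+
  show ?thesis
    unfolding verifier_def[abs_def] Let_def
    by (rule pt_if pt_conj pt_eqI pt_eq_list pt_eq_bool pt_comp[OF pt_encode_cert d] pt_comp[OF pt_cert_wf d]
      pt_comp[OF pt_cert_ranks d] pt_fst pt_split_pair pt_const)+
qed

lemma tsize_encode_string: "tsize w \<le> 2 * length (encode_string w)"
proof -
  have "length (encode_string w) = 2 * length w + 1"
    by (induction w) (auto simp: encode_string_def encode_list_def)
  then show ?thesis using tsize_bool_list[of w] by simp
qed

lemma tsize_encode_list:
  assumes "\<And>x. tsize x \<le> 2 * length (e x)"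
  shows "tsize xs \<le> 2 * length (encode_list e xs)"
proof (induction xs)
  case (Cons x xs)
  then show ?case using assms[of x] by (simp add: encode_list_def)
qed (simp add: encode_list_def)

lemma length_encode_list: "length xs \<le> length (encode_list e xs)"
  by (induction xs) (auto simp: encode_list_def)

text \<open>Two unary ranks of value at most \<open>n\<close> enlarge a row by at most
  \<open>4 * n + 4\<close>, and there are \<open>n\<close> rows. The rest of the certificate is
  linear in the encoded instance, so the quadratic polynomial is a generous bound.\<close>

lemma tsize_cert:
  assumes "\<forall>p\<in>set (cert_rows d). fst (snd p) \<le> n \<and> snd (snd p) \<le> n" "n = length (cert_rows d)"
  shows "tsize d \<le> poly [:4, 16, 4:] (length (encode_instance (cert_instance d)))"
proof -
  let ?l = "length (encode_instance (cert_instance d))"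
  have "tsize rs \<le> tsize (map fst rs) + length rs * (4 * n + 4)"
    if "\<forall>p\<in>set rs. fst (snd p) \<le> n \<and> snd (snd p) \<le> n" for rs :: "(bool list list \<times> nat \<times> nat) list"
    using that by (induction rs) auto
  from this[OF assms(1)] have 1: "tsize (cert_rows d) \<le> tsize (map fst (cert_rows d)) + n * (4 * n + 4)"
    using assms(2) by simp
  note es = tsize_encode_list[of encode_string, OF tsize_encode_string]
  have 2: "tsize (cert_schema d) + tsize (map fst (cert_rows d)) + tsize (cert_ctx d) + tsize (cert_A d) + tsize (cert_B d)
      \<le> 2 * ?l"
    using es[of "cert_schema d"] tsize_encode_list[of "encode_list encode_string", OF es, of "map fst (cert_rows d)"]
      es[of "cert_ctx d"] tsize_encode_string[of "cert_A d"] tsize_encode_string[of "cert_B d"]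
    by (simp add: encode_instance_def cert_instance_def)
  have n: "n \<le> ?l"
    using length_encode_list[of "map fst (cert_rows d)" "encode_list encode_string"] assms(2)
    by (simp add: encode_instance_def cert_instance_def)
  have d: "tsize d = tsize (cert_schema d) + tsize (cert_rows d) + tsize (cert_ctx d) + tsize (cert_A d) + tsize (cert_B d) + 4"
    by (cases d rule: prod_cases5) simp
  have "n * (4 * n + 4) \<le> ?l * (4 * ?l + 4)"
    using n by (intro mult_le_mono) auto
  then show ?thesis
    using 1 2 unfolding d by (simp add: algebra_simps)
qed

theorem oc_in_NP: "in_NP {encode_instance I | I. wf_instance I \<and> instance_valid I}"
  unfolding in_NP_def
proof (intro exI conjI allI)
  show "polytime_computable verifier"
    by (rule polytime_computable_pt[OF pt_verifier])
  fix x
  have v: "verifier (encode_pair x u) = [True] \<longleftrightarrow> (let d = dec (postfix_tree u) in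
      encode_instance (cert_instance d) = x \<and> cert_wf d \<and> cert_ranks d)" for u
    by (simp add: verifier_def split_pair_encode Let_def)
  show "x \<in> {encode_instance I | I. wf_instance I \<and> instance_valid I} \<longleftrightarrow>
      (\<exists>u. length u \<le> poly [:4, 16, 4:] (length x) \<and> verifier (encode_pair x u) = [True])"
  proof
    assume "x \<in> {encode_instance I | I. wf_instance I \<and> instance_valid I}"
    then obtain I where I: "x = encode_instance I" "wf_instance I" "instance_valid I" by blast
    obtain d where d: "cert_instance d = I" "cert_wf d" "cert_ranks d"
      "\<forall>p\<in>set (cert_rows d). fst (snd p) \<le> length (rows I) \<and> snd (snd p) \<le> length (rows I)"
      using cert_complete[OF I(2,3)] by blast
    have "length (rows I) = length (cert_rows d)" using d(1) by (auto simp: cert_instance_def)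
    then have "tsize d \<le> poly [:4, 16, 4:] (length x)"
      using tsize_cert[OF d(4)] d(1) I(1) by simp
    then show "\<exists>u. length u \<le> poly [:4, 16, 4:] (length x) \<and> verifier (encode_pair x u) = [True]"
      using d(1-3) I(1) by (intro exI[of _ "postfix (enc d)"]) (unfold v, simp add: Let_def postfix_tree_postfix length_postfix)
  next
    assume "\<exists>u. length u \<le> poly [:4, 16, 4:] (length x) \<and> verifier (encode_pair x u) = [True]"
    then obtain u where "verifier (encode_pair x u) = [True]" by blast
    then have "encode_instance (cert_instance (dec (postfix_tree u))) = x" "cert_wf (dec (postfix_tree u))"
      "cert_ranks (dec (postfix_tree u))"
      unfolding v Let_def by simp_all
    then show "x \<in> {encode_instance I | I. wf_instance I \<and> instance_valid I}"
      using cert_sound cert_wf_iff by blast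
  qed
qed

section \<open>Reduction from satisfiability\<close>

type_synonym var = "nat list"
type_synonym lit = "bool \<times> var"
type_synonym cnf = "lit list list"

definition satisfies :: "(var \<Rightarrow> bool) \<Rightarrow> cnf \<Rightarrow> bool" where
  "satisfies v F \<longleftrightarrow> (\<forall>C\<in>set F. \<exists>l\<in>set C. v (snd l) = fst l)"

definition nat_string :: "nat \<Rightarrow> bool list" where
  "nat_string n = replicate n True @ [False]"

definition var_string :: "var \<Rightarrow> bool list" where
  "var_string = encode_list nat_string"

definition clause_string :: "lit list \<Rightarrow> bool list" where
  "clause_string = encode_list (\<lambda>l. fst l # var_string (snd l))"

text \<open>A position is named by the clause itself and not by the place of the clause in the
  formula. A repeated clause thus only repeats its rows.\<close>

definition pos_string :: "lit list \<Rightarrow> nat \<Rightarrow> bool list" where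
  "pos_string C j = clause_string C @ nat_string j"

lemma nat_string_prefix_free: "nat_string m @ u = nat_string n @ v \<Longrightarrow> m = n \<and> u = v"
proof (induction m arbitrary: n)
  case 0
  then show ?case by (cases n) (auto simp: nat_string_def)
next
  case (Suc m)
  then show ?case by (cases n) (auto simp: nat_string_def)
qed

lemma var_string_prefix_free: "var_string x @ u = var_string y @ v \<Longrightarrow> x = y \<and> u = v"
  unfolding var_string_def using nat_string_prefix_free by (rule encode_list_prefix_free)

lemma clause_string_prefix_free: "clause_string C @ u = clause_string D @ v \<Longrightarrow> C = D \<and> u = v"
  unfolding clause_string_def
  by (rule encode_list_prefix_free) (auto simp: prod_eq_iff dest: var_string_prefix_free)

lemma var_string_inject [simp]: "var_string x = var_string y \<longleftrightarrow> x = y"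
  using var_string_prefix_free[of x "[]" y "[]"] by auto

lemma pos_string_inject [simp]: "pos_string C i = pos_string D j \<longleftrightarrow> C = D \<and> i = j"
  unfolding pos_string_def
  using clause_string_prefix_free[of C "nat_string i" D "nat_string j"] nat_string_prefix_free[of i "[]" j "[]"]
  by auto

text \<open>The positions \<open>0, \<dots>, n\<close> of a clause with \<open>n\<close> literals lie on a cycle, whose edges are the
  literals and an additional positive literal with the variable \<open>[]\<close>. The three tuples of the link
  of an edge force the edge and the two \<open>B\<close>-values of its variable to be ordered in the same way (or
  in opposite ways, for a negative literal). As the order must be acyclic, the literals of the
  cycle cannot have the same truth value.\<close>

definition link_rows :: "lit list \<Rightarrow> nat \<Rightarrow> nat \<Rightarrow> lit \<Rightarrow> bool list list list" where
  "link_rows C i j l =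
     [[pos_string C i, if fst l then pos_string C i else pos_string C j, False # var_string (snd l)],
      [pos_string C i, if fst l then pos_string C j else pos_string C i, False # var_string (snd l)],
      [pos_string C i, if fst l then pos_string C j else pos_string C i, True # var_string (snd l)]]"

text \<open>The context value of an edge is its starting position, so every edge of a cycle forms
  its own group. The last link closes the cycle.\<close>

definition clause_rows :: "lit list \<Rightarrow> bool list list list" where
  "clause_rows C = concat (map (\<lambda>i. link_rows C i (Suc i) (hd (drop i C))) [0..<length C]) @
     link_rows C (length C) 0 (True, [])"

definition cnf_instance :: "cnf \<Rightarrow> oc_instance" where
  "cnf_instance F = \<lparr>schema = [[], [True], [False]], rows = concat (map clause_rows F),
     ctx_attrs = [[]], attr_A = [True], attr_B = [False]\<rparr>"

lemma mem_clause_rows: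
  "r \<in> set (clause_rows C) \<longleftrightarrow> (\<exists>i<length C. r \<in> set (link_rows C i (Suc i) (C ! i))) \<or>
     r \<in> set (link_rows C (length C) 0 (True, []))"
  unfolding clause_rows_def by (auto simp: hd_drop_conv_nth)

lemma mem_link_rows: "r \<in> set (link_rows C i j l) \<Longrightarrow> length r = 3 \<and> r ! 0 = pos_string C i"
  by (auto simp: link_rows_def)

lemma length_row: "r \<in> set (rows (cnf_instance F)) \<Longrightarrow> length r = 3"
  by (auto simp: cnf_instance_def mem_clause_rows dest: mem_link_rows)

lemma wf_cnf_instance: "wf_instance (cnf_instance F)"
  using length_row[of _ F] by (auto simp: wf_instance_def cnf_instance_def)

definition pair_ok :: "(bool list \<Rightarrow> nat) \<Rightarrow> (bool list \<Rightarrow> nat) \<Rightarrow> bool list list \<Rightarrow> bool list list \<Rightarrow> bool" where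
  "pair_ok \<alpha> \<beta> r r' \<longleftrightarrow> (\<alpha> (r ! 1) = \<alpha> (r' ! 1) \<longrightarrow> r ! 1 = r' ! 1) \<and>
     (\<beta> (r ! 2) = \<beta> (r' ! 2) \<longrightarrow> r ! 2 = r' ! 2) \<and>
     \<not> (\<alpha> (r ! 1) < \<alpha> (r' ! 1) \<and> \<beta> (r' ! 2) < \<beta> (r ! 2))"

lemma instance_valid_cnf_instance:
  "instance_valid (cnf_instance F) \<longleftrightarrow> (\<exists>\<alpha> \<beta>. \<forall>r\<in>set (rows (cnf_instance F)).
     \<forall>r'\<in>set (rows (cnf_instance F)). r ! 0 = r' ! 0 \<longrightarrow> pair_ok \<alpha> \<beta> r r')"
proof -
  let ?I = "cnf_instance F"
  have val: "tuple_value ?I t [] = rows ?I ! t ! 0" "tuple_value ?I t [True] = rows ?I ! t ! 1"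
    "tuple_value ?I t [False] = rows ?I ! t ! 2" if "t < length (rows ?I)" for t
  proof -
    have "length (rows ?I ! t) = 3" by (rule length_row[OF nth_mem[OF that]])
    then obtain x y z where "rows ?I ! t = [x, y, z]"
      by (auto simp: numeral_3_eq_3 length_Suc_conv)
    moreover have "schema ?I = [[], [True], [False]]" by (simp add: cnf_instance_def)
    ultimately show "tuple_value ?I t [] = rows ?I ! t ! 0" "tuple_value ?I t [True] = rows ?I ! t ! 1"
      "tuple_value ?I t [False] = rows ?I ! t ! 2"
      by (simp_all add: tuple_value_def)
  qed
  have "instance_valid ?I \<longleftrightarrow>
      (\<exists>\<alpha> \<beta>. ranks_ok {..<length (rows ?I)} (tuple_value ?I) {[]} [True] [False] \<alpha> \<beta>)"
    using oc_valid_imp_ranks[of "{..<length (rows ?I)}" "tuple_value ?I" "{[]}" "[True]" "[False]"]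
      ranks_imp_oc_valid[of "{..<length (rows ?I)}" "tuple_value ?I" "{[]}" "[True]" "[False]"]
    unfolding instance_valid_def by (auto simp: cnf_instance_def)
  moreover have "ranks_ok {..<length (rows ?I)} (tuple_value ?I) {[]} [True] [False] \<alpha> \<beta> \<longleftrightarrow>
      (\<forall>r\<in>set (rows ?I). \<forall>r'\<in>set (rows ?I). r ! 0 = r' ! 0 \<longrightarrow> pair_ok \<alpha> \<beta> r r')" for \<alpha> \<beta>
    unfolding ranks_ok_def pair_ok_def all_set_conv_all_nth using val by auto
  ultimately show ?thesis by simp
qed

text \<open>The first and the third row differ in both attributes. Within a group, both pairs of
  values must then be separated and ordered in the same way; for a negative literal the exchanged
  \<open>A\<close>-values reverse one of the two comparisons.\<close>

lemma link_ok:
  assumes "i \<noteq> j"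
  shows "(\<forall>r\<in>set (link_rows C i j l). \<forall>r'\<in>set (link_rows C i j l). pair_ok \<alpha> \<beta> r r') \<longleftrightarrow>
    \<alpha> (pos_string C i) \<noteq> \<alpha> (pos_string C j) \<and>
    \<beta> (False # var_string (snd l)) \<noteq> \<beta> (True # var_string (snd l)) \<and>
    (\<alpha> (pos_string C i) < \<alpha> (pos_string C j) \<longleftrightarrow>
      (\<beta> (False # var_string (snd l)) < \<beta> (True # var_string (snd l))) = fst l)"
  using assms unfolding link_rows_def pair_ok_def by (cases "fst l") auto

text \<open>The empty clause is excluded because its closing edge would be a loop at position 0,
  whose link can be satisfied although the clause cannot.\<close>

lemma sat_if_valid:
  assumes "instance_valid (cnf_instance F)" "[] \<notin> set F"
  shows "\<exists>v. satisfies v F"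
proof -
  obtain \<alpha> \<beta> where ok: "\<And>r r'. r \<in> set (rows (cnf_instance F)) \<Longrightarrow> r' \<in> set (rows (cnf_instance F)) \<Longrightarrow>
      r ! 0 = r' ! 0 \<Longrightarrow> pair_ok \<alpha> \<beta> r r'"
    using assms(1) unfolding instance_valid_cnf_instance by blast
  define t where "t x \<longleftrightarrow> \<beta> (False # var_string x) < \<beta> (True # var_string x)" for x
  have "\<exists>l\<in>set C. (t (snd l) \<noteq> t []) = fst l" if C: "C \<in> set F" for C
  proof (rule ccontr)
    \<comment> \<open>Now every literal has the same value as the closing literal, so that \<alpha>
      is strictly monotone all around the cycle.\<close>
    assume *: "\<not> ?thesis"
    let ?n = "length C" and ?a = "\<lambda>i. \<alpha> (pos_string C i)"
    have n: "?n > 0" using C assms(2) by auto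
    have link: "?a i \<noteq> ?a j \<and> (?a i < ?a j \<longleftrightarrow> t (snd l) = fst l)"
      if "set (link_rows C i j l) \<subseteq> set (clause_rows C)" "i \<noteq> j" for i j l
    proof -
      have "set (link_rows C i j l) \<subseteq> set (rows (cnf_instance F))"
        using that(1) C by (auto simp: cnf_instance_def)
      then have "\<forall>r\<in>set (link_rows C i j l). \<forall>r'\<in>set (link_rows C i j l). pair_ok \<alpha> \<beta> r r'"
        using ok mem_link_rows by (metis subsetD)
      then show ?thesis using link_ok[OF that(2)] unfolding t_def by blast
    qed
    have step: "?a i \<noteq> ?a (Suc i) \<and> (?a i < ?a (Suc i) \<longleftrightarrow> t [])" if "i < ?n" for i
    proof -
      have "set (link_rows C i (Suc i) (C ! i)) \<subseteq> set (clause_rows C)"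
        using that by (auto simp: mem_clause_rows)
      moreover have "\<not> ((t (snd (C ! i)) \<noteq> t []) = fst (C ! i))"
        using * nth_mem[OF that] by blast
      ultimately show ?thesis using link[of i "Suc i" "C ! i"] by auto
    qed
    have last: "?a ?n \<noteq> ?a 0 \<and> (?a ?n < ?a 0 \<longleftrightarrow> t [])"
      using link[of ?n 0 "(True, [])"] n by (auto simp: mem_clause_rows subset_iff)
    show False
    proof (cases "t []")
      case True
      have "?a 0 \<le> ?a i" if "i \<le> ?n" for i
        using that
      proof (induction i)
        case (Suc i)
        then show ?case using step[of i] True by simp
      qed simp
      from this[of ?n] show False using last True by simp
    next
      case False
      have "?a i \<le> ?a 0" if "i \<le> ?n" for i
        using that
      proof (induction i)
        case (Suc i)
        then show ?case using step[of i] False by simp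
      qed simp
      from this[of ?n] show False using last False by simp
    qed
  qed
  \<comment> \<open>Comparing with \<open>t []\<close> complements the assignment if the closing
    literal is true, so that this literal counts as false.\<close>
  then have "satisfies (\<lambda>x. t x \<noteq> t []) F" unfolding satisfies_def by blast
  then show ?thesis by blast
qed

text \<open>The string beginning with \<open>False\<close> is below its partner iff the variable is
  true. Equal ranks for different variables are harmless, since only rows of one group are compared
  and they mention one variable.\<close>

definition var_rank :: "(var \<Rightarrow> bool) \<Rightarrow> bool list \<Rightarrow> nat" where
  "var_rank v s = (if hd s = v (inv var_string (tl s)) then 1 else 0)"

text \<open>With \<open>n\<close> the length of the clause, a true literal raises the rank by
  \<open>n + 1\<close> and a false one lowers it by 1. Position 0 has rank \<open>n\<close>. One
  true literal lifts position \<open>n\<close> to at least \<open>n + 2\<close>, so the closing edge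
  descends, as it must for a false literal.\<close>

definition pos_rank :: "(var \<Rightarrow> bool) \<Rightarrow> bool list \<Rightarrow> nat" where
  "pos_rank v s = (case inv (\<lambda>(C, i). pos_string C i) s of (C, i) \<Rightarrow>
     (length C + 2) * length (filter (\<lambda>l. v (snd l) = fst l) (take i C)) + (length C - i))"

lemma var_rank: "var_rank v (b # var_string x) = (if b = v x then 1 else 0)"
  by (simp add: var_rank_def inv_f_f inj_def)

lemma pos_rank: "pos_rank v (pos_string C i) =
    (length C + 2) * length (filter (\<lambda>l. v (snd l) = fst l) (take i C)) + (length C - i)"
proof -
  have "inj (\<lambda>(C, i). pos_string C i)" by (auto simp: inj_def)
  from inv_f_f[OF this, of "(C, i)"] show ?thesis by (simp add: pos_rank_def)
qed

lemma valid_if_sat: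
  assumes "satisfies v F" "\<And>C l. C \<in> set F \<Longrightarrow> l \<in> set C \<Longrightarrow> snd l \<noteq> []"
  shows "instance_valid (cnf_instance F)"
proof -
  \<comment> \<open>The reserved variable is made false, as the descending closing edges require; it
    does not occur in \<open>F\<close>.\<close>
  define w where "w x \<longleftrightarrow> x \<noteq> [] \<and> v x" for x
  let ?\<alpha> = "pos_rank w" and ?\<beta> = "var_rank w"
  have link: "\<forall>r\<in>set (link_rows C i (Suc i) (C ! i)). \<forall>r'\<in>set (link_rows C i (Suc i) (C ! i)). pair_ok ?\<alpha> ?\<beta> r r'"
    if "i < length C" for C i
  proof -
    have "i \<noteq> Suc i" by simp
    then show ?thesis
      using that unfolding link_ok[OF \<open>i \<noteq> Suc i\<close>] by (auto simp: pos_rank var_rank take_Suc_conv_app_nth)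
  qed
  have last: "\<forall>r\<in>set (link_rows C (length C) 0 (True, [])). \<forall>r'\<in>set (link_rows C (length C) 0 (True, [])).
      pair_ok ?\<alpha> ?\<beta> r r'" if C: "C \<in> set F" for C
  proof -
    obtain l where l: "l \<in> set C" "v (snd l) = fst l"
      using assms(1) C by (auto simp: satisfies_def)
    then have "w (snd l) = fst l" using assms(2)[OF C] by (simp add: w_def)
    then have "filter (\<lambda>l. w (snd l) = fst l) C \<noteq> []" using l by (auto simp: filter_empty_conv)
    then have "1 \<le> length (filter (\<lambda>l. w (snd l) = fst l) C)" by (simp add: Suc_le_eq)
    then have "length C < (length C + 2) * length (filter (\<lambda>l. w (snd l) = fst l) C)"
      by (rule less_le_trans[OF _ mult_le_mono2, rotated]) simp
    moreover have "length C \<noteq> 0" using l by auto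
    ultimately show ?thesis
      unfolding link_ok[OF \<open>length C \<noteq> 0\<close>] by (auto simp: pos_rank var_rank w_def)
  qed
  have "pair_ok ?\<alpha> ?\<beta> r r'"
    if r: "r \<in> set (rows (cnf_instance F))" "r' \<in> set (rows (cnf_instance F))" "r ! 0 = r' ! 0" for r r'
  proof -
    obtain C C' where C: "C \<in> set F" "r \<in> set (clause_rows C)" "C' \<in> set F" "r' \<in> set (clause_rows C')"
      using r(1,2) by (auto simp: cnf_instance_def)
    let ?L = "\<lambda>C i. set (if i < length C then link_rows C i (Suc i) (C ! i) else link_rows C (length C) 0 (True, []))"
    have mem: "\<exists>i. r \<in> ?L C i \<and> r ! 0 = pos_string C i" if rC: "r \<in> set (clause_rows C)" for r C
    proof -
      consider i where "i < length C" "r \<in> set (link_rows C i (Suc i) (C ! i))"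
        | "r \<in> set (link_rows C (length C) 0 (True, []))"
        using rC unfolding mem_clause_rows by blast
      then show ?thesis
      proof cases
        case 1
        then show ?thesis using mem_link_rows[OF 1(2)] by (intro exI[of _ i] conjI) simp_all
      next
        case 2
        then show ?thesis using mem_link_rows[OF 2] by (intro exI[of _ "length C"] conjI) simp_all
      qed
    qed
    obtain i where i: "r \<in> ?L C i" "r ! 0 = pos_string C i"
      using mem[OF C(2)] by (elim exE conjE)
    obtain i' where i': "r' \<in> ?L C' i'" "r' ! 0 = pos_string C' i'"
      using mem[OF C(4)] by (elim exE conjE)
    have eq: "C' = C" "i' = i" using r(3) unfolding i(2) i'(2) by simp_all
    show ?thesis
    proof (cases "i < length C")
      case True
      then have "r \<in> set (link_rows C i (Suc i) (C ! i))" "r' \<in> set (link_rows C i (Suc i) (C ! i))"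
        using i(1) i'(1) unfolding eq by simp_all
      then show ?thesis using link[OF True] by blast
    next
      case False
      then have "r \<in> set (link_rows C (length C) 0 (True, []))" "r' \<in> set (link_rows C (length C) 0 (True, []))"
        using i(1) i'(1) unfolding eq by simp_all
      then show ?thesis using last[OF C(1)] by blast
    qed
  qed
  then show ?thesis unfolding instance_valid_cnf_instance by blast
qed

section \<open>Polynomial-time computability of the reduction from formulas\<close>

lemma pt_nat_string [pt_rules]: "pt f \<Longrightarrow> pt (\<lambda>a. nat_string (f a))"
  unfolding nat_string_def by (rule pt_const pt_rules | assumption)+

lemma pt_var_string [pt_rules]: "pt f \<Longrightarrow> pt (\<lambda>a. var_string (f a))"
  unfolding var_string_def by (rule pt_const pt_id pt_rules | assumption)+

lemma pt_pos_string [pt_rules]: "pt f \<Longrightarrow> pt g \<Longrightarrow> pt (\<lambda>a. pos_string (f a) (g a))"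
  unfolding pos_string_def clause_string_def by (rule pt_const pt_id pt_rules | assumption)+

lemma pt_encode_cnf: "pt (\<lambda>F. encode_instance (cnf_instance F))"
  unfolding encode_instance_def cnf_instance_def oc_instance.simps encode_string_def clause_rows_def link_rows_def
  by (rule pt_const pt_id pt_rules)+

section \<open>Computations as satisfiability problems\<close>

subsection \<open>Single steps of a machine\<close>

definition cell_at :: "config \<Rightarrow> nat \<Rightarrow> int \<Rightarrow> nat" where
  "cell_at c k z = fst (snd c ! k) z"

definition head_at :: "config \<Rightarrow> nat \<Rightarrow> int" where
  "head_at c k = snd (snd c ! k)"

definition scanned :: "config \<Rightarrow> nat list" where
  "scanned c = map (\<lambda>(f, h). f h) (snd c)"

text \<open>A halted machine is regarded as rewriting the scanned symbols.\<close>

definition action :: "turing_machine \<Rightarrow> nat \<Rightarrow> nat list \<Rightarrow> nat \<times> (nat \<times> move) list" where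
  "action M q ss = (case delta M q ss of None \<Rightarrow> (q, map (\<lambda>s. (s, Stay)) ss) | Some a \<Rightarrow> a)"

text \<open>Offset by one to stay within the natural numbers: the head moves from column
  \<open>i\<close> to \<open>i + shift d - 1\<close>.\<close>

primrec shift :: "move \<Rightarrow> nat" where
  "shift Go_Left = 0"
| "shift Stay = 1"
| "shift Go_Right = 2"

text \<open>The bound on the head positions confines \<open>N\<close> steps to the columns 0 to
  \<open>2 * N\<close> of the tableau.\<close>

definition config_ok :: "turing_machine \<Rightarrow> nat \<Rightarrow> config \<Rightarrow> bool" where
  "config_ok M t c \<longleftrightarrow> length (snd c) = num_tapes M \<and> fst c < num_states M \<and>
     (\<forall>k<num_tapes M. (\<forall>z. cell_at c k z < num_symbols M) \<and> \<bar>head_at c k\<bar> \<le> int t)"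

lemma scanned_nth: "k < length (snd c) \<Longrightarrow> scanned c ! k = cell_at c k (head_at c k)"
  by (simp add: scanned_def cell_at_def head_at_def case_prod_beta)

lemma length_scanned: "length (scanned c) = length (snd c)"
  by (simp add: scanned_def)

lemma step_action: "step M c = (fst (action M (fst c) (scanned c)), map2 act (snd (action M (fst c) (scanned c))) (snd c))"
proof (cases "delta M (fst c) (scanned c)")
  case None
  have "map2 act (map (\<lambda>s. (s, Stay)) (scanned c)) (snd c) = snd c"
    unfolding scanned_def by (intro nth_equalityI) (auto split: prod.splits)
  then show ?thesis
    using None by (simp add: step_def next_action_def action_def scanned_def[symmetric])
next
  case (Some a)
  then show ?thesis
    by (simp add: step_def next_action_def action_def scanned_def[symmetric] split: prod.splits)
qed

lemma action_ok:
  assumes "wf_tm M" "q < num_states M" "length ss = num_tapes M" "\<forall>s\<in>set ss. s < num_symbols M"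
  shows "fst (action M q ss) < num_states M" "length (snd (action M q ss)) = num_tapes M"
    "\<forall>a\<in>set (snd (action M q ss)). fst a < num_symbols M"
proof -
  have "fst (action M q ss) < num_states M \<and> length (snd (action M q ss)) = num_tapes M \<and>
    (\<forall>a\<in>set (snd (action M q ss)). fst a < num_symbols M)"
  proof (cases "delta M q ss")
    case None
    then show ?thesis using assms by (auto simp: action_def)
  next
    case (Some a)
    then have "fst a < num_states M \<and> length (snd a) = num_tapes M \<and> (\<forall>(s, d)\<in>set (snd a). s < num_symbols M)"
      using assms unfolding wf_tm_def by (metis prod.collapse)
    then show ?thesis using Some by (auto simp: action_def)
  qed
  then show "fst (action M q ss) < num_states M" "length (snd (action M q ss)) = num_tapes M"
    "\<forall>a\<in>set (snd (action M q ss)). fst a < num_symbols M"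
    by blast+
qed

lemma scanned_ok:
  assumes "config_ok M t c"
  shows "length (scanned c) = num_tapes M" "\<forall>s\<in>set (scanned c). s < num_symbols M"
  using assms by (auto simp: config_ok_def length_scanned in_set_conv_nth scanned_nth)

lemma step_components:
  assumes "wf_tm M" "config_ok M t c" "k < num_tapes M"
  defines "a \<equiv> snd (action M (fst c) (scanned c)) ! k"
  shows "cell_at (step M c) k z = (if z = head_at c k then fst a else cell_at c k z)"
    and "head_at (step M c) k = head_at c k + int (shift (snd a)) - 1"
proof -
  have "length (snd (action M (fst c) (scanned c))) = num_tapes M" "length (snd c) = num_tapes M"
    using action_ok(2)[OF assms(1) _ scanned_ok[OF assms(2)]] assms(2) by (auto simp: config_ok_def)
  then have "snd (step M c) ! k = act a (snd c ! k)"
    using assms(3) by (simp add: step_action a_def)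
  then show "cell_at (step M c) k z = (if z = head_at c k then fst a else cell_at c k z)"
    "head_at (step M c) k = head_at c k + int (shift (snd a)) - 1"
    by (cases a; cases "snd c ! k"; cases "snd a"; simp add: cell_at_def head_at_def)+
qed

lemma config_ok_step:
  assumes "wf_tm M" "config_ok M t c"
  shows "config_ok M (Suc t) (step M c)"
proof -
  have c: "fst c < num_states M" "length (snd c) = num_tapes M"
    using assms(2) by (auto simp: config_ok_def)
  note a = action_ok[OF assms(1) c(1) scanned_ok[OF assms(2)]]
  have "length (snd (step M c)) = num_tapes M" "fst (step M c) < num_states M"
    using a c by (simp_all add: step_action)
  moreover have "cell_at (step M c) k z < num_symbols M" "\<bar>head_at (step M c) k\<bar> \<le> int (Suc t)"
    if k: "k < num_tapes M" for k z
  proof -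
    let ?a = "snd (action M (fst c) (scanned c)) ! k"
    have "fst ?a < num_symbols M" using a k by simp
    then show "cell_at (step M c) k z < num_symbols M"
      using assms(2) k by (simp add: step_components[OF assms k] config_ok_def)
    have "\<bar>head_at c k\<bar> \<le> int t" using assms(2) k by (simp add: config_ok_def)
    then show "\<bar>head_at (step M c) k\<bar> \<le> int (Suc t)"
      unfolding step_components[OF assms k] by (cases "snd ?a") auto
  qed
  ultimately show ?thesis unfolding config_ok_def by blast
qed

lemma initial_config_components:
  assumes "k < num_tapes M"
  shows "cell_at (initial_config M w) k z = (if k = 0 then word_contents w z else 0)"
    and "head_at (initial_config M w) k = 0"
  using assms by (cases k; simp add: cell_at_def head_at_def initial_config_def word_contents_def)+

lemma config_ok_funpow:
  assumes "wf_tm M"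
  shows "config_ok M t ((step M ^^ t) (initial_config M w))"
proof (induction t)
  case 0
  have "length (snd (initial_config M w)) = num_tapes M" "fst (initial_config M w) < num_states M"
    using assms by (auto simp: wf_tm_def initial_config_def)
  moreover have "word_contents w z < num_symbols M" for z
    using assms by (auto simp: wf_tm_def word_contents_def)
  ultimately show ?case
    using assms by (auto simp: config_ok_def initial_config_components wf_tm_def)
next
  case (Suc t)
  then show ?case using config_ok_step[OF assms] by simp
qed

subsection \<open>The tableau of a computation\<close>

definition horn :: "var list \<Rightarrow> var \<Rightarrow> lit list" where
  "horn ps c = map (\<lambda>x. (False, x)) ps @ [(True, c)]"

lemma horn_sat: "(\<exists>l\<in>set (horn ps c). v (snd l) = fst l) \<longleftrightarrow> ((\<forall>x\<in>set ps. v x) \<longrightarrow> v c)"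
  by (auto simp: horn_def)

lemma satisfies_simps:
  "satisfies v []" "satisfies v (C # F) \<longleftrightarrow> (\<exists>l\<in>set C. v (snd l) = fst l) \<and> satisfies v F"
  "satisfies v (F @ G) \<longleftrightarrow> satisfies v F \<and> satisfies v G"
  "satisfies v (concat (map f xs)) \<longleftrightarrow> (\<forall>x\<in>set xs. satisfies v (f x))"
  "satisfies v (map g xs) \<longleftrightarrow> (\<forall>x\<in>set xs. \<exists>l\<in>set (g x). v (snd l) = fst l)"
  by (auto simp: satisfies_def)

text \<open>Variables of the tableau, at time \<open>t\<close>: \<open>[0, k, t, i, s]\<close> means that column \<open>i\<close> of tape \<open>k\<close>
  contains \<open>s\<close>; \<open>[1, k, t, i]\<close> that its head is in column \<open>i\<close>; \<open>[2, t, q]\<close> that the state is \<open>q\<close>;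
  \<open>[3, k, t, s]\<close> that the head of tape \<open>k\<close> scans \<open>s\<close>. Column \<open>N\<close> is position 0 of the tapes. The
  clauses only propagate the positive facts of a computation, so that a satisfying assignment may
  make more facts true than those; the final clauses forbid the undesired results. The only choice
  is in the columns of the certificate, whose length is at most \<open>P\<close>.\<close>

definition init_clauses :: "nat \<Rightarrow> bool list \<Rightarrow> nat \<Rightarrow> nat \<Rightarrow> nat \<Rightarrow> cnf" where
  "init_clauses K e P N W =
     [[(True, [2, 0, 0])]] @
     map (\<lambda>k. [(True, [1, k, 0, N])]) [0..<K] @
     concat (map (\<lambda>k. map (\<lambda>i. [(True, [0, k, 0, i, 0])]) [0..<W]) [1..<K]) @
     map (\<lambda>i. [(True, [0, 0, 0, i, 0])]) [0..<N] @
     map (\<lambda>j. [(True, [0, 0, 0, N + j, if hd (drop j e) then 2 else 1])]) [0..<length e] @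
     map (\<lambda>j. [(True, [0, 0, 0, N + length e + j, 0]), (True, [0, 0, 0, N + length e + j, 1]),
       (True, [0, 0, 0, N + length e + j, 2])]) [0..<P] @
     map (\<lambda>j. horn [[0, 0, 0, N + length e + j, 0]] [0, 0, 0, Suc (N + length e + j), 0]) [0..<P] @
     map (\<lambda>i. [(True, [0, 0, 0, N + length e + P + i, 0])]) [0..<W]"

definition read_clauses :: "nat \<Rightarrow> nat \<Rightarrow> nat \<Rightarrow> nat \<Rightarrow> cnf" where
  "read_clauses K S W t = concat (map (\<lambda>k. concat (map (\<lambda>i. map (\<lambda>s.
     horn [[1, k, t, i], [0, k, t, i, s]] [3, k, t, s]) [0..<S]) [0..<W])) [0..<K])"

text \<open>The premise names a column \<open>i\<close> other than \<open>j\<close> in which the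
  head is. That the head is not in column \<open>j\<close> would be a negative fact, which cannot be
  a premise of forward propagation.\<close>

definition frame_clauses :: "nat \<Rightarrow> nat \<Rightarrow> nat \<Rightarrow> nat \<Rightarrow> cnf" where
  "frame_clauses K S W t = concat (map (\<lambda>k. concat (map (\<lambda>i. concat (map (\<lambda>j. map (\<lambda>s.
     horn [[1, k, t, i], [0, k, t, j, s]] [0, k, Suc t, j, s]) [0..<S]) (filter (\<lambda>j. j \<noteq> i) [0..<W]))) [0..<W])) [0..<K])"

type_synonym rule = "nat \<times> (nat \<times> nat) list \<times> nat \<times> (nat \<times> nat \<times> nat) list"

text \<open>The transition function is tabulated as first-order data with a tree encoding: state,
  scanned symbols, next state and, for each tape, the symbol written and the move.\<close>

definition tm_rule :: "turing_machine \<Rightarrow> nat \<Rightarrow> nat list \<Rightarrow> rule" where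
  "tm_rule M q ss = (q, zip [0..<num_tapes M] ss, fst (action M q ss),
     map (\<lambda>k. (k, fst (snd (action M q ss) ! k), shift (snd (snd (action M q ss) ! k)))) [0..<num_tapes M])"

definition tm_rules :: "turing_machine \<Rightarrow> rule list" where
  "tm_rules M = concat (map (\<lambda>q. map (tm_rule M q) (List.n_lists (num_tapes M) [0..<num_symbols M])) [0..<num_states M])"

definition rule_premises :: "nat \<Rightarrow> rule \<Rightarrow> var list" where
  "rule_premises t r = [2, t, fst r] # map (\<lambda>x. [3, fst x, t, snd x]) (fst (snd r))"

definition rule_clauses :: "nat \<Rightarrow> nat \<Rightarrow> rule \<Rightarrow> cnf" where
  "rule_clauses W t r = horn (rule_premises t r) [2, Suc t, fst (snd (snd r))] #
     concat (map (\<lambda>a. concat (map (\<lambda>i.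
       [horn ([1, fst a, t, i] # rule_premises t r) [0, fst a, Suc t, i, fst (snd a)],
        horn ([1, fst a, t, i] # rule_premises t r) [1, fst a, Suc t, i + snd (snd a) - 1]])
       [0..<W])) (snd (snd (snd r))))"

text \<open>The actual symbol of every cell is a derived fact. Excluding all symbols but 2 and then
  all but the blank in the first two output cells forces the output \<open>[True]\<close>.\<close>

definition final_clauses :: "nat \<Rightarrow> nat \<Rightarrow> cnf" where
  "final_clauses S N = map (\<lambda>s. [(False, [0, 1, N, N, s])]) (filter (\<lambda>s. s \<noteq> 2) [0..<S]) @
     map (\<lambda>s. [(False, [0, 1, N, Suc N, s])]) [1..<S]"

definition tableau :: "turing_machine \<Rightarrow> bool list \<Rightarrow> nat \<Rightarrow> nat \<Rightarrow> nat \<Rightarrow> cnf" where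
  "tableau M e P N W = init_clauses (num_tapes M) e P N W @
     concat (map (\<lambda>t. read_clauses (num_tapes M) (num_symbols M) W t @
       frame_clauses (num_tapes M) (num_symbols M) W t @
       concat (map (rule_clauses W t) (tm_rules M))) [0..<N]) @
     final_clauses (num_symbols M) N"

lemma satisfies_init_clauses:
  "satisfies v (init_clauses K e P N W) \<longleftrightarrow>
     v [2, 0, 0] \<and> (\<forall>k<K. v [1, k, 0, N]) \<and> (\<forall>k i. 1 \<le> k \<and> k < K \<and> i < W \<longrightarrow> v [0, k, 0, i, 0]) \<and>
     (\<forall>i<N. v [0, 0, 0, i, 0]) \<and> (\<forall>j<length e. v [0, 0, 0, N + j, if e ! j then 2 else 1]) \<and>
     (\<forall>j<P. v [0, 0, 0, N + length e + j, 0] \<or> v [0, 0, 0, N + length e + j, 1] \<or> v [0, 0, 0, N + length e + j, 2]) \<and>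
     (\<forall>j<P. v [0, 0, 0, N + length e + j, 0] \<longrightarrow> v [0, 0, 0, Suc (N + length e + j), 0]) \<and>
     (\<forall>i<W. v [0, 0, 0, N + length e + P + i, 0])"
  unfolding init_clauses_def satisfies_simps horn_sat by (auto simp: hd_drop_conv_nth satisfies_simps(1))

lemma satisfies_read_clauses:
  "satisfies v (read_clauses K S W t) \<longleftrightarrow>
     (\<forall>k i s. k < K \<and> i < W \<and> s < S \<and> v [1, k, t, i] \<and> v [0, k, t, i, s] \<longrightarrow> v [3, k, t, s])"
  unfolding read_clauses_def satisfies_simps horn_sat by auto

lemma satisfies_frame_clauses:
  "satisfies v (frame_clauses K S W t) \<longleftrightarrow>
     (\<forall>k i j s. k < K \<and> i < W \<and> j < W \<and> j \<noteq> i \<and> s < S \<and> v [1, k, t, i] \<and> v [0, k, t, j, s] \<longrightarrow>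
        v [0, k, Suc t, j, s])"
  unfolding frame_clauses_def satisfies_simps horn_sat by auto

lemma rule_premises_sat:
  assumes "length ss = num_tapes M"
  shows "(\<forall>x\<in>set (rule_premises t (tm_rule M q ss)). v x) \<longleftrightarrow>
    v [2, t, q] \<and> (\<forall>k<num_tapes M. v [3, k, t, ss ! k])"
proof -
  have "zip [0..<num_tapes M] ss = map (\<lambda>k. (k, ss ! k)) [0..<num_tapes M]"
    using assms by (intro nth_equalityI) auto
  then show ?thesis by (auto simp: rule_premises_def tm_rule_def)
qed

lemma satisfies_rule_clauses:
  assumes "length ss = num_tapes M"
  shows "satisfies v (rule_clauses W t (tm_rule M q ss)) \<longleftrightarrow>
    (v [2, t, q] \<and> (\<forall>k<num_tapes M. v [3, k, t, ss ! k]) \<longrightarrow> v [2, Suc t, fst (action M q ss)] \<and>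
      (\<forall>k<num_tapes M. \<forall>i<W. v [1, k, t, i] \<longrightarrow>
         v [0, k, Suc t, i, fst (snd (action M q ss) ! k)] \<and>
         v [1, k, Suc t, i + shift (snd (snd (action M q ss) ! k)) - 1]))"
proof -
  have s: "snd (snd (snd (tm_rule M q ss))) =
      map (\<lambda>k. (k, fst (snd (action M q ss) ! k), shift (snd (snd (action M q ss) ! k)))) [0..<num_tapes M]"
    "fst (snd (snd (tm_rule M q ss))) = fst (action M q ss)"
    by (simp_all add: tm_rule_def)
  have c: "(\<forall>y\<in>set (x # xs). v y) \<longleftrightarrow> v x \<and> (\<forall>y\<in>set xs. v y)" for x xs
    by simp
  show ?thesis
    unfolding rule_clauses_def satisfies_simps horn_sat c rule_premises_sat[OF assms] s by (auto simp: satisfies_simps(1))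
qed

lemma satisfies_final_clauses:
  "satisfies v (final_clauses S N) \<longleftrightarrow>
     (\<forall>s<S. s \<noteq> 2 \<longrightarrow> \<not> v [0, 1, N, N, s]) \<and> (\<forall>s<S. s \<noteq> 0 \<longrightarrow> \<not> v [0, 1, N, Suc N, s])"
  unfolding final_clauses_def satisfies_simps by (auto simp: Suc_le_eq)

lemma satisfies_tm_rules:
  "satisfies v (concat (map (rule_clauses W t) (tm_rules M))) \<longleftrightarrow>
    (\<forall>q ss. q < num_states M \<and> length ss = num_tapes M \<and> (\<forall>s\<in>set ss. s < num_symbols M) \<longrightarrow>
       satisfies v (rule_clauses W t (tm_rule M q ss)))"
  unfolding satisfies_simps tm_rules_def by (auto simp: set_n_lists subset_iff)

lemma satisfies_tableau:
  "satisfies v (tableau M e P N W) \<longleftrightarrow>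
     satisfies v (init_clauses (num_tapes M) e P N W) \<and>
     (\<forall>t<N. satisfies v (read_clauses (num_tapes M) (num_symbols M) W t) \<and>
        satisfies v (frame_clauses (num_tapes M) (num_symbols M) W t) \<and>
        satisfies v (concat (map (rule_clauses W t) (tm_rules M)))) \<and>
     satisfies v (final_clauses (num_symbols M) N)"
  unfolding tableau_def satisfies_simps by auto

lemma tableau_nonempty: "[] \<notin> set (tableau M e P N W)"
  by (auto simp: tableau_def init_clauses_def read_clauses_def frame_clauses_def rule_clauses_def
      final_clauses_def horn_def)

lemma tableau_vars: "C \<in> set (tableau M e P N W) \<Longrightarrow> l \<in> set C \<Longrightarrow> snd l \<noteq> []"
  by (auto simp: tableau_def init_clauses_def read_clauses_def frame_clauses_def rule_clauses_def
      final_clauses_def horn_def rule_premises_def)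

section \<open>Satisfying assignments contain accepting computations\<close>

lemma word_contents_nth: "j < length w \<Longrightarrow> word_contents w (int j) = (if w ! j then 2 else 1)"
  by (simp add: word_contents_def)

lemma word_contents_beyond: "int (length w) \<le> z \<Longrightarrow> word_contents w z = 0"
  by (simp add: word_contents_def)

lemma word_contents_negative: "z < 0 \<Longrightarrow> word_contents w z = 0"
  by (simp add: word_contents_def)

lemma init_clauses_sound:
  assumes "satisfies v (init_clauses K e P N W)"
  obtains u where "length u \<le> P" "\<forall>i<W. v [0, 0, 0, i, word_contents (e @ u) (int i - int N)]"
proof -
  have blank: "\<And>i. i < N \<Longrightarrow> v [0, 0, 0, i, 0]" "\<And>i. i < W \<Longrightarrow> v [0, 0, 0, N + length e + P + i, 0]"
    and e: "\<And>j. j < length e \<Longrightarrow> v [0, 0, 0, N + j, if e ! j then 2 else 1]"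
    and choice: "\<And>j. j < P \<Longrightarrow> v [0, 0, 0, N + length e + j, 0] \<or> v [0, 0, 0, N + length e + j, 1] \<or>
      v [0, 0, 0, N + length e + j, 2]"
    and "next": "\<And>j. j < P \<Longrightarrow> v [0, 0, 0, N + length e + j, 0] \<Longrightarrow> v [0, 0, 0, Suc (N + length e + j), 0]"
    using assms unfolding satisfies_init_clauses by blast+
  define b where "b j s = v [0, 0, 0, N + length e + j, s]" for j s
  \<comment> \<open>The certificate ends at its first column that may be blank. Blanks propagate to
    the right from there, while each earlier column offers a bit.\<close>
  define J where "J = (LEAST j. j = P \<or> b j 0)"
  have J: "J \<le> P" "J = P \<or> b J 0"
    using Least_le[of "\<lambda>j. j = P \<or> b j 0" P] LeastI[of "\<lambda>j. j = P \<or> b j 0" P] unfolding J_def by simp_all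
  have before: "\<not> b j 0" "j < P" if "j < J" for j
    using not_less_Least[of j "\<lambda>j. j = P \<or> b j 0"] that J(1) unfolding J_def by auto
  have after: "b j 0" if "J \<le> j" "j < P" for j
    using that
  proof (induction j rule: dec_induct)
    case base
    then show ?case using J by auto
  next
    case (step j)
    then show ?case using "next"[of j] by (simp add: b_def)
  qed
  \<comment> \<open>If an assignment allows both bits in a column, the bit 1 (symbol 2) is taken;
    the fact for the chosen bit holds in either case.\<close>
  let ?u = "map (\<lambda>j. b j 2) [0..<J]"
  have "v [0, 0, 0, i, word_contents (e @ ?u) (int i - int N)]" if i: "i < W" for i
  proof -
    consider (1) "i < N" | (2) j where "i = N + j" "j < length e" | (3) j where "i = N + length e + j" "j < P"
      | (4) j where "i = N + length e + P + j"
    proof (cases "i < N + length e + P")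
      case True
      then show ?thesis
        using 1 2[of "i - N"] 3[of "i - N - length e"] by (cases "i < N"; cases "i < N + length e"; simp)
    next
      case False
      then show ?thesis using 4[of "i - (N + length e + P)"] by simp
    qed
    then show ?thesis
    proof cases
      case 1
      then show ?thesis using blank(1) by (simp add: word_contents_negative)
    next
      case 2
      have "word_contents (e @ ?u) (int j) = (if e ! j then 2 else 1)"
        using 2(2) by (subst word_contents_nth) (auto simp: nth_append)
      moreover have "int i - int N = int j" using 2(1) by simp
      ultimately show ?thesis using e[OF 2(2)] 2(1) by simp
    next
      case 3
      have z: "int i - int N = int (length e + j)" using 3(1) by simp
      show ?thesis
      proof (cases "j < J")
        case True
        then have w: "word_contents (e @ ?u) (int (length e + j)) = (if b j 2 then 2 else 1)"
          by (subst word_contents_nth) (auto simp: nth_append)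
        have "b j 1 \<or> b j 2" using choice[OF 3(2)] before[OF True] unfolding b_def by blast
        then have "b j (if b j 2 then 2 else 1)" by auto
        then show ?thesis unfolding z w unfolding b_def 3(1) .
      next
        case False
        then have w: "word_contents (e @ ?u) (int (length e + j)) = 0"
          by (intro word_contents_beyond) simp
        show ?thesis unfolding z w using after[of j] False 3 by (simp add: b_def)
      qed
    next
      case 4
      then have w: "word_contents (e @ ?u) (int i - int N) = 0"
        using J(1) by (intro word_contents_beyond) simp
      have "j < W" using 4 i by simp
      then show ?thesis unfolding w using blank(2) 4 by simp
    qed
  qed
  moreover have "length ?u \<le> P" using J(1) by simp
  ultimately show ?thesis using that[of ?u] by blast
qed

lemma tableau_step:
  assumes "wf_tm M" "satisfies v (tableau M e P N W)" "2 * N \<le> W" "t < N" "config_ok M t c"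
    and state: "v [2, t, fst c]"
    and head: "\<And>k i. k < num_tapes M \<Longrightarrow> int i - int N = head_at c k \<Longrightarrow> v [1, k, t, i]"
    and cell: "\<And>k i. k < num_tapes M \<Longrightarrow> i < W \<Longrightarrow> v [0, k, t, i, cell_at c k (int i - int N)]"
  shows "v [2, Suc t, fst (step M c)]"
    and "k < num_tapes M \<Longrightarrow> int i - int N = head_at (step M c) k \<Longrightarrow> v [1, k, Suc t, i]"
    and "k < num_tapes M \<Longrightarrow> i < W \<Longrightarrow> v [0, k, Suc t, i, cell_at (step M c) k (int i - int N)]"
proof -
  have "read": "\<And>k i s. k < num_tapes M \<Longrightarrow> i < W \<Longrightarrow> s < num_symbols M \<Longrightarrow> v [1, k, t, i] \<Longrightarrow>
      v [0, k, t, i, s] \<Longrightarrow> v [3, k, t, s]"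
    and frame: "\<And>k i j s. k < num_tapes M \<Longrightarrow> i < W \<Longrightarrow> j < W \<Longrightarrow> j \<noteq> i \<Longrightarrow> s < num_symbols M \<Longrightarrow>
      v [1, k, t, i] \<Longrightarrow> v [0, k, t, j, s] \<Longrightarrow> v [0, k, Suc t, j, s]"
    and rules: "\<And>q ss. q < num_states M \<Longrightarrow> length ss = num_tapes M \<Longrightarrow> (\<forall>s\<in>set ss. s < num_symbols M) \<Longrightarrow>
      satisfies v (rule_clauses W t (tm_rule M q ss))"
    using assms(2,4) unfolding satisfies_tableau satisfies_read_clauses satisfies_frame_clauses satisfies_tm_rules
    by blast+
  \<comment> \<open>The column of the head. As \<open>t < N\<close>, it lies inside the tableau and
    to the right of column 0, so that the subtraction giving the next column is not
    truncated.\<close>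
  let ?h = "\<lambda>k. nat (head_at c k + int N)" and ?ss = "scanned c"
  note ss = scanned_ok[OF assms(5)]
  have c: "fst c < num_states M" "\<And>k z. k < num_tapes M \<Longrightarrow> cell_at c k z < num_symbols M"
    "\<And>k. k < num_tapes M \<Longrightarrow> \<bar>head_at c k\<bar> \<le> int t" "length (snd c) = num_tapes M"
    using assms(5) by (auto simp: config_ok_def)
  have h: "int (?h k) - int N = head_at c k" "?h k < W" "0 < ?h k" if "k < num_tapes M" for k
    using c(3)[OF that] assms(3,4) by auto
  have vh: "v [1, k, t, ?h k]" if "k < num_tapes M" for k
    using head[OF that] h[OF that] by blast
  have scan: "v [3, k, t, ?ss ! k]" if "k < num_tapes M" for k
    using "read"[OF that h(2)[OF that] _ vh[OF that], of "?ss ! k"] cell[OF that h(2)[OF that]] c(2)[OF that] h(1)[OF that]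
    by (simp add: scanned_nth c(4) that)
  let ?a = "\<lambda>k. snd (action M (fst c) ?ss) ! k"
  have step: "v [2, Suc t, fst (action M (fst c) ?ss)]"
    "\<And>k i. k < num_tapes M \<Longrightarrow> i < W \<Longrightarrow> v [1, k, t, i] \<Longrightarrow>
       v [0, k, Suc t, i, fst (?a k)] \<and> v [1, k, Suc t, i + shift (snd (?a k)) - 1]"
    using rules[OF c(1) ss] state scan unfolding satisfies_rule_clauses[OF ss(1)] by blast+
  show "v [2, Suc t, fst (step M c)]"
    using step(1) by (simp add: step_action)
  show "v [1, k, Suc t, i]" if k: "k < num_tapes M" and i: "int i - int N = head_at (step M c) k"
  proof -
    have "i = ?h k + shift (snd (?a k)) - 1"
      using i h[OF k] unfolding step_components(2)[OF assms(1,5) k] by linarith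
    then show ?thesis using step(2)[OF k h(2)[OF k] vh[OF k]] by simp
  qed
  show "v [0, k, Suc t, i, cell_at (step M c) k (int i - int N)]" if k: "k < num_tapes M" and i: "i < W"
  proof (cases "i = ?h k")
    case True
    then show ?thesis
      using step(2)[OF k h(2)[OF k] vh[OF k]] h(1)[OF k] by (simp add: step_components(1)[OF assms(1,5) k])
  next
    case False
    then have "int i - int N \<noteq> head_at c k" using h[OF k] by linarith
    then show ?thesis
      using frame[OF k h(2)[OF k] i False c(2)[OF k] vh[OF k] cell[OF k i]]
      by (simp add: step_components(1)[OF assms(1,5) k])
  qed
qed

lemma tableau_sound:
  assumes "wf_tm M" "satisfies v (tableau M e P N W)" "2 * N + 2 \<le> W" "N \<ge> 1"
  obtains u where "length u \<le> P"
    "cell_at ((step M ^^ N) (initial_config M (e @ u))) 1 0 = 2"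
    "cell_at ((step M ^^ N) (initial_config M (e @ u))) 1 1 = 0"
proof -
  have init: "satisfies v (init_clauses (num_tapes M) e P N W)"
    using assms(2) unfolding satisfies_tableau by blast
  obtain u where u: "length u \<le> P" "\<forall>i<W. v [0, 0, 0, i, word_contents (e @ u) (int i - int N)]"
    using init_clauses_sound[OF init] by blast
  let ?c = "\<lambda>t. (step M ^^ t) (initial_config M (e @ u))"
  have main: "v [2, t, fst (?c t)] \<and>
      (\<forall>k i. k < num_tapes M \<and> int i - int N = head_at (?c t) k \<longrightarrow> v [1, k, t, i]) \<and>
      (\<forall>k i. k < num_tapes M \<and> i < W \<longrightarrow> v [0, k, t, i, cell_at (?c t) k (int i - int N)])" if "t \<le> N" for t
    using that
  proof (induction t)
    case 0
    have "fst (initial_config M (e @ u)) = 0" by (simp add: initial_config_def)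
    moreover have "v [0, k, 0, i, if k = 0 then word_contents (e @ u) (int i - int N) else 0]"
      if "k < num_tapes M" "i < W" for k i
      using u(2) that init[unfolded satisfies_init_clauses] by auto
    ultimately show ?case
      using init[unfolded satisfies_init_clauses] by (auto simp: initial_config_components)
  next
    case (Suc t)
    have t: "t < N" "2 * N \<le> W" using Suc.prems assms(3) by auto
    have IH: "v [2, t, fst (?c t)]" "\<And>k i. k < num_tapes M \<Longrightarrow> int i - int N = head_at (?c t) k \<Longrightarrow> v [1, k, t, i]"
      "\<And>k i. k < num_tapes M \<Longrightarrow> i < W \<Longrightarrow> v [0, k, t, i, cell_at (?c t) k (int i - int N)]"
      using Suc.IH t by auto
    note s = tableau_step[OF assms(1,2) t(2,1) config_ok_funpow[OF assms(1)] IH]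
    have "?c (Suc t) = step M (?c t)" by simp
    then show ?case using s by presburger
  qed
  have tapes: "1 < num_tapes M" using assms(1) by (simp add: wf_tm_def)
  have m: "v [0, 1, N, i, cell_at (?c N) 1 (int i - int N)]" if "i < W" for i
    using main[OF order.refl] tapes that by blast
  have "cell_at (?c N) 1 z < num_symbols M" for z
    using config_ok_funpow[OF assms(1), of N "e @ u"] tapes by (simp add: config_ok_def)
  moreover have "v [0, 1, N, N, cell_at (?c N) 1 0]" "v [0, 1, N, Suc N, cell_at (?c N) 1 1]"
    using m[of N] m[of "Suc N"] assms(3) by simp_all
  moreover have "satisfies v (final_clauses (num_symbols M) N)"
    using assms(2) unfolding satisfies_tableau by blast
  ultimately have "cell_at (?c N) 1 0 = 2" "cell_at (?c N) 1 1 = 0"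
    unfolding satisfies_final_clauses by blast+
  then show ?thesis using that u(1) by blast
qed

section \<open>Accepting computations satisfy the tableau\<close>

definition holds :: "(nat \<Rightarrow> config) \<Rightarrow> nat \<Rightarrow> var \<Rightarrow> bool" where
  "holds c N x \<longleftrightarrow>
     (if x ! 0 = 0 then cell_at (c (x ! 2)) (x ! 1) (int (x ! 3) - int N) = x ! 4
      else if x ! 0 = 1 then head_at (c (x ! 2)) (x ! 1) = int (x ! 3) - int N
      else if x ! 0 = 2 then fst (c (x ! 1)) = x ! 2
      else cell_at (c (x ! 2)) (x ! 1) (head_at (c (x ! 2)) (x ! 1)) = x ! 3)"

lemma holds_simps:
  "holds c N [0, k, t, i, s] \<longleftrightarrow> cell_at (c t) k (int i - int N) = s"
  "holds c N [1, k, t, i] \<longleftrightarrow> head_at (c t) k = int i - int N"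
  "holds c N [2, t, q] \<longleftrightarrow> fst (c t) = q"
  "holds c N [3, k, t, s] \<longleftrightarrow> cell_at (c t) k (head_at (c t) k) = s"
  by (simp_all add: holds_def)

lemma tableau_complete:
  fixes e u :: "bool list"
  assumes "wf_tm M" "length u \<le> P"
  defines "c \<equiv> \<lambda>t. (step M ^^ t) (initial_config M (e @ u))"
  assumes "cell_at (c N) 1 0 = 2" "cell_at (c N) 1 1 = 0"
  shows "satisfies (holds c N) (tableau M e P N W)"
proof -
  have ok: "config_ok M t (c t)" for t
    unfolding c_def by (rule config_ok_funpow[OF assms(1)])
  have step: "c (Suc t) = step M (c t)" for t
    by (simp add: c_def)
  have c0: "fst (c 0) = 0" "cell_at (c 0) k z = (if k = 0 then word_contents (e @ u) z else 0)" "head_at (c 0) k = 0"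
    if "k < num_tapes M" for k z
    using initial_config_components[OF that] by (simp_all add: c_def initial_config_def)
  have tapes: "0 < num_tapes M" using assms(1) by (simp add: wf_tm_def)
  have symbols: "word_contents w z = 0 \<or> word_contents w z = 1 \<or> word_contents w z = 2" for w z
    by (simp add: word_contents_def)
  have mono: "word_contents w (int j) = 0 \<Longrightarrow> word_contents w (1 + int j) = 0" for w j
    by (auto simp: word_contents_def split: if_splits)
  have "satisfies (holds c N) (init_clauses (num_tapes M) e P N W)"
    unfolding satisfies_init_clauses holds_simps
  proof (intro conjI allI impI)
    show "cell_at (c 0) 0 (int (N + j) - int N) = (if e ! j then 2 else 1)" if "j < length e" for j
      using word_contents_nth[of j "e @ u"] that tapes by (simp add: c0 nth_append)
    show "cell_at (c 0) 0 (int (Suc (N + length e + j)) - int N) = 0"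
      if "cell_at (c 0) 0 (int (N + length e + j) - int N) = 0" for j
      using mono[of "e @ u" "length e + j"] that tapes by (simp add: c0 algebra_simps)
    show "cell_at (c 0) 0 (int (N + length e + P + i) - int N) = 0" for i
      using tapes assms(2) by (simp add: c0 word_contents_beyond)
    show "cell_at (c 0) 0 (int (N + length e + j) - int N) = 0 \<or>
        cell_at (c 0) 0 (int (N + length e + j) - int N) = 1 \<or>
        cell_at (c 0) 0 (int (N + length e + j) - int N) = 2" for j
      using tapes symbols by (simp add: c0)
  qed (use tapes in \<open>auto simp: c0 word_contents_negative\<close>)
  moreover have "satisfies (holds c N) (read_clauses (num_tapes M) (num_symbols M) W t)" for t
    unfolding satisfies_read_clauses holds_simps by auto
  moreover have "satisfies (holds c N) (frame_clauses (num_tapes M) (num_symbols M) W t)" for t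
    unfolding satisfies_frame_clauses holds_simps by (auto simp: step step_components(1)[OF assms(1) ok])
  moreover have "satisfies (holds c N) (concat (map (rule_clauses W t) (tm_rules M)))" if t: "t < N" for t
    unfolding satisfies_tm_rules
  proof (intro allI impI, elim conjE)
    fix q and ss :: "nat list" assume q: "q < num_states M" and ss: "length ss = num_tapes M"
    have "fst (step M (c t)) = fst (action M q ss) \<and> (\<forall>k<num_tapes M. \<forall>i<W. head_at (c t) k = int i - int N \<longrightarrow>
        cell_at (step M (c t)) k (int i - int N) = fst (snd (action M q ss) ! k) \<and>
        head_at (step M (c t)) k = int (i + shift (snd (snd (action M q ss) ! k)) - 1) - int N)"
      if s: "fst (c t) = q" "\<forall>k<num_tapes M. cell_at (c t) k (head_at (c t) k) = ss ! k"
    proof -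
      have "length (snd (c t)) = num_tapes M" using ok by (simp add: config_ok_def)
      then have a: "action M (fst (c t)) (scanned (c t)) = action M q ss"
        using s ss by (intro arg_cong2[where f = "action M"] nth_equalityI) (auto simp: length_scanned scanned_nth)
      show ?thesis
      proof (intro conjI allI impI)
        show "fst (step M (c t)) = fst (action M q ss)"
          by (simp add: step_action a)
        fix k i assume k: "k < num_tapes M" and h: "head_at (c t) k = int i - int N"
        show "cell_at (step M (c t)) k (int i - int N) = fst (snd (action M q ss) ! k)"
          unfolding step_components(1)[OF assms(1) ok k] a h by simp
        have "\<bar>head_at (c t) k\<bar> \<le> int t" using ok[of t] k by (simp add: config_ok_def)
        then have "1 \<le> i" using h t by linarith
        then show "head_at (step M (c t)) k = int (i + shift (snd (snd (action M q ss) ! k)) - 1) - int N"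
          unfolding step_components(2)[OF assms(1) ok k] a h by (simp add: of_nat_diff)
      qed
    qed
    then show "satisfies (holds c N) (rule_clauses W t (tm_rule M q ss))"
      unfolding satisfies_rule_clauses[OF ss] holds_simps step by blast
  qed
  moreover have "satisfies (holds c N) (final_clauses (num_symbols M) N)"
    unfolding satisfies_final_clauses holds_simps using assms(4,5) by simp
  ultimately show ?thesis unfolding satisfies_tableau by blast
qed

text \<open>The machine is fixed, so its rule table and its numbers of tapes and symbols are
  constants; nothing about the computability of \<open>delta\<close> is required.\<close>

lemma pt_tableau:
  assumes "pt e" "pt P" "pt N" "pt W"
  shows "pt (\<lambda>x. tableau M (e x) (P x) (N x) (W x))"
proof -
  have "pt (\<lambda>y. tableau M (fst y) (fst (snd y)) (fst (snd (snd y))) (snd (snd (snd y))))"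
    unfolding tableau_def init_clauses_def read_clauses_def frame_clauses_def rule_clauses_def rule_premises_def
      final_clauses_def horn_def
    by (rule pt_const pt_id pt_rules)+
  from pt_comp[OF this pt_Pair[OF assms(1) pt_Pair[OF assms(2) pt_Pair[OF assms(3,4)]]]] show ?thesis
    by simp
qed

text \<open>Bits are never blank, so a blank second cell ends the word. Acceptance is thereby
  visible in two cells.\<close>

lemma word_contents_True: "word_contents w 0 = 2 \<and> word_contents w 1 = 0 \<longleftrightarrow> w = [True]"
  by (cases w; cases "tl w") (auto simp: word_contents_def)

theorem oc_NP_hard: "NP_hard {encode_instance I | I. wf_instance I \<and> instance_valid I}"
  unfolding NP_hard_def
proof (intro allI impI)
  fix L assume "in_NP L"
  then obtain f and p :: "nat poly" where f: "polytime_computable f"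
    and L: "\<And>x. x \<in> L \<longleftrightarrow> (\<exists>u. length u \<le> poly p (length x) \<and> f (encode_pair x u) = [True])"
    unfolding in_NP_def by blast
  obtain M and q :: "nat poly" where M: "wf_tm M" "computes_in_time M f (poly q)"
    using f unfolding polytime_computable_def by blast
  define P where "P x = poly p (length x)" for x :: "bool list"
  \<comment> \<open>A common clock for all certificates of length at most \<open>P x\<close>: a
    machine that halts earlier keeps its configuration until time \<open>N x\<close>.\<close>
  define N where "N x = Suc (poly q (length (encode_string x) + P x))" for x
  define W where "W x = 2 * N x + 2" for x
  define F where "F x = tableau M (encode_string x) (P x) (N x) (W x)" for x
  have out: "f (encode_string x @ u) = [True] \<longleftrightarrow>
      cell_at ((step M ^^ N x) (initial_config M (encode_string x @ u))) 1 0 = 2 \<and>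
      cell_at ((step M ^^ N x) (initial_config M (encode_string x @ u))) 1 1 = 0"
    if u: "length u \<le> P x" for x u
  proof -
    let ?w = "encode_string x @ u"
    let ?T = "poly q (length ?w)"
    have h: "halted M ((step M ^^ ?T) (initial_config M ?w))"
      "fst (snd ((step M ^^ ?T) (initial_config M ?w)) ! 1) = word_contents (f ?w)"
      using M(2) unfolding computes_in_time_def Let_def by blast+
    have "?T \<le> N x"
      unfolding N_def using u by (intro le_SucI poly_nat_mono) simp
    from step_funpow_halted[OF h(1) this] h(2)
    have "cell_at ((step M ^^ N x) (initial_config M ?w)) 1 = word_contents (f ?w)"
      by (simp add: cell_at_def fun_eq_iff)
    then show ?thesis by (simp add: word_contents_True)
  qed
  have sat: "x \<in> L \<longleftrightarrow> (\<exists>v. satisfies v (F x))" for x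
  proof
    assume "x \<in> L"
    then obtain u where u: "length u \<le> P x" "f (encode_string x @ u) = [True]"
      unfolding L P_def encode_pair_def by blast
    then show "\<exists>v. satisfies v (F x)"
      unfolding F_def using tableau_complete[OF M(1) u(1)] out[OF u(1)] by blast
  next
    assume "\<exists>v. satisfies v (F x)"
    then obtain v where v: "satisfies v (tableau M (encode_string x) (P x) (N x) (W x))"
      unfolding F_def by blast
    obtain u where u: "length u \<le> P x"
      "cell_at ((step M ^^ N x) (initial_config M (encode_string x @ u))) 1 0 = 2"
      "cell_at ((step M ^^ N x) (initial_config M (encode_string x @ u))) 1 1 = 0"
      using tableau_sound[OF M(1) v] by (auto simp: W_def N_def)
    then show "x \<in> L"
      using out[OF u(1)] unfolding L P_def encode_pair_def by blast
  qed
  have "pt (\<lambda>x. encode_instance (cnf_instance (F x)))"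
    unfolding F_def W_def N_def P_def
    by (rule pt_comp[OF pt_encode_cnf pt_tableau] pt_const pt_id pt_rules)+
  then have "polytime_computable (\<lambda>x. encode_instance (cnf_instance (F x)))"
    by (rule polytime_computable_pt)
  moreover have "x \<in> L \<longleftrightarrow> encode_instance (cnf_instance (F x)) \<in>
      {encode_instance I | I. wf_instance I \<and> instance_valid I}" for x
  proof -
    \<comment> \<open>By injectivity of the encoding, the string cannot also encode a different
      instance that is valid.\<close>
    have "encode_instance (cnf_instance (F x)) \<in> {encode_instance I | I. wf_instance I \<and> instance_valid I} \<longleftrightarrow>
        instance_valid (cnf_instance (F x))"
      using inj_encode_instance wf_cnf_instance by (auto dest: injD)
    moreover have "[] \<notin> set (F x)" "\<And>C l. C \<in> set (F x) \<Longrightarrow> l \<in> set C \<Longrightarrow> snd l \<noteq> []"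
      unfolding F_def using tableau_nonempty tableau_vars by blast+
    ultimately show ?thesis
      unfolding sat using sat_if_valid[of "F x"] valid_if_sat[of _ "F x"] by blast
  qed
  ultimately show "polytime_reducible L {encode_instance I | I. wf_instance I \<and> instance_valid I}"
    unfolding polytime_reducible_def by blast
qed

theorem theorem5:
  shows "NP_complete {encode_instance I | I. wf_instance I \<and> instance_valid I}"
  unfolding NP_complete_def using oc_in_NP oc_NP_hard by blast

end
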